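(* Consider the generalized incremental knapsack problem (defined in the context). For any accuracy level $\epsilon\in(0,1)$, there is an algorithm that, on every instance, computes a feasible chain whose profit is at least $(1-\epsilon)$ times the maximum profit of a feasible chain, in time $O\big(|\mathcal{I}|^{O((\frac{1}{\epsilon}\log|\mathcal{I}|)^{O(1)})}\big)$, where $|\mathcal{I}|=\Theta(n\log \|w\|_{\infty} + nT\log \|p\|_{\infty} + T\log \|W\|_{\infty})$ is the input size. In particular, the problem admits a quasi-polynomial time approximation scheme.
   Context: Generalized incremental knapsack: we are given $n$ items with strictly positive weights $w_1,\dots,w_n$, $T$ time periods with non-decreasing capacities $W_1 \le \cdots \le W_T$, and non-negative profits $p_{it}$ for $i\in[n]$, $t\in[T]$. A chain is a sequence $\mathcal{S}=(S_1,\dots,S_T)$ with $S_1\subseteq\cdots\subseteq S_T\subseteq[n]$; it is feasible if $w(S_t)=\sum_{i\in S_t}w_i\le W_t$ for every $t\in[T]$. Its profit is $\Phi(\mathcal{S})=\sum_{t\in[T]}\sum_{i\in S_t\setminus S_{t-1}}p_{it}$, with $S_0=\emptyset$. The goal is to find a feasible chain of maximum profit. *)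

theory Defs
  imports Complex_Main "HOL-Library.Log_Nat"
begin

section \<open>The generalized incremental knapsack problem\<close>

text \<open>Items are numbered from 1 to \<open>items I\<close> and periods from 1 to \<open>periods I\<close>; the values of
  \<open>weight\<close>, \<open>capacity\<close> and \<open>gain\<close> outside these ranges are irrelevant. All data are natural
  numbers, as the input size counts binary digits; \<open>gain I i t\<close> is the profit \<open>p\<^sub>i\<^sub>t\<close>.\<close>

record gik =
  items :: nat
  periods :: nat
  weight :: "nat \<Rightarrow> nat"
  capacity :: "nat \<Rightarrow> nat"
  gain :: "nat \<Rightarrow> nat \<Rightarrow> nat"

definition gik_instance :: "gik \<Rightarrow> bool" where
  "gik_instance I \<longleftrightarrow>
     items I \<ge> 1 \<and> periods I \<ge> 1 \<and>
     (\<forall>i\<in>{1..items I}. weight I i > 0) \<and>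
     (\<forall>s\<in>{1..periods I}. \<forall>t\<in>{1..periods I}. s \<le> t \<longrightarrow> capacity I s \<le> capacity I t)"

definition chain :: "gik \<Rightarrow> (nat \<Rightarrow> nat set) \<Rightarrow> bool" where
  "chain I S \<longleftrightarrow>
     S 0 = {} \<and> (\<forall>t\<in>{1..periods I}. S (t - 1) \<subseteq> S t \<and> S t \<subseteq> {1..items I})"

definition feasible_chain :: "gik \<Rightarrow> (nat \<Rightarrow> nat set) \<Rightarrow> bool" where
  "feasible_chain I S \<longleftrightarrow>
     chain I S \<and> (\<forall>t\<in>{1..periods I}. (\<Sum>i\<in>S t. weight I i) \<le> capacity I t)"

definition chain_profit :: "gik \<Rightarrow> (nat \<Rightarrow> nat set) \<Rightarrow> nat" where
  "chain_profit I S = (\<Sum>t\<in>{1..periods I}. \<Sum>i\<in>S t - S (t - 1). gain I i t)"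

definition max_profit :: "gik \<Rightarrow> nat" where
  "max_profit I = Max {chain_profit I S | S. feasible_chain I S}"

text \<open>The number of binary digits of \<open>k\<close>, where 0 has one digit; it replaces the logarithm
  in the input size, which would vanish on data equal to 1.\<close>

definition bits :: "nat \<Rightarrow> nat" where
  "bits k = max 1 (floorlog 2 k)"

definition input_size :: "gik \<Rightarrow> nat" where
  "input_size I =
     items I * bits (Max (weight I ` {1..items I})) +
     items I * periods I *
       bits (Max {gain I i t | i t. i \<in> {1..items I} \<and> t \<in> {1..periods I}}) +
     periods I * bits (Max (capacity I ` {1..periods I}))"

section \<open>Algorithms and their running time\<close>

text \<open>Algorithms are programs of a first-order, call-by-value functional language whose values
  are binary trees with natural numbers at the leaves. A program is a list of bodies of
  one-argument (possibly mutually recursive) functions, the first of which is the entry point.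
  Variables are de Bruijn indices; a function body starts with its argument as \<open>Var 0\<close>.

  Running time is measured by the logarithmic cost criterion: arithmetic operations and literals
  are charged the bit lengths of the numbers involved, everything else (which only moves
  pointers) is charged one unit. In time \<open>c\<close> only \<open>c\<close> tree cells can be built, and an arithmetic
  result has at most as many digits as its operands together, so that the model and Turing
  machines simulate each other with polynomial overhead.\<close>

datatype val = Num nat | Pair val val

datatype arith = Add | Sub | Mul | Div | Mod | Leq

fun arith_val :: "arith \<Rightarrow> nat \<Rightarrow> nat \<Rightarrow> nat" where
  "arith_val Add a b = a + b"
| "arith_val Sub a b = a - b"
| "arith_val Mul a b = a * b"
| "arith_val Div a b = a div b"
| "arith_val Mod a b = a mod b"
| "arith_val Leq a b = (if a \<le> b then 1 else 0)"

datatype expr =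
    Var nat
  | Lit nat
  | Arith arith expr expr
  | MkPair expr expr
  | Fst expr
  | Snd expr
  | IsPair expr
  | Cond expr expr expr
  | Bind expr expr
  | Call nat expr

type_synonym program = "expr list"

text \<open>\<open>evals P env e v c\<close>: in environment \<open>env\<close>, the expression \<open>e\<close> evaluates to \<open>v\<close> at cost \<open>c\<close>.
  Ill-formed operations, such as adding pairs, have no value.\<close>

inductive evals :: "program \<Rightarrow> val list \<Rightarrow> expr \<Rightarrow> val \<Rightarrow> nat \<Rightarrow> bool" for P :: program where
  var: "i < length env \<Longrightarrow> evals P env (Var i) (env ! i) 1"
| lit: "evals P env (Lit k) (Num k) (bits k)"
| arith: "evals P env e1 (Num a) c1 \<Longrightarrow> evals P env e2 (Num b) c2 \<Longrightarrow>
    evals P env (Arith f e1 e2) (Num (arith_val f a b)) (c1 + c2 + bits a + bits b)"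
| pair: "evals P env e1 v1 c1 \<Longrightarrow> evals P env e2 v2 c2 \<Longrightarrow>
    evals P env (MkPair e1 e2) (Pair v1 v2) (c1 + c2 + 1)"
| fst: "evals P env e (Pair v1 v2) c \<Longrightarrow> evals P env (Fst e) v1 (c + 1)"
| snd: "evals P env e (Pair v1 v2) c \<Longrightarrow> evals P env (Snd e) v2 (c + 1)"
| ispair: "evals P env e v c \<Longrightarrow>
    evals P env (IsPair e) (Num (case v of Pair _ _ \<Rightarrow> 1 | Num _ \<Rightarrow> 0)) (c + 1)"
| cond_true: "evals P env e v c1 \<Longrightarrow> v \<noteq> Num 0 \<Longrightarrow> evals P env e1 v1 c2 \<Longrightarrow>
    evals P env (Cond e e1 e2) v1 (c1 + c2 + 1)"
| cond_false: "evals P env e (Num 0) c1 \<Longrightarrow> evals P env e2 v2 c2 \<Longrightarrow>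
    evals P env (Cond e e1 e2) v2 (c1 + c2 + 1)"
| bind: "evals P env e1 v1 c1 \<Longrightarrow> evals P (v1 # env) e2 v2 c2 \<Longrightarrow>
    evals P env (Bind e1 e2) v2 (c1 + c2 + 1)"
| call: "evals P env e v c1 \<Longrightarrow> f < length P \<Longrightarrow> evals P [v] (P ! f) r c2 \<Longrightarrow>
    evals P env (Call f e) r (c1 + c2 + 1)"

lemma evals_deterministic:
  "evals P env e v c \<Longrightarrow> evals P env e v' c' \<Longrightarrow> v' = v \<and> c' = c"
proof (induction arbitrary: v' c' rule: evals.induct)
  case (var i env) from var.prems show ?case by cases auto
next
  case (lit env k) from lit.prems show ?case by cases auto
next
  case (arith env e1 a c1 e2 b c2 f)
  from arith.prems show ?case by cases (auto dest!: arith.IH)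
next
  case (pair env e1 v1 c1 e2 v2 c2)
  from pair.prems show ?case by cases (auto dest!: pair.IH)
next
  case (fst env e v1 v2 c) from fst.prems show ?case by cases (auto dest!: fst.IH)
next
  case (snd env e v1 v2 c) from snd.prems show ?case by cases (auto dest!: snd.IH)
next
  case (ispair env e v c) from ispair.prems show ?case by cases (auto dest!: ispair.IH)
next
  case (cond_true env e v c1 e1 v1 c2 e2)
  from cond_true.prems show ?case by cases (auto simp: cond_true.hyps dest!: cond_true.IH)
next
  case (cond_false env e c1 e2 v2 c2 e1)
  from cond_false.prems show ?case by cases (auto dest!: cond_false.IH)
next
  case (bind env e1 v1 c1 e2 v2 c2)
  from bind.prems show ?case by cases (auto dest!: bind.IH)
next
  case (call env e v c1 f r c2)
  from call.prems show ?case by cases (auto dest!: call.IH)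
qed

definition runs :: "program \<Rightarrow> val \<Rightarrow> val \<Rightarrow> nat \<Rightarrow> bool" where
  "runs P x v c \<longleftrightarrow> evals P [x] (Call 0 (Var 0)) v c"

fun val_list :: "val list \<Rightarrow> val" where
  "val_list [] = Num 0"
| "val_list (x # xs) = Pair x (val_list xs)"

definition encode_instance :: "gik \<Rightarrow> val" where
  "encode_instance I = val_list
     [Num (items I), Num (periods I),
      val_list (map (\<lambda>i. Num (weight I i)) [1..<items I + 1]),
      val_list (map (\<lambda>t. Num (capacity I t)) [1..<periods I + 1]),
      val_list (map (\<lambda>i. val_list (map (\<lambda>t. Num (gain I i t)) [1..<periods I + 1]))
        [1..<items I + 1])]"

text \<open>A chain is output as the list of its sets \<open>S\<^sub>1, \<dots>, S\<^sub>T\<close>, each given by a list of items.\<close>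

definition encodes_chain :: "gik \<Rightarrow> val \<Rightarrow> (nat \<Rightarrow> nat set) \<Rightarrow> bool" where
  "encodes_chain I v S \<longleftrightarrow>
     (\<exists>xss. v = val_list (map (\<lambda>xs. val_list (map Num xs)) xss) \<and>
        length xss = periods I \<and> (\<forall>t\<in>{1..periods I}. S t = set (xss ! (t - 1))))"

section \<open>Approximation algorithms\<close>

definition gik_approx_algorithm :: "program \<Rightarrow> real \<Rightarrow> (real \<Rightarrow> real) \<Rightarrow> bool" where
  "gik_approx_algorithm P \<alpha> \<tau> \<longleftrightarrow>
     (\<forall>I. gik_instance I \<longrightarrow>
        (\<exists>v c S. runs P (encode_instance I) v c \<and>
           real c \<le> \<tau> (real (input_size I)) \<and>
           encodes_chain I v S \<and> feasible_chain I S \<and>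
           real (chain_profit I S) \<ge> \<alpha> * real (max_profit I)))"

text \<open>Quasi-polynomial time means time \<open>2\<close> to the power of a polylogarithm of the input size; for
  an approximation scheme the constants may depend on the accuracy.\<close>

definition gik_admits_qptas :: bool where
  "gik_admits_qptas \<longleftrightarrow>
     (\<forall>\<epsilon>::real. 0 < \<epsilon> \<and> \<epsilon> < 1 \<longrightarrow>
        (\<exists>P. \<exists>a>0. \<exists>b>0. \<exists>d>0.
           gik_approx_algorithm P (1 - \<epsilon>) (\<lambda>s. a * 2 powr (b * log 2 s powr d))))"

end

theory Submission imports Defs "HOL-Library.FuncSet" begin

text \<open>From an optimal chain, delete a cheap set of items such that in every period \<open>t\<close> the deleted
  weight \<open>s t\<close> satisfies the following: all but \<open>K\<close> of the items inserted up to \<open>t\<close> have total weight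
  at most \<open>K * s t\<close>, where \<open>K\<close> is polylogarithmic. Such a set is a color class of a coloring with
  \<open>q \<ge> 1 / \<epsilon>\<close> colors in which every block of \<open>K\<close> items, consecutive by weight among the items
  inserted up to \<open>t\<close>, contains every color (a random coloring does); the cheapest color is deleted.

  The slack \<open>s t\<close> pays for rounding. In period \<open>t\<close>, the few items much heavier than \<open>K * s t\<close> are
  recorded exactly, lighter ones only in multiples of about \<open>s t / n\<close> and only at \<open>O(K\<^sup>2)\<close>
  breakpoints per doubling of \<open>s t\<close>, and items lighter than \<open>s t / (2 n)\<close> fit in any case. So if items
  are processed by decreasing weight, only periods whose slack is small relative to the current
  weight matter, and polylogarithmically many tokens describe the loads of all of them. The
  algorithm is a dynamic program over all token lists of this length.\<close>

section \<open>Deleting a color class\<close>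

text \<open>The obstacle is that all \<open>T\<close> capacities bind at once: a state that stores
  the load of every period has exponentially many values. Slack makes the loads of many periods
  nearly interchangeable, but it must be bought relative to the weights present in each period, so
  the blocks are formed anew for every prefix of the schedule. \<open>K = q * L\<close> with
  \<open>q * T * n < 2 ^ L\<close> comes from a union bound over at most \<open>T * n\<close> blocks
  and \<open>q\<close> colors, since \<open>(1 - 1 / q) ^ q \<le> 1 / 2\<close>. Neither the
  coloring nor the rounding occurs in the algorithm. Every run of the dynamic program is feasible by
  \<open>admissible\<close> and the order of the items, whatever its tokens are, so tokens may be
  guessed; the rounded schedule only shows that a run of large profit exists. Hence the program
  depends on \<open>q\<close> alone and computes \<open>K\<close> and the token bounds from the
  instance. Rounding consumes half of the scale of the slack (a quarter for the grid, a quarter for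
  the breakpoints); the other half receives the small items that come after a period has been
  dropped.\<close>

lemma hitting_coloring:
  fixes q K :: nat
  assumes "finite X" "finite \<B>" "q > 0" "\<And>B. B \<in> \<B> \<Longrightarrow> B \<subseteq> X \<and> card B = K"
    and small: "card \<B> * q * (q - 1) ^ K < q ^ K"
  obtains f where "\<And>B c. B \<in> \<B> \<Longrightarrow> c < q \<Longrightarrow> \<exists>x\<in>B. f x = c" "\<And>x. x \<in> X \<Longrightarrow> f x < q"
proof -
  \<comment> \<open>The colorings that avoid color \<open>c\<close> on block \<open>B\<close>. A
    union bound over all \<open>(B, c)\<close> leaves a coloring outside every bad set;
    extensionality keeps the number of colorings finite.\<close>
  define bad where "bad = (\<lambda>(B, c). PiE X (\<lambda>x. if x \<in> B then {..<q} - {c} else {..<q}))"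
  have card_bad: "card (bad (B, c)) = (q - 1) ^ K * q ^ (card X - K)" if "B \<in> \<B>" "c < q" for B c
  proof -
    have B: "B \<subseteq> X" "card B = K" using assms(4) that by auto
    have "card (bad (B, c)) = (\<Prod>x\<in>X. card (if x \<in> B then {..<q} - {c} else {..<q}))"
      unfolding bad_def using assms(1) by (simp add: card_PiE)
    also have "\<dots> = (\<Prod>x\<in>X. if x \<in> B then q - 1 else q)"
      using that by (intro prod.cong) (auto simp: card_Diff_singleton_if)
    also have "\<dots> = (q - 1) ^ card (X \<inter> B) * q ^ card (X - B)"
      using assms(1) by (subst prod.If_cases) (auto simp: Diff_eq Compl_eq)
    also have "\<dots> = (q - 1) ^ K * q ^ (card X - K)"
      using B assms(1) by (simp add: Int_absorb1 card_Diff_subset finite_subset)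
    finally show ?thesis .
  qed
  have "card (\<Union> (bad ` (\<B> \<times> {..<q}))) < q ^ card X"
  proof (cases "\<B> = {}")
    case True
    then show ?thesis using \<open>q > 0\<close> by simp
  next
    case False
    then have "K \<le> card X" using assms by (metis all_not_in_conv card_mono)
    have "card (\<Union> (bad ` (\<B> \<times> {..<q}))) \<le> (\<Sum>i\<in>\<B> \<times> {..<q}. card (bad i))"
      using assms(2) by (intro card_UN_le) auto
    also have "\<dots> = (\<Sum>i\<in>\<B> \<times> {..<q}. (q - 1) ^ K * q ^ (card X - K))"
      using card_bad by (intro sum.cong) auto
    also have "\<dots> = card \<B> * q * (q - 1) ^ K * q ^ (card X - K)"
      by (simp add: card_cartesian_product)
    also have "\<dots> < q ^ K * q ^ (card X - K)"
      using small \<open>q > 0\<close> by simp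
    also have "\<dots> = q ^ card X" using \<open>K \<le> card X\<close> by (simp flip: power_add)
    finally show ?thesis .
  qed
  moreover have "card (PiE X (\<lambda>_. {..<q})) = q ^ card X"
    using assms(1) by (simp add: card_PiE)
  ultimately have "\<not> PiE X (\<lambda>_. {..<q}) \<subseteq> \<Union> (bad ` (\<B> \<times> {..<q}))"
  proof -
    have "finite (\<Union> (bad ` (\<B> \<times> {..<q})))"
      using assms(1,2) by (auto simp: bad_def intro!: finite_PiE)
    then show ?thesis
      using card_mono \<open>card (\<Union> _) < _\<close> \<open>card (PiE X _) = _\<close> by (metis linorder_not_le)
  qed
  then obtain f where f: "f \<in> PiE X (\<lambda>_. {..<q})" "\<And>B c. B \<in> \<B> \<Longrightarrow> c < q \<Longrightarrow> f \<notin> bad (B, c)"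
    by blast
  show thesis
  proof
    fix B c assume "B \<in> \<B>" "c < q"
    then have "f \<notin> bad (B, c)" using f by blast
    then show "\<exists>x\<in>B. f x = c"
      using f(1) by (auto simp: bad_def PiE_iff split: if_splits)
  next
    fix x assume "x \<in> X" then show "f x < q" using f by auto
  qed
qed

text \<open>An item of a block is at most as heavy as any item of the block before it, hence as the
  marked item of that block.\<close>

lemma sum_drop_le_marked:
  fixes w :: "'a \<Rightarrow> nat"
  assumes "sorted_wrt (\<lambda>x y. w y \<le> w x) xs"
    and "\<And>b. (b + 1) * K \<le> length xs \<Longrightarrow> \<exists>x\<in>set (take K (drop (b * K) xs)). Q x"
  shows "sum_list (map w (drop K xs)) \<le> K * sum_list (map w (filter Q xs))"
  using assms
proof (induction "length xs" arbitrary: xs rule: less_induct)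
  case less
  show ?case
  proof (cases "length xs \<le> K \<or> K = 0")
    case True
    then show ?thesis
    proof
      assume "K = 0"
      then have "xs = []" using less.prems(2)[of 0] by auto
      then show ?thesis by simp
    qed simp
  next
    case False
    define ys where "ys = drop K xs"
    have sorted_ys: "sorted_wrt (\<lambda>x y. w y \<le> w x) ys"
      using less.prems(1) by (simp add: ys_def sorted_wrt_drop)
    have "\<exists>x\<in>set (take K (drop (b * K) ys)). Q x" if "(b + 1) * K \<le> length ys" for b
      using less.prems(2)[of "b + 1"] that False by (auto simp: ys_def algebra_simps)
    with sorted_ys have IH: "sum_list (map w (drop K ys)) \<le> K * sum_list (map w (filter Q ys))"
      using less.hyps[of ys] False by (auto simp: ys_def)
    obtain x where x: "x \<in> set (take K xs)" "Q x"
      using less.prems(2)[of 0] False by auto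
    have "w y \<le> w x" if "y \<in> set ys" for y
    proof -
      have "sorted_wrt (\<lambda>x y. w y \<le> w x) (take K xs @ ys)"
        using less.prems(1) by (simp add: ys_def)
      then show ?thesis using x that by (auto simp: sorted_wrt_append)
    qed
    then have "sum_list (map w (take K ys)) \<le> sum_list (map (\<lambda>_. w x) (take K ys))"
      by (intro sum_list_mono) (auto dest: in_set_takeD)
    also have "\<dots> \<le> K * w x" by (simp add: sum_list_triv)
    finally have *: "sum_list (map w (take K ys)) \<le> K * w x" .
    have "w x \<le> sum_list (map w (filter Q (take K xs)))"
      using x by (intro member_le_sum_list) auto
    have "sum_list (map w ys) = sum_list (map w (take K ys)) + sum_list (map w (drop K ys))"
      by (metis append_take_drop_id map_append sum_list_append)
    also have "\<dots> \<le> K * w x + K * sum_list (map w (filter Q ys))"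
      using * IH by simp
    also have "\<dots> \<le> K * sum_list (map w (filter Q (take K xs))) + K * sum_list (map w (filter Q ys))"
      using \<open>w x \<le> _\<close> by simp
    also have "\<dots> = K * sum_list (map w (filter Q (take K xs @ ys)))"
      by (simp add: algebra_simps)
    also have "take K xs @ ys = xs" by (simp add: ys_def)
    finally show ?thesis by (simp add: ys_def)
  qed
qed

text \<open>For each \<open>t\<close> the items with \<open>time x \<le> t\<close> are listed by
  decreasing weight and cut into blocks of \<open>K\<close>. If every full block contains every
  color, then for each color class the items behind the first block weigh at most \<open>K\<close>
  times the class members of that list. By averaging, some class carries at most a
  \<open>q\<close>-th of the profit; \<open>Y\<close> is the first block.\<close>

lemma color_class_covers_light_items:
  fixes w p :: "'a \<Rightarrow> nat" and time :: "'a \<Rightarrow> nat" and q K n T :: nat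
  assumes fin: "finite X" and "card X \<le> n" and "q > 0" and "K > 0"
    and small: "T * n * q * (q - 1) ^ K < q ^ K"
  obtains D where "D \<subseteq> X" "q * sum p D \<le> sum p X"
    "\<And>t. t \<in> {1..T} \<Longrightarrow> \<exists>Y\<subseteq>{x\<in>X. time x \<le> t}. card Y \<le> K \<and>
       sum w ({x\<in>X. time x \<le> t} - Y) \<le> K * sum w {x\<in>D. time x \<le> t}"
proof -
  define pre where "pre t = {x\<in>X. time x \<le> t}" for t
  have fin_pre: "finite (pre t)" for t using fin by (simp add: pre_def)
  have "\<exists>xs. set xs = pre t \<and> distinct xs \<and> sorted_wrt (\<lambda>x y. w y \<le> w x) xs" for t
  proof -
    obtain ys where ys: "set ys = pre t" "distinct ys"
      using finite_distinct_list[OF fin_pre] by blast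
    have "sorted (map w (sort_key w ys))" by simp
    then have "sorted_wrt (\<lambda>x y. w y \<le> w x) (rev (sort_key w ys))"
      by (simp add: sorted_wrt_rev sorted_map)
    then show ?thesis using ys by (intro exI[of _ "rev (sort_key w ys)"]) auto
  qed
  then obtain xs where xs: "\<And>t. set (xs t) = pre t" "\<And>t. distinct (xs t)"
    "\<And>t. sorted_wrt (\<lambda>x y. w y \<le> w x) (xs t)" by metis
  define block where "block t b = set (take K (drop (b * K) (xs t)))" for t b
  \<comment> \<open>Only full blocks need all colors: the items of a last incomplete block are
    compared with the block before it. The bound \<open>b < n\<close> makes the count
    \<open>T * n\<close> visible.\<close>
  define \<B> where "\<B> = (\<lambda>(t, b). block t b) ` {(t, b). t \<in> {1..T} \<and> b < n \<and> (b + 1) * K \<le> length (xs t)}"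
  have "finite \<B>" unfolding \<B>_def
    by (rule finite_imageI, rule finite_subset[of _ "{1..T} \<times> {..<n}"]) auto
  have len: "length (xs t) \<le> n" for t
  proof -
    have "length (xs t) = card (pre t)" using xs by (metis distinct_card)
    also have "\<dots> \<le> card X" by (rule card_mono) (auto simp: fin pre_def)
    finally show ?thesis using assms(2) by simp
  qed
  have "card \<B> \<le> card ({1..T} \<times> {..<n})"
    unfolding \<B>_def
    by (rule order.trans[OF card_image_le card_mono]) (auto intro: finite_subset[of _ "{1..T} \<times> {..<n}"])
  then have "card \<B> \<le> T * n" by simp
  then have "card \<B> * q * (q - 1) ^ K < q ^ K"
    using small by (meson le_less_trans mult_le_mono1)
  moreover have "B \<subseteq> X \<and> card B = K" if "B \<in> \<B>" for B
  proof -
    obtain t b where tb: "B = block t b" "(b + 1) * K \<le> length (xs t)" using \<open>B \<in> \<B>\<close>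
      by (auto simp: \<B>_def)
    have "B \<subseteq> pre t" unfolding tb block_def xs(1)[symmetric]
      by (meson order_trans set_drop_subset set_take_subset)
    moreover have "card B = K" unfolding tb block_def
      using tb(2) xs(2)[of t] by (subst distinct_card) auto
    ultimately show ?thesis by (auto simp: pre_def)
  qed
  ultimately obtain f where f: "\<And>B c. B \<in> \<B> \<Longrightarrow> c < q \<Longrightarrow> \<exists>x\<in>B. f x = c" "\<And>x. x \<in> X \<Longrightarrow> f x < q"
    using hitting_coloring[OF fin \<open>finite \<B>\<close> \<open>q > 0\<close>] by metis
  have "\<exists>c<q. q * sum p {x\<in>X. f x = c} \<le> sum p X"
  proof (rule ccontr)
    assume *: "\<not> ?thesis"
    have "sum p X = (\<Sum>c<q. sum p {x\<in>X. f x = c})"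
      using f(2) fin by (subst sum.group) auto
    then have "q * sum p X = (\<Sum>c<q. q * sum p {x\<in>X. f x = c})"
      by (simp add: sum_distrib_left)
    also have "\<dots> > (\<Sum>c<q. sum p X)"
      using * \<open>q > 0\<close> by (intro sum_strict_mono) (auto simp: not_le)
    finally show False by simp
  qed
  then obtain c where c: "c < q" "q * sum p {x\<in>X. f x = c} \<le> sum p X" by blast
  show thesis
  proof (rule that[of "{x\<in>X. f x = c}"])
    fix t assume t: "t \<in> {1..T}"
    define Y where "Y = set (take K (xs t))"
    have "\<exists>x\<in>set (take K (drop (b * K) (xs t))). f x = c" if "(b + 1) * K \<le> length (xs t)" for b
    proof -
      have "(b + 1) * 1 \<le> (b + 1) * K" using \<open>K > 0\<close> by (intro mult_le_mono2) auto
      then have "b < n" using that len[of t] by simp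
      then have "block t b \<in> \<B>" using that t by (auto simp: \<B>_def)
      then show ?thesis using f(1) c(1) by (auto simp: block_def)
    qed
    then have *: "sum_list (map w (drop K (xs t))) \<le> K * sum_list (map w (filter (\<lambda>x. f x = c) (xs t)))"
      by (intro sum_drop_le_marked xs)
    have "set (drop K (xs t)) = pre t - Y"
    proof -
      have "set (take K (xs t)) \<inter> set (drop K (xs t)) = {}"
        by (simp add: set_take_disj_set_drop_if_distinct xs(2))
      moreover have "set (take K (xs t)) \<union> set (drop K (xs t)) = pre t"
        by (metis append_take_drop_id set_append xs(1))
      ultimately show ?thesis unfolding Y_def by blast
    qed
    then have "sum w (pre t - Y) = sum_list (map w (drop K (xs t)))"
      using xs(2)[of t] by (metis distinct_drop sum.distinct_set_conv_list)
    also note *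
    also have "sum_list (map w (filter (\<lambda>x. f x = c) (xs t))) = sum w (set (filter (\<lambda>x. f x = c) (xs t)))"
      using xs(2)[of t] by (simp add: sum.distinct_set_conv_list del: set_filter)
    also have "set (filter (\<lambda>x. f x = c) (xs t)) = {x \<in> {x\<in>X. f x = c}. time x \<le> t}"
      using xs(1)[of t] by (auto simp: pre_def)
    finally have "sum w (pre t - Y) \<le> K * sum w {x \<in> {x\<in>X. f x = c}. time x \<le> t}" .
    moreover have "Y \<subseteq> pre t" unfolding Y_def xs(1)[symmetric] by (rule set_take_subset)
    moreover have "card Y \<le> K"
      unfolding Y_def by (rule order.trans[OF card_length]) simp
    ultimately show "\<exists>Y\<subseteq>{x\<in>X. time x \<le> t}. card Y \<le> K \<and>
       sum w ({x\<in>X. time x \<le> t} - Y) \<le> K * sum w {x\<in>{x\<in>X. f x = c}. time x \<le> t}"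
      unfolding pre_def by blast
  qed (use c in auto)
qed

section \<open>Rounding a schedule with slack\<close>

type_synonym token = "nat \<times> nat \<times> nat \<times> nat"

text \<open>A token stands for a load of \<open>c * u\<close> during the periods \<open>a\<close> to
  \<open>b\<close>; \<open>u\<close> will be an item weight or a grid width and \<open>c\<close> a
  multiplicity. The factored form keeps the number of possible tokens small although the product may
  be exponentially large.\<close>

fun token_load :: "nat \<Rightarrow> token \<Rightarrow> nat" where
  "token_load t (a, b, c, u) = (if a \<le> t \<and> t \<le> b then c * u else 0)"

definition load :: "token list \<Rightarrow> nat \<Rightarrow> nat" where
  "load Q t = sum_list (map (token_load t) Q)"

lemma floorlog2_bounds:
  assumes "k > 0"
  shows "2 ^ floorlog 2 k \<le> 2 * k" "k < 2 ^ floorlog 2 k"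
proof -
  have "floorlog 2 k > 0" using assms by (simp add: floorlog_def)
  then obtain l where "floorlog 2 k = Suc l" by (cases "floorlog 2 k") auto
  then show "2 ^ floorlog 2 k \<le> 2 * k" "k < 2 ^ floorlog 2 k"
    using floorlog_bounds[of k 2] assms by auto
qed

lemma le_add_if_div_eq:
  fixes a b c :: nat
  assumes "a div c = b div c" "c > 0" shows "a \<le> b + c"
proof -
  have "a = a div c * c + a mod c" by simp
  also have "\<dots> \<le> b div c * c + c" unfolding assms(1) using assms(2) by (intro add_left_mono) simp
  also have "b div c * c \<le> b" by (rule div_times_less_eq_dividend)
  finally show ?thesis by simp
qed

text \<open>\<open>A\<close> is the schedule left after the deletion, and \<open>s t\<close> the
  weight deleted up to \<open>t\<close>, now available as slack. The factor 4 in the bound on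
  \<open>2 ^ m\<close> makes rounding up all light items cost at most a quarter of a scale.\<close>

locale slack_schedule =
  fixes n T K m :: nat and w :: "nat \<Rightarrow> nat" and A :: "nat set"
    and time :: "nat \<Rightarrow> nat" and s W :: "nat \<Rightarrow> nat"
  assumes finite_A: "finite A" and card_A: "card A \<le> n" and K_pos: "K > 0"
    and w_pos: "i \<in> A \<Longrightarrow> w i > 0" and m: "4 * n \<le> 2 ^ m" and n_pos: "n > 0"
    and s_mono: "t \<le> t' \<Longrightarrow> s t \<le> s t'"
    and fits: "t \<in> {1..T} \<Longrightarrow> sum w {i\<in>A. time i \<le> t} + s t \<le> W t"
    and sparse: "t \<in> {1..T} \<Longrightarrow> \<exists>Y\<subseteq>{i\<in>A. time i \<le> t}. card Y \<le> K \<and>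
       sum w ({i\<in>A. time i \<le> t} - Y) \<le> K * s t"
begin

section \<open>Levels of slack, heavy and light items, rounded loads\<close>

definition level :: "nat \<Rightarrow> nat" where "level t = floorlog 2 (s t)"

text \<open>This is \<open>2 ^ (l - 1)\<close> for \<open>l > 0\<close> and 0 for
  \<open>l = 0\<close>. So \<open>scale (level t)\<close> is the slack up to a factor 2, and it is 0
  exactly when there is no slack; then every item of \<open>A\<close> is heavy.\<close>

definition scale :: "nat \<Rightarrow> nat" where "scale l = 2 ^ l div 2"

text \<open>The quotient \<open>scale l / 2 ^ m\<close>, except that truncated subtraction gives
  width 1, hence exact weights, when the quotient is at most 1.\<close>

definition grid :: "nat \<Rightarrow> nat" where "grid l = 2 ^ (l - 1 - m)"

text \<open>The threshold is at least \<open>K * s t\<close> on the level of \<open>t\<close>, so by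
  \<open>sparse\<close> a heavy item inserted up to \<open>t\<close> must lie in the exceptional set
  \<open>Y\<close>.\<close>

definition heavy :: "nat \<Rightarrow> nat set" where "heavy l = {i\<in>A. 2 * K * scale l < w i}"

definition light :: "nat \<Rightarrow> nat set" where "light l = A - heavy l"

text \<open>Light weight counted in quarters of the scale: within a piece it varies by at most one
  quarter, and the bound on the light weight bounds the number of pieces per level. The ends of
  pieces are the breakpoints of the overview.\<close>

definition piece :: "nat \<Rightarrow> nat" where
  "piece t = 4 * sum w {i\<in>light (level t). time i \<le> t} div scale (level t)"

definition piece_set :: "nat \<Rightarrow> nat \<Rightarrow> nat set" where
  "piece_set l c = {t\<in>{1..T}. level t = l \<and> piece t = c}"

text \<open>The inserted 0 is a default for an empty piece.\<close>

definition piece_end :: "nat \<Rightarrow> nat \<Rightarrow> nat" where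
  "piece_end l c = Max (insert 0 (piece_set l c))"

definition units :: "nat \<Rightarrow> nat \<Rightarrow> nat" where
  "units l i = (w i + grid l - 1) div grid l"

text \<open>Light items of a piece are charged from its first period on, in multiples of the grid.\<close>

definition rounded :: "nat set \<Rightarrow> nat \<Rightarrow> nat" where
  "rounded P t = sum w {i\<in>P \<inter> heavy (level t). time i \<le> t} +
     sum (units (level t)) {i\<in>P \<inter> light (level t). time i \<le> piece_end (level t) (piece t)}
       * grid (level t)"

lemma level_mono: "t \<le> t' \<Longrightarrow> level t \<le> level t'"
  unfolding level_def by (intro floorlog_mono s_mono)

lemma scale_mono: "l \<le> l' \<Longrightarrow> scale l \<le> scale l'"
  unfolding scale_def by (intro div_le_mono power_increasing) auto

lemma scale_le: "scale (level t) \<le> s t" and le_scale: "s t \<le> 2 * scale (level t)"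
proof -
  have "scale (level t) \<le> s t \<and> s t \<le> 2 * scale (level t)"
  proof (cases "s t = 0")
    case True
    then show ?thesis by (simp add: level_def scale_def floorlog_def)
  next
    case False
    then have "level t > 0" by (simp add: level_def floorlog_def)
    then obtain l where "level t = Suc l" by (cases "level t") auto
    then show ?thesis using floorlog2_bounds[of "s t"] False
      by (simp add: scale_def level_def)
  qed
  then show "scale (level t) \<le> s t" "s t \<le> 2 * scale (level t)" by auto
qed

lemma grid_pos: "grid l > 0" by (simp add: grid_def)

lemma scale_le_grid: "scale l \<le> grid l * 2 ^ m"
proof (cases l)
  case (Suc k)
  then have "scale l = 2 ^ k" by (simp add: scale_def)
  also have "\<dots> \<le> 2 ^ (k - m + m)" by (intro power_increasing) auto
  finally show ?thesis using Suc by (simp add: grid_def power_add)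
qed (simp add: scale_def)

lemma grid_le_scale: "(grid l - 1) * 2 ^ m \<le> scale l"
proof (cases "l - 1 \<le> m")
  case False
  then have "l = Suc (l - 1 - m + m)" by simp
  then obtain k where k: "l = Suc (k + m)" by blast
  have "(grid l - 1) * 2 ^ m \<le> grid l * 2 ^ m" by (rule mult_le_mono1) simp
  also have "\<dots> = scale l" unfolding k by (simp add: grid_def scale_def power_add)
  finally show ?thesis .
qed (simp add: grid_def)

text \<open>The items outside \<open>Y\<close> together weigh at most \<open>K * s t\<close>, which
  is at most the threshold, so none of them is heavy. The light items are these and at most
  \<open>K\<close> items of \<open>Y\<close>, each at most the threshold; this gives
  \<open>2 * K\<^sup>2\<close> scales twice.\<close>

lemma heavy_bound:
  assumes "t \<in> {1..T}"
  shows "card {i\<in>heavy (level t). time i \<le> t} \<le> K"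
    and "sum w {i\<in>light (level t). time i \<le> t} \<le> 4 * K\<^sup>2 * scale (level t)"
proof -
  obtain Y where Y: "Y \<subseteq> {i\<in>A. time i \<le> t}" "card Y \<le> K"
    "sum w ({i\<in>A. time i \<le> t} - Y) \<le> K * s t"
    using sparse[OF assms] by blast
  have fin: "finite Y" using Y(1) finite_A by (auto intro: finite_subset)
  have Ks: "K * s t \<le> 2 * K * scale (level t)"
    using mult_le_mono2[OF le_scale[of t], of K] by (simp only: ac_simps)
  have "{i\<in>heavy (level t). time i \<le> t} \<subseteq> Y"
  proof
    fix i assume i: "i \<in> {i\<in>heavy (level t). time i \<le> t}"
    show "i \<in> Y"
    proof (rule ccontr)
      assume "i \<notin> Y"
      then have "w i \<le> sum w ({i\<in>A. time i \<le> t} - Y)"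
        using i finite_A by (intro member_le_sum) (auto simp: heavy_def)
      then show False using i Y(3) Ks by (auto simp: heavy_def)
    qed
  qed
  then show "card {i\<in>heavy (level t). time i \<le> t} \<le> K"
    using card_mono[OF fin] Y(2) le_trans by blast
  have "sum w {i\<in>light (level t). time i \<le> t} \<le> sum w (({i\<in>A. time i \<le> t} - Y) \<union> (Y \<inter> light (level t)))"
    using finite_A fin by (intro sum_mono2) (auto simp: light_def)
  also have "\<dots> \<le> sum w ({i\<in>A. time i \<le> t} - Y) + sum w (Y \<inter> light (level t))"
    using finite_A fin by (subst sum.union_disjoint) auto
  also have "sum w (Y \<inter> light (level t)) \<le> sum (\<lambda>_. 2 * K * scale (level t)) (Y \<inter> light (level t))"
    by (intro sum_mono) (auto simp: light_def heavy_def not_less)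
  also have "\<dots> = card (Y \<inter> light (level t)) * (2 * K * scale (level t))" by simp
  also have "\<dots> \<le> K * (2 * K * scale (level t))"
    using Y(2) card_mono[of Y "Y \<inter> light (level t)"] fin by (intro mult_le_mono1) auto
  also have "sum w ({i\<in>A. time i \<le> t} - Y) \<le> K * (2 * K * scale (level t))"
  proof -
    have "K * s t \<le> K * (K * s t)" using K_pos by simp
    also have "\<dots> \<le> K * (2 * K * scale (level t))" using Ks by (rule mult_le_mono2)
    finally show ?thesis using Y(3) by (rule order.trans[rotated])
  qed
  finally show "sum w {i\<in>light (level t). time i \<le> t} \<le> 4 * K\<^sup>2 * scale (level t)"
    by (simp add: power2_eq_square)
qed

lemma piece_le:
  assumes "t \<in> {1..T}" shows "piece t \<le> 16 * K\<^sup>2"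
proof -
  have "piece t \<le> (16 * K\<^sup>2) * scale (level t) div scale (level t)"
    unfolding piece_def using heavy_bound(2)[OF assms] by (intro div_le_mono) (simp add: algebra_simps)
  also have "\<dots> \<le> 16 * K\<^sup>2" by (cases "scale (level t) = 0") auto
  finally show ?thesis .
qed

lemma finite_piece_set: "finite (piece_set l c)" by (simp add: piece_set_def)

lemma piece_end_mem: "t \<in> piece_set l c \<Longrightarrow> piece_end l c \<in> piece_set l c"
  unfolding piece_end_def using finite_piece_set
  by (subst Max_insert) (auto simp: max_def dest: Max_in)

lemma le_piece_end: "t \<in> piece_set l c \<Longrightarrow> t \<le> piece_end l c"
  unfolding piece_end_def using finite_piece_set by (intro Max_ge) auto

lemma piece_mono:
  assumes "t \<le> t'" "level t = level t'" shows "piece t \<le> piece t'"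
  unfolding piece_def assms(2) using assms(1) finite_A
  by (intro div_le_mono mult_le_mono2 sum_mono2) (auto simp: light_def)

text \<open>The level grows with time and, inside a level, so does the piece number. This is what
  allows one token with an interval of periods to describe a piece.\<close>

lemma piece_set_convex:
  assumes "a \<in> piece_set l c" "b \<in> piece_set l c" "a \<le> t" "t \<le> b"
  shows "t \<in> piece_set l c"
  using assms level_mono[of a t] level_mono[of t b] piece_mono[of a t] piece_mono[of t b]
  by (auto simp: piece_set_def)

lemma units_grid: "w i \<le> units l i * grid l" "units l i * grid l \<le> w i + (grid l - 1)"
proof -
  have "w i + grid l - 1 = units l i * grid l + (w i + grid l - 1) mod grid l"
    unfolding units_def by (rule div_mult_mod_eq[symmetric])
  moreover have "(w i + grid l - 1) mod grid l < grid l" using grid_pos by simp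
  ultimately show "w i \<le> units l i * grid l" "units l i * grid l \<le> w i + (grid l - 1)"
    by linarith+
qed

text \<open>The rounded load only overestimates: light items are charged up to the end of the piece,
  which is not before \<open>t\<close>, and weights are rounded up to the grid.\<close>

lemma rounded_insert:
  assumes "finite P" "i \<in> A" "i \<notin> P" "t \<in> {1..T}"
  shows "rounded P t + (if time i \<le> t then w i else 0) \<le> rounded (insert i P) t"
proof (cases "i \<in> heavy (level t)")
  case True
  then have "insert i P \<inter> light (level t) = P \<inter> light (level t)"
    "insert i P \<inter> heavy (level t) = insert i (P \<inter> heavy (level t))" by (auto simp: light_def)
  moreover have "{j\<in>insert i (P \<inter> heavy (level t)). time j \<le> t} =
    (if time i \<le> t then insert i {j\<in>P \<inter> heavy (level t). time j \<le> t} else {j\<in>P \<inter> heavy (level t). time j \<le> t})"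
    by auto
  ultimately show ?thesis using assms by (auto simp: rounded_def)
next
  case False
  then have light: "i \<in> light (level t)" using assms by (simp add: light_def)
  define e where "e = piece_end (level t) (piece t)"
  have "t \<le> e" unfolding e_def using assms(4) by (intro le_piece_end) (simp add: piece_set_def)
  have eq: "insert i P \<inter> heavy (level t) = P \<inter> heavy (level t)"
    "insert i P \<inter> light (level t) = insert i (P \<inter> light (level t))" using False light by auto
  have "sum (units (level t)) {j\<in>P \<inter> light (level t). time j \<le> e} + (if time i \<le> e then units (level t) i else 0) =
    sum (units (level t)) {j\<in>insert i (P \<inter> light (level t)). time j \<le> e}"
  proof -
    have "{j\<in>insert i (P \<inter> light (level t)). time j \<le> e} =
    (if time i \<le> e then insert i {j\<in>P \<inter> light (level t). time j \<le> e} else {j\<in>P \<inter> light (level t). time j \<le> e})"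
      by auto
    then show ?thesis using assms by auto
  qed
  then have "rounded (insert i P) t = rounded P t + (if time i \<le> e then units (level t) i else 0) * grid (level t)"
    unfolding rounded_def eq e_def[symmetric] by (simp only: add.assoc add_mult_distrib [symmetric])
  moreover have "(if time i \<le> t then w i else 0) \<le> (if time i \<le> e then units (level t) i else 0) * grid (level t)"
    using units_grid(1)[of i "level t"] \<open>t \<le> e\<close> by auto
  ultimately show ?thesis by linarith
qed

text \<open>Two errors of a quarter of the scale each: rounding at most \<open>n\<close> weights up
  to the grid, and charging light items from the start of a piece. The doubled inequality avoids
  halves. As the slack is at least the scale, at least half a scale of capacity remains
  free.\<close>

lemma rounded_le:
  assumes "P \<subseteq> A" "t \<in> {1..T}"
  shows "2 * rounded P t \<le> 2 * sum w {i\<in>A. time i \<le> t} + scale (level t)"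
proof -
  define l where "l = level t"
  define e where "e = piece_end l (piece t)"
  have t: "t \<in> piece_set l (piece t)" using assms(2) by (simp add: piece_set_def l_def)
  then have e: "e \<in> piece_set l (piece t)" unfolding e_def by (rule piece_end_mem)
  have heavy: "sum w {i\<in>P \<inter> heavy l. time i \<le> t} \<le> sum w {i\<in>heavy l. time i \<le> t}"
    using assms finite_A by (intro sum_mono2) (auto simp: heavy_def)
  have "sum (units l) {i\<in>P \<inter> light l. time i \<le> e} * grid l
      \<le> (\<Sum>i\<in>{i\<in>P \<inter> light l. time i \<le> e}. w i + (grid l - 1))"
    unfolding sum_distrib_right by (intro sum_mono units_grid)
  also have "\<dots> \<le> (\<Sum>i\<in>{i\<in>light l. time i \<le> e}. w i + (grid l - 1))"
    using assms finite_A by (intro sum_mono2) (auto simp: light_def)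
  also have "\<dots> \<le> sum w {i\<in>light l. time i \<le> e} + n * (grid l - 1)"
  proof -
    have "card {i\<in>light l. time i \<le> e} \<le> card A" using finite_A by (intro card_mono) (auto simp: light_def)
    then show ?thesis using card_A by (simp add: sum.distrib)
  qed
  finally have 1: "4 * (sum (units l) {i\<in>P \<inter> light l. time i \<le> e} * grid l)
    \<le> 4 * sum w {i\<in>light l. time i \<le> e} + 4 * n * (grid l - 1)" by simp
  have 2: "4 * n * (grid l - 1) \<le> scale l"
    using order.trans[OF mult_le_mono1[OF m] grid_le_scale[of l, unfolded mult.commute[of _ "2 ^ m"]]] .
  \<comment> \<open>Without slack there are no light items, so the division by 0 in
    \<open>piece\<close> does no harm.\<close>
  have 3: "4 * sum w {i\<in>light l. time i \<le> e} \<le> 4 * sum w {i\<in>light l. time i \<le> t} + scale l"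
  proof (cases "scale l = 0")
    case True
    then have "light l = {}" using w_pos by (auto simp: light_def heavy_def)
    then show ?thesis by simp
  next
    case False
    have "4 * sum w {i\<in>light l. time i \<le> e} div scale l = 4 * sum w {i\<in>light l. time i \<le> t} div scale l"
      using e t by (auto simp: piece_set_def piece_def)
    then show ?thesis using False by (intro le_add_if_div_eq) auto
  qed
  have "sum w {i\<in>A. time i \<le> t} = sum w {i\<in>heavy l. time i \<le> t} + sum w {i\<in>light l. time i \<le> t}"
    using finite_A by (subst sum.union_disjoint[symmetric]) (auto simp: heavy_def light_def intro!: sum.cong)
  moreover define g where "g = 4 * n * (grid l - 1)"
  moreover define h where "h = sum (units l) {i\<in>P \<inter> light l. time i \<le> e} * grid l"
  moreover have "rounded P t = sum w {i\<in>P \<inter> heavy l. time i \<le> t} + h"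
    unfolding rounded_def h_def e_def l_def ..
  ultimately show ?thesis using heavy 1 2 3 unfolding l_def[symmetric] by linarith
qed

text \<open>Here \<open>\<omega>\<close> is the weight of the item processed last. In an untracked
  period, \<open>n\<close> items of weight at most \<open>\<omega>\<close> weigh at most half a
  scale, exactly what \<open>rounded_le\<close> leaves free; hence the factor 2.\<close>

definition snapshot :: "nat \<Rightarrow> nat set \<Rightarrow> nat \<Rightarrow> nat" where
  "snapshot \<omega> P t = (if scale (level t) < 2 * n * \<omega> then rounded P t else 0)"

text \<open>The scale grows with time, so the periods in which item \<open>i\<close> is both heavy
  and tracked form an initial segment of the time line. This is its end, or 0 if the segment is
  empty.\<close>

definition last_heavy :: "nat \<Rightarrow> nat \<Rightarrow> nat" where
  "last_heavy \<omega> i = Max (insert 0 {t\<in>{1..T}. i \<in> heavy (level t) \<and> scale (level t) < 2 * n * \<omega>})"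

definition active_levels :: "nat \<Rightarrow> nat set" where
  "active_levels \<omega> = {l\<in>level ` {1..T}. \<omega> \<le> 2 * K * scale l \<and> scale l < 2 * n * \<omega>}"

lemma le_last_heavy_iff:
  assumes "t \<in> {1..T}" "i \<in> A"
  shows "t \<le> last_heavy \<omega> i \<longleftrightarrow> i \<in> heavy (level t) \<and> scale (level t) < 2 * n * \<omega>"
proof -
  let ?S = "{t\<in>{1..T}. i \<in> heavy (level t) \<and> scale (level t) < 2 * n * \<omega>}"
  have fin: "finite (insert 0 ?S)" by simp
  show ?thesis
  proof
    assume le: "t \<le> last_heavy \<omega> i"
    have "last_heavy \<omega> i \<in> insert 0 ?S" unfolding last_heavy_def by (rule Max_in) auto
    then have *: "last_heavy \<omega> i \<in> ?S" using le assms by auto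
    have "scale (level t) \<le> scale (level (last_heavy \<omega> i))"
      by (intro scale_mono level_mono le)
    moreover from this have "2 * K * scale (level t) \<le> 2 * K * scale (level (last_heavy \<omega> i))"
      by (rule mult_le_mono2)
    ultimately show "i \<in> heavy (level t) \<and> scale (level t) < 2 * n * \<omega>"
      using * assms(2) unfolding heavy_def by (metis (mono_tags, lifting) le_less_trans mem_Collect_eq)
  next
    assume "i \<in> heavy (level t) \<and> scale (level t) < 2 * n * \<omega>"
    then show "t \<le> last_heavy \<omega> i"
      unfolding last_heavy_def using assms by (intro Max_ge[OF fin]) auto
  qed
qed

lemma last_heavy_le: "last_heavy \<omega> i \<le> T"
  unfolding last_heavy_def by (subst Max_le_iff) auto

text \<open>Scales double from level to level, and those of two active levels differ by a factor
  below \<open>4 * n * K\<close>, which is at most \<open>2 ^ m * 2 ^ K\<close>.\<close>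

lemma card_active_levels: "card (active_levels \<omega>) \<le> m + K" if "\<omega> > 0"
proof (cases "active_levels \<omega> = {}")
  case False
  have fin: "finite (active_levels \<omega>)" by (simp add: active_levels_def)
  define l0 where "l0 = Min (active_levels \<omega>)"
  have l0: "l0 \<in> active_levels \<omega>" using False fin by (simp add: l0_def)
  have "active_levels \<omega> \<subseteq> {l0..<l0 + (m + K)}"
  proof
    fix l assume l: "l \<in> active_levels \<omega>"
    have pow: "2 * scale l = 2 ^ l" if "l \<in> active_levels \<omega>" for l
      using that \<open>\<omega> > 0\<close> by (cases l) (auto simp: scale_def active_levels_def)
    have "l0 \<le> l" using l fin by (simp add: l0_def)
    have "2 ^ l = 2 * scale l" using pow[OF l] by simp
    also have "\<dots> < 4 * n * \<omega>"
      using l unfolding active_levels_def by (simp only: mem_Collect_eq) linarith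
    also have "\<dots> \<le> 4 * n * (K * (2 * scale l0))"
      using l0 by (intro mult_le_mono2) (simp add: active_levels_def)
    also have "\<dots> = 4 * n * K * 2 ^ l0" using pow[OF l0] by simp
    also have "\<dots> \<le> 2 ^ m * 2 ^ K * 2 ^ l0"
      using m by (intro mult_le_mono) (auto intro: less_imp_le)
    finally have "l < m + K + l0" by (simp flip: power_add)
    then show "l \<in> {l0..<l0 + (m + K)}" using \<open>l0 \<le> l\<close> by auto
  qed
  then have "card (active_levels \<omega>) \<le> card {l0..<l0 + (m + K)}" by (intro card_mono) auto
  then show ?thesis by simp
qed simp

text \<open>In one period at most \<open>K\<close> heavy items are present, and few periods suffice
  as witnesses: the last period \<open>a\<close> whose threshold is still below
  \<open>\<omega>\<close>, and the last period of each active level. An item whose last heavy period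
  is not on an active level is still heavy at \<open>a\<close>, because it weighs at least
  \<open>\<omega>\<close>.\<close>

lemma card_heavy_tokens:
  assumes "P \<subseteq> A" "\<And>i. i \<in> P \<Longrightarrow> \<omega> \<le> w i" "\<omega> > 0" "\<And>i. i \<in> A \<Longrightarrow> time i > 0"
  shows "card {i\<in>P. time i \<le> last_heavy \<omega> i} \<le> K * (m + K + 1)"
proof -
  define H where "H t = {i\<in>heavy (level t). time i \<le> t}" for t
  \<comment> \<open>The default 0 means that there is no such period; \<open>H 0\<close> is empty
    because insertion times are positive.\<close>
  define a where "a = Max (insert 0 {t\<in>{1..T}. 2 * K * scale (level t) < \<omega>})"
  define b where "b l = Max {t\<in>{1..T}. level t = l}" for l
  have fin: "finite (active_levels \<omega>)" by (simp add: active_levels_def)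
  have finH: "finite (H t)" for t using finite_A by (simp add: H_def heavy_def)
  have H: "card (H t) \<le> K" if "t \<in> {0..T}" for t
  proof (cases "t = 0")
    case True
    then have "H t = {}" using assms(4) by (auto simp: H_def heavy_def)
    then show ?thesis by simp
  next
    case False
    then show ?thesis using heavy_bound(1)[of t] that by (simp add: H_def)
  qed
  have b: "b l \<in> {t\<in>{1..T}. level t = l}" "\<And>t. t \<in> {1..T} \<Longrightarrow> level t = l \<Longrightarrow> t \<le> b l"
    if "l \<in> active_levels \<omega>" for l
  proof -
    have "{t\<in>{1..T}. level t = l} \<noteq> {}" using that by (auto simp: active_levels_def)
    then show "b l \<in> {t\<in>{1..T}. level t = l}" unfolding b_def by (intro Max_in) auto
    show "t \<le> b l" if "t \<in> {1..T}" "level t = l" for t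
      unfolding b_def using that by (intro Max_ge) auto
  qed
  have a: "a \<in> insert 0 {t\<in>{1..T}. 2 * K * scale (level t) < \<omega>}"
    unfolding a_def by (rule Max_in) auto
  have "{i\<in>P. time i \<le> last_heavy \<omega> i} \<subseteq> H a \<union> (\<Union>l\<in>active_levels \<omega>. H (b l))"
  proof
    fix i assume "i \<in> {i\<in>P. time i \<le> last_heavy \<omega> i}"
    then have i: "i \<in> P" "i \<in> A" "time i \<le> last_heavy \<omega> i" using assms by auto
    define t where "t = last_heavy \<omega> i"
    have t: "t \<in> {1..T}" using last_heavy_le i assms(4)[OF i(2)] by (auto simp: t_def)
    have heavy: "i \<in> heavy (level t)" "scale (level t) < 2 * n * \<omega>"
      using le_last_heavy_iff[OF t i(2)] by (auto simp: t_def)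
    show "i \<in> H a \<union> (\<Union>l\<in>active_levels \<omega>. H (b l))"
    proof (cases "2 * K * scale (level t) < \<omega>")
      case True
      then have "t \<le> a" unfolding a_def using t by (intro Max_ge) auto
      then have "2 * K * scale (level a) < w i" using a t assms(2)[OF i(1)] by auto
      then have "i \<in> H a" using i \<open>t \<le> a\<close> by (auto simp: H_def heavy_def t_def)
      then show ?thesis by blast
    next
      case False
      then have l: "level t \<in> active_levels \<omega>" using heavy t by (auto simp: active_levels_def)
      have "time i \<le> b (level t)" using b(2)[OF l t refl] i by (simp add: t_def)
      then have "i \<in> H (b (level t))" using b(1)[OF l] heavy by (simp add: H_def)
      then show ?thesis using l by blast
    qed
  qed
  then have "card {i\<in>P. time i \<le> last_heavy \<omega> i} \<le> card (H a \<union> (\<Union>l\<in>active_levels \<omega>. H (b l)))"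
    using finH fin by (intro card_mono) auto
  also have "\<dots> \<le> card (H a) + card (\<Union>l\<in>active_levels \<omega>. H (b l))" by (rule card_Un_le)
  also have "card (H a) \<le> K" using a by (intro H) auto
  also have "card (\<Union>l\<in>active_levels \<omega>. H (b l)) \<le> (\<Sum>l\<in>active_levels \<omega>. card (H (b l)))"
    by (rule card_UN_le[OF fin])
  also have "\<dots> \<le> (\<Sum>l\<in>active_levels \<omega>. K)"
  proof (rule sum_mono)
    fix l assume "l \<in> active_levels \<omega>" then show "card (H (b l)) \<le> K" using b(1) by (intro H) auto
  qed
  also have "\<dots> \<le> (m + K) * K" using card_active_levels[OF assms(3)] by simp
  finally show ?thesis by (simp add: algebra_simps)
qed

text \<open>The tokens that the enumeration of the program has to cover. Units that are not weights
  are grid widths; these are powers of two bounded by the slack, so only few exponents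
  occur.\<close>

definition available :: "token \<Rightarrow> bool" where
  "available = (\<lambda>(a, b, c, u). a \<le> T \<and> b \<le> T \<and> c \<le> 5 * K\<^sup>2 * 2 ^ m \<and>
     (u \<in> w ` A \<or> (\<exists>e. u = 2 ^ e \<and> 2 ^ e \<le> s T)))"

text \<open>Each tracked heavy item gets a token from its insertion to \<open>last_heavy\<close>.
  Each nonempty piece of an active level gets one token, with the rounded light weight as a multiple
  of the grid width. The two summands of the length bound are \<open>card_heavy_tokens\<close> and
  the number of active levels times the number of pieces per level.\<close>

lemma snapshot_as_tokens:
  assumes P: "P \<subseteq> A" "\<And>i. i \<in> P \<Longrightarrow> \<omega> \<le> w i" "\<omega> > 0" and time: "\<And>i. i \<in> A \<Longrightarrow> time i > 0"
  obtains Q where "length Q \<le> K * (m + K + 1) + (m + K) * (16 * K\<^sup>2 + 1)"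
    "\<And>\<tau>. \<tau> \<in> set Q \<Longrightarrow> available \<tau>"
    "\<And>t. t \<in> {1..T} \<Longrightarrow> load Q t = snapshot \<omega> P t"
proof -
  have finP: "finite P" using P(1) finite_A finite_subset by blast
  define Y where "Y = {i\<in>P. time i \<le> last_heavy \<omega> i}"
  define Z where "Z = {(l, c). l \<in> active_levels \<omega> \<and> c \<le> 16 * K\<^sup>2 \<and> piece_set l c \<noteq> {}}"
  define coef where "coef l c = sum (units l) {i\<in>P \<inter> light l. time i \<le> piece_end l c}" for l c
  define htok where "htok i = (time i, last_heavy \<omega> i, 1::nat, w i)" for i
  define ltok where "ltok = (\<lambda>(l, c). (Min (piece_set l c), piece_end l c, coef l c, grid l))"
  have finlev: "finite (active_levels \<omega>)" by (simp add: active_levels_def)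
  have finY: "finite Y" using finP by (simp add: Y_def)
  have Zsub: "Z \<subseteq> active_levels \<omega> \<times> {..16 * K\<^sup>2}" by (auto simp: Z_def)
  then have finZ: "finite Z" using finlev finite_subset by blast
  obtain ys where ys: "set ys = Y" "distinct ys" using finite_distinct_list[OF finY] by blast
  obtain zs where zs: "set zs = Z" "distinct zs" using finite_distinct_list[OF finZ] by blast
  define Q where "Q = map htok ys @ map ltok zs"
  show thesis
  proof
    have "length ys \<le> K * (m + K + 1)"
      using card_heavy_tokens[OF P time] ys by (metis Y_def distinct_card)
    moreover have "length zs \<le> (m + K) * (16 * K\<^sup>2 + 1)"
    proof -
      have "length zs = card Z" using zs by (metis distinct_card)
      also have "\<dots> \<le> card (active_levels \<omega> \<times> {..16 * K\<^sup>2})"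
        using Zsub finlev by (intro card_mono) auto
      also have "\<dots> \<le> (m + K) * (16 * K\<^sup>2 + 1)"
        using card_active_levels[OF P(3)] by (simp add: card_cartesian_product del: mult_Suc_right)
      finally show ?thesis .
    qed
    ultimately show "length Q \<le> K * (m + K + 1) + (m + K) * (16 * K\<^sup>2 + 1)"
      by (simp add: Q_def)
  next
    fix \<tau> assume "\<tau> \<in> set Q"
    moreover obtain a b c u where \<tau>: "\<tau> = (a, b, c, u)" by (cases \<tau>)
    ultimately consider i where "i \<in> Y" "(a, b, c, u) = htok i"
      | l d where "(l, d) \<in> Z" "(a, b, c, u) = ltok (l, d)"
      by (auto simp: Q_def ys zs)
    then show "available \<tau>"
    proof cases
      case 1
      moreover have "1 \<le> 5 * K\<^sup>2 * 2 ^ m" using K_pos by simp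
      ultimately show ?thesis using P(1) last_heavy_le[of \<omega> i] by (auto simp: htok_def Y_def available_def \<tau>)
    next
      case 2
      have ne: "piece_set l d \<noteq> {}" and l: "l \<in> active_levels \<omega>" using 2 by (auto simp: Z_def)
      then obtain t where t: "t \<in> piece_set l d" by blast
      define e where "e = piece_end l d"
      have e: "e \<in> piece_set l d" unfolding e_def using t by (rule piece_end_mem)
      then have "level e = l" "e \<in> {1..T}" by (auto simp: piece_set_def)
      have "Min (piece_set l d) \<in> piece_set l d" using ne finite_piece_set by simp
      then have "a \<le> T" "b \<le> T" using 2(2) e by (auto simp: ltok_def e_def piece_set_def)
      \<comment> \<open>The true light weight is at most \<open>4 * K\<^sup>2\<close> scales, a
        scale is at most \<open>2 ^ m\<close> grid widths, and rounding adds at most one grid width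
        for each of at most \<open>2 ^ m\<close> items.\<close>
      moreover have "coef l d \<le> 5 * K\<^sup>2 * 2 ^ m"
      proof -
        have "coef l d * grid l \<le> (\<Sum>i\<in>{i\<in>P \<inter> light l. time i \<le> e}. w i + (grid l - 1))"
          unfolding coef_def sum_distrib_right e_def by (intro sum_mono units_grid)
        also have "\<dots> \<le> (\<Sum>i\<in>{i\<in>light l. time i \<le> e}. w i + (grid l - 1))"
          using finite_A by (intro sum_mono2) (auto simp: light_def)
        also have "\<dots> = sum w {i\<in>light l. time i \<le> e} + card {i\<in>light l. time i \<le> e} * (grid l - 1)"
          by (simp add: sum.distrib)
        also have "\<dots> \<le> 4 * K\<^sup>2 * (grid l * 2 ^ m) + 2 ^ m * grid l"
        proof (intro add_le_mono mult_le_mono)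
          have "sum w {i\<in>light l. time i \<le> e} \<le> 4 * K\<^sup>2 * scale l"
            using heavy_bound(2)[OF \<open>e \<in> {1..T}\<close>] \<open>level e = l\<close> by simp
          also have "\<dots> \<le> 4 * K\<^sup>2 * (grid l * 2 ^ m)" by (intro mult_le_mono2 scale_le_grid)
          finally show "sum w {i\<in>light l. time i \<le> e} \<le> 4 * K\<^sup>2 * (grid l * 2 ^ m)" .
          have "card {i\<in>light l. time i \<le> e} \<le> card A"
            using finite_A by (intro card_mono) (auto simp: light_def)
          then show "card {i\<in>light l. time i \<le> e} \<le> 2 ^ m" using card_A m by linarith
        qed simp
        finally have "coef l d * grid l \<le> (4 * K\<^sup>2 * 2 ^ m + 2 ^ m) * grid l"
          by (simp only: ac_simps distrib_left distrib_right)
        then have "coef l d \<le> 4 * K\<^sup>2 * 2 ^ m + 2 ^ m" using grid_pos[of l] by simp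
        also have "\<dots> \<le> 4 * K\<^sup>2 * 2 ^ m + K\<^sup>2 * 2 ^ m" using K_pos by simp
        finally show ?thesis by simp
      qed
      moreover have "grid l \<le> s T"
      proof -
        have "scale l > 0" using l P(3) by (auto simp: active_levels_def intro: gr0I)
        then have "l > 0" by (auto simp: scale_def intro: gr0I)
        then have "grid l \<le> scale l" unfolding grid_def scale_def
          by (cases l) (auto intro: power_increasing)
        also have "\<dots> \<le> s e" using scale_le[of e] \<open>level e = l\<close> by simp
        also have "\<dots> \<le> s T" using \<open>e \<in> {1..T}\<close> by (intro s_mono) auto
        finally show ?thesis .
      qed
      ultimately show ?thesis using 2(2) by (auto simp: ltok_def grid_def available_def \<tau>)
    qed
  next
    fix t assume t: "t \<in> {1..T}"
    have "sum_list (map (token_load t) (map htok ys)) = (\<Sum>i\<in>Y. token_load t (htok i))"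
      using ys by (simp add: o_def sum_list_distinct_conv_sum_set)
    also have "\<dots> = (\<Sum>i\<in>Y. if time i \<le> t \<and> t \<le> last_heavy \<omega> i then w i else 0)"
      by (intro sum.cong) (auto simp: htok_def)
    also have "\<dots> = sum w {i\<in>Y. time i \<le> t \<and> t \<le> last_heavy \<omega> i}"
      using finY by (simp add: sum.inter_filter)
    also have "{i\<in>Y. time i \<le> t \<and> t \<le> last_heavy \<omega> i} =
      (if scale (level t) < 2 * n * \<omega> then {i\<in>P \<inter> heavy (level t). time i \<le> t} else {})"
    proof -
      have "{i\<in>Y. time i \<le> t \<and> t \<le> last_heavy \<omega> i} = {i\<in>P. time i \<le> t \<and> t \<le> last_heavy \<omega> i}"
        by (auto simp: Y_def)
      also have "\<dots> = {i\<in>P. time i \<le> t \<and> i \<in> heavy (level t) \<and> scale (level t) < 2 * n * \<omega>}"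
        using P(1) le_last_heavy_iff[OF t] by blast
      finally show ?thesis by auto
    qed
    finally have 1: "sum_list (map (token_load t) (map htok ys)) =
      (if scale (level t) < 2 * n * \<omega> then sum w {i\<in>P \<inter> heavy (level t). time i \<le> t} else 0)"
      by simp
    have ltok: "token_load t (ltok z) = (if z = (level t, piece t) then coef (level t) (piece t) * grid (level t) else 0)"
      if "z \<in> Z" for z
    proof -
      obtain l c where z: "z = (l, c)" by (cases z)
      have ne: "piece_set l c \<noteq> {}" using that by (auto simp: z Z_def)
      have mem: "Min (piece_set l c) \<in> piece_set l c" "piece_end l c \<in> piece_set l c"
        using ne finite_piece_set piece_end_mem by (auto simp: all_not_in_conv[symmetric] simp del: all_not_in_conv intro!: Min_in)
      have "Min (piece_set l c) \<le> t \<and> t \<le> piece_end l c \<longleftrightarrow> t \<in> piece_set l c"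
        using piece_set_convex[OF mem] le_piece_end finite_piece_set by auto
      also have "\<dots> \<longleftrightarrow> l = level t \<and> c = piece t" using t by (auto simp: piece_set_def)
      finally show ?thesis by (auto simp: z ltok_def)
    qed
    have "sum_list (map (token_load t) (map ltok zs)) = (\<Sum>z\<in>Z. token_load t (ltok z))"
      using zs by (simp add: o_def sum_list_distinct_conv_sum_set)
    also have "\<dots> = (\<Sum>z\<in>Z. if z = (level t, piece t) then coef (level t) (piece t) * grid (level t) else 0)"
      using ltok by (rule sum.cong[OF refl])
    also have "\<dots> = (if (level t, piece t) \<in> Z then coef (level t) (piece t) * grid (level t) else 0)"
      using finZ by (simp add: sum.delta)
    also have "\<dots> = (if scale (level t) < 2 * n * \<omega> then coef (level t) (piece t) * grid (level t) else 0)"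
    proof -
      have "(level t, piece t) \<in> Z \<longleftrightarrow> level t \<in> active_levels \<omega>"
        using piece_le[OF t] t by (auto simp: Z_def piece_set_def)
      \<comment> \<open>On a tracked level that is not active every item of \<open>P\<close> is
        heavy, so the missing piece token would have multiplicity 0.\<close>
      moreover have "level t \<in> active_levels \<omega>"
        if lt: "scale (level t) < 2 * n * \<omega>" and ne: "coef (level t) (piece t) \<noteq> 0"
      proof -
        obtain i where "i \<in> P" "i \<in> light (level t)"
          using ne unfolding coef_def by (elim sum.not_neutral_contains_not_neutral) auto
        then have "\<omega> \<le> 2 * K * scale (level t)" using P(1,2) by (force simp: light_def heavy_def)
        then show ?thesis using lt t by (auto simp: active_levels_def)
      qed
      moreover have "scale (level t) < 2 * n * \<omega>" if "level t \<in> active_levels \<omega>"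
        using that by (simp add: active_levels_def)
      ultimately show ?thesis by auto
    qed
    finally show "load Q t = snapshot \<omega> P t"
      using 1 by (simp add: load_def Q_def snapshot_def rounded_def coef_def)
  qed
qed

text \<open>Once the slack exceeds \<open>n\<close> times the weight of the next item, it accommodates all
  remaining items, and the snapshot may drop to 0.\<close>

lemma snapshot_step:
  assumes "P \<subseteq> A" "\<omega>' \<le> \<omega>" "t \<in> {1..T}" "i \<in> A \<Longrightarrow> i \<notin> P \<and> time i > 0"
    and o: "j = (if i \<in> A then time i else 0)" "w i = \<omega>'"
  shows "(snapshot \<omega> P t + (if 1 \<le> j \<and> j \<le> t then w i else 0) \<le> snapshot \<omega>' (if i \<in> A then insert i P else P) t
      \<and> snapshot \<omega>' (if i \<in> A then insert i P else P) t \<le> W t)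
    \<or> snapshot \<omega> P t + n * w i \<le> W t"
proof (cases "scale (level t) < 2 * n * \<omega>'")
  case True
  also have "2 * n * \<omega>' \<le> 2 * n * \<omega>" using assms(2) by (rule mult_le_mono2)
  finally have eq: "snapshot \<omega> P t = rounded P t" by (simp add: snapshot_def)
  define P' where "P' = (if i \<in> A then insert i P else P)"
  have "P' \<subseteq> A" using assms by (auto simp: P'_def)
  have "2 * rounded P' t \<le> 2 * W t"
    using rounded_le[OF \<open>P' \<subseteq> A\<close> assms(3)] fits[OF assms(3)] scale_le[of t] by linarith
  moreover have "finite P" using assms(1) finite_A finite_subset by blast
  then have "rounded P t + (if 1 \<le> j \<and> j \<le> t then w i else 0) \<le> rounded P' t"
    using rounded_insert[of P i t] assms by (auto simp: P'_def)
  moreover have "snapshot \<omega>' P' t = rounded P' t" using True by (simp add: snapshot_def)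
  ultimately show ?thesis unfolding eq P'_def by simp
next
  case False
  define y where "y = n * w i"
  have "snapshot \<omega> P t \<le> rounded P t" by (simp add: snapshot_def)
  moreover have "2 * y \<le> scale (level t)" using False o by (simp add: y_def mult.assoc)
  moreover have "2 * rounded P t + scale (level t) \<le> 2 * W t"
    using rounded_le[OF assms(1,3)] fits[OF assms(3)] scale_le[of t] by linarith
  ultimately have "snapshot \<omega> P t + y \<le> W t" by linarith
  then show ?thesis by (simp add: y_def)
qed

end

section \<open>The dynamic program\<close>

type_synonym item = "nat \<times> nat \<times> nat list"
type_synonym plan = "(nat \<times> nat) list"
type_synonym entry = "token list \<times> nat \<times> plan"

abbreviation sorted_by_weight :: "item list \<Rightarrow> bool" where
  "sorted_by_weight \<equiv> sorted_wrt (\<lambda>x y. fst (snd y) \<le> fst (snd x))"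

text \<open>As items are processed by decreasing weight, \<open>n * w\<close> bounds the weight of all items that are
  still to come, including the present one. A period in which that much capacity is left need not be tracked.\<close>

definition admissible ::
  "nat list \<Rightarrow> nat \<Rightarrow> token list \<Rightarrow> token list \<Rightarrow> nat \<Rightarrow> nat \<Rightarrow> bool" where
  "admissible caps n Q' Q j w \<longleftrightarrow> (\<forall>t\<in>{1..length caps}.
     load Q' t + (if 1 \<le> j \<and> j \<le> t then w else 0) \<le> load Q t \<and> load Q t \<le> caps ! (t - 1) \<or>
     load Q' t + n * w \<le> caps ! (t - 1))"

text \<open>In a plan, an item paired with period 0 is left out.\<close>

inductive dp_run ::
  "nat list \<Rightarrow> nat \<Rightarrow> token list set \<Rightarrow> item list \<Rightarrow> token list \<Rightarrow> nat \<Rightarrow> plan \<Rightarrow> bool"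
  for caps n U where
  start: "dp_run caps n U [] [] 0 []"
| extend: "dp_run caps n U xs Q' p sol \<Longrightarrow> Q \<in> U \<Longrightarrow> j \<le> length g \<Longrightarrow> admissible caps n Q' Q j w \<Longrightarrow>
    dp_run caps n U (xs @ [(i, w, g)]) Q (p + (0 # g) ! j) ((i, j) # sol)"

section \<open>Runs yield feasible plans\<close>

abbreviation planned_weight :: "(nat \<Rightarrow> nat) \<Rightarrow> nat \<Rightarrow> plan \<Rightarrow> nat" where
  "planned_weight w t sol \<equiv> sum_list (map (\<lambda>(i, j). if 1 \<le> j \<and> j \<le> t then w i else 0) sol)"

text \<open>The run is read backwards, and \<open>r\<close> is the weight of the items already
  passed. At a tracked step the loads account for the current item. At an untracked step the free
  capacity \<open>n * v\<close> before the item absorbs it together with \<open>r\<close>, since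
  \<open>r\<close> stems from later and thus no heavier items. The assumption on
  \<open>load Q t\<close> is conditional because an untracked step leaves the load of the new state
  unconstrained.\<close>

lemma dp_run_fits:
  assumes "dp_run caps n U xs Q p sol" "sorted_by_weight xs"
    "length xs \<le> n" "t \<in> {1..length caps}"
    and "load Q t \<le> caps ! (t - 1) \<Longrightarrow> load Q t + r \<le> caps ! (t - 1)"
    and "\<And>i v g. (i, v, g) \<in> set xs \<Longrightarrow> r \<le> (n - length xs) * v \<and> v = w i"
  shows "planned_weight w t sol + r \<le> caps ! (t - 1)"
  using assms
proof (induction arbitrary: r rule: dp_run.induct)
  case start
  then show ?case by (simp add: load_def)
next
  case (extend xs Q' p sol Q j g v i)
  let ?u = "if 1 \<le> j \<and> j \<le> t then v else 0"
  have v: "v = w i" and r: "r \<le> (n - Suc (length xs)) * v" using extend.prems(5)[of i v g] by auto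
  have le: "?u + r \<le> (n - length xs) * v"
  proof -
    have "Suc (n - Suc (length xs)) = n - length xs" using extend.prems(2) by simp
    then have "(n - length xs) * v = v + (n - Suc (length xs)) * v" by (metis mult_Suc)
    then show ?thesis using r by auto
  qed
  have "planned_weight w t sol + (?u + r) \<le> caps ! (t - 1)"
  proof (rule extend.IH)
    show "sorted_by_weight xs" "length xs \<le> n"
      using extend.prems by (auto simp: sorted_wrt_append)
    show "load Q' t + (?u + r) \<le> caps ! (t - 1)" if "load Q' t \<le> caps ! (t - 1)"
    proof -
      consider "load Q' t + ?u \<le> load Q t" "load Q t \<le> caps ! (t - 1)" | "load Q' t + n * v \<le> caps ! (t - 1)"
        using extend.hyps(4) extend.prems(3) unfolding admissible_def by blast
      then show ?thesis
      proof cases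
        case 1
        then show ?thesis using extend.prems(4) by linarith
      next
        case 2
        have "(n - length xs) * v \<le> n * v" by simp
        then show ?thesis using 2 le by linarith
      qed
    qed
    fix i' v' g' assume i': "(i', v', g') \<in> set xs"
    then have "v \<le> v'" using extend.prems(1) by (force simp: sorted_wrt_append)
    then have "(n - length xs) * v \<le> (n - length xs) * v'" by (rule mult_le_mono2)
    moreover have "v' = w i'" using extend.prems(5)[of i' v' g'] i' by auto
    ultimately show "?u + r \<le> (n - length xs) * v' \<and> v' = w i'" using le by linarith
  qed (use extend.prems in auto)
  then show ?case unfolding v by (simp add: algebra_simps)
qed

lemma dp_run_plan:
  assumes "dp_run caps n U xs Q p sol" "\<And>i v g. (i, v, g) \<in> set xs \<Longrightarrow> g = map (gn i) [1..<T + 1]"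
  shows "map fst sol = rev (map fst xs) \<and> (\<forall>(i, j)\<in>set sol. j \<le> T) \<and>
    p = sum_list (map (\<lambda>(i, j). if j = 0 then 0 else gn i j) sol)"
  using assms
proof (induction rule: dp_run.induct)
  case (extend xs Q' p sol Q j g v i)
  have g: "g = map (gn i) [1..<T + 1]" using extend.prems[of i v g] by (simp del: upt_Suc)
  have IH: "map fst sol = rev (map fst xs) \<and> (\<forall>(i, j)\<in>set sol. j \<le> T) \<and>
    p = sum_list (map (\<lambda>(i, j). if j = 0 then 0 else gn i j) sol)"
    using extend.prems by (intro extend.IH) (auto simp del: upt_Suc)
  have "(0 # g) ! j = (if j = 0 then 0 else gn i j)"
    using extend.hyps(3) unfolding g by (cases j) (auto simp del: upt_Suc)
  moreover have "j \<le> T" using extend.hyps(3) g by (simp del: upt_Suc)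
  ultimately show ?case using IH by auto
qed auto

section \<open>Keeping one best plan per state\<close>

definition upd_best :: "nat \<times> plan \<Rightarrow> (nat \<times> plan) option \<Rightarrow> (nat \<times> plan) option" where
  "upd_best c b = (case b of None \<Rightarrow> Some c | Some d \<Rightarrow> if fst d \<le> fst c then Some c else b)"

text \<open>A relation rather than a function of the candidate set, since ties are resolved by the
  order in which the candidates are tried.\<close>

definition is_best :: "(nat \<times> plan) set \<Rightarrow> (nat \<times> plan) option \<Rightarrow> bool" where
  "is_best S b \<longleftrightarrow> (case b of None \<Rightarrow> S = {} | Some d \<Rightarrow> d \<in> S \<and> (\<forall>c\<in>S. fst c \<le> fst d))"

definition try_option ::
  "nat list \<Rightarrow> nat \<Rightarrow> token list \<Rightarrow> item \<Rightarrow> entry \<Rightarrow> nat \<Rightarrow> nat \<times> (nat \<times> plan) option \<Rightarrow> nat \<times> (nat \<times> plan) option"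
  where "try_option caps n Q = (\<lambda>(i, w, g) (Q', p, sol) x (j, b).
    (j + 1, if admissible caps n Q' Q j w then upd_best (p + x, (i, j) # sol) b else b))"

definition try_entry ::
  "nat list \<Rightarrow> nat \<Rightarrow> token list \<Rightarrow> item \<Rightarrow> entry \<Rightarrow> (nat \<times> plan) option \<Rightarrow> (nat \<times> plan) option" where
  "try_entry caps n Q x e b = snd (fold (try_option caps n Q x e) (0 # snd (snd x)) (0, b))"

definition reach_state ::
  "nat list \<Rightarrow> nat \<Rightarrow> item \<Rightarrow> entry list \<Rightarrow> token list \<Rightarrow> entry list \<Rightarrow> entry list" where
  "reach_state caps n x F Q G = (case fold (try_entry caps n Q x) F None of None \<Rightarrow> G | Some b \<Rightarrow> (Q, b) # G)"

definition next_frontier ::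
  "nat list \<Rightarrow> nat \<Rightarrow> token list list \<Rightarrow> item \<Rightarrow> entry list \<Rightarrow> entry list" where
  "next_frontier caps n U x F = fold (reach_state caps n x F) U []"

definition frontier :: "nat list \<Rightarrow> nat \<Rightarrow> token list list \<Rightarrow> item list \<Rightarrow> entry list" where
  "frontier caps n U xs = fold (next_frontier caps n U) xs [([], 0, [])]"

definition best_entry :: "entry list \<Rightarrow> (nat \<times> plan) option" where
  "best_entry F = fold (\<lambda>e. upd_best (snd e)) F None"

lemma is_best_upd_best: "is_best S b \<Longrightarrow> is_best (insert c S) (upd_best c b)"
  by (auto simp: is_best_def upd_best_def split: option.splits if_splits)

lemma is_best_fold_try_option:
  assumes "is_best S b"
  shows "is_best (S \<union> {(p + ys ! k, (i, j + k) # sol) | k. k < length ys \<and> admissible caps n Q' Q (j + k) w})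
    (snd (fold (try_option caps n Q (i, w, g) (Q', p, sol)) ys (j, b)))"
  using assms
proof (induction ys arbitrary: S b j)
  case (Cons y ys)
  define b' where "b' = (if admissible caps n Q' Q j w then upd_best (p + y, (i, j) # sol) b else b)"
  \<comment> \<open>The dummy variable \<open>z\<close> turns the condition into a set that is a
    singleton or empty.\<close>
  define S' where "S' = S \<union> {(p + y, (i, j) # sol) | z::unit. admissible caps n Q' Q j w}"
  have "is_best S' b'"
    using Cons.prems is_best_upd_best[of S b] by (auto simp: S'_def b'_def)
  note IH = Cons.IH[OF this, of "j + 1"]
  have eq: "{(p + (y # ys) ! k, (i, j + k) # sol) | k. k < length (y # ys) \<and> admissible caps n Q' Q (j + k) w}
    = {(p + y, (i, j) # sol) | z::unit. admissible caps n Q' Q j w} \<union>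
      {(p + ys ! k, (i, j + 1 + k) # sol) | k. k < length ys \<and> admissible caps n Q' Q (j + 1 + k) w}"
    (is "?L = ?A \<union> ?B")
  proof (intro equalityI subsetI)
    fix c assume "c \<in> ?L"
    then obtain k where "c = (p + (y # ys) ! k, (i, j + k) # sol)" "k < length (y # ys)" "admissible caps n Q' Q (j + k) w"
      by blast
    then show "c \<in> ?A \<union> ?B" by (cases k) auto
  next
    fix c assume "c \<in> ?A \<union> ?B"
    then show "c \<in> ?L"
    proof
      assume "c \<in> ?A" then show ?thesis by (auto intro!: exI[of _ 0])
    next
      assume "c \<in> ?B"
      then obtain k where "c = (p + ys ! k, (i, j + 1 + k) # sol)" "k < length ys" "admissible caps n Q' Q (j + 1 + k) w"
        by blast
      then show ?thesis by (auto intro!: exI[of _ "Suc k"])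
    qed
  qed
  show ?case using IH unfolding eq
    by (simp add: try_option_def b'_def S'_def Un_assoc)
qed simp

definition candidates ::
  "nat list \<Rightarrow> nat \<Rightarrow> token list \<Rightarrow> item \<Rightarrow> entry set \<Rightarrow> (nat \<times> plan) set" where
  "candidates caps n Q = (\<lambda>(i, w, g) E. {(p + (0 # g) ! k, (i, k) # sol) | Q' p sol k.
     (Q', p, sol) \<in> E \<and> k \<le> length g \<and> admissible caps n Q' Q k w})"

lemma is_best_try_entry:
  assumes "is_best S b"
  shows "is_best (S \<union> candidates caps n Q x {e}) (try_entry caps n Q x e b)"
proof -
  obtain i w g where x: "x = (i, w, g)" by (cases x)
  obtain Q' p sol where e: "e = (Q', p, sol)" by (cases e)
  show ?thesis
    using is_best_fold_try_option[OF assms, of p "0 # g" i 0 sol caps n Q' Q w g]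
    unfolding x e candidates_def try_entry_def by (simp add: less_Suc_eq_le)
qed

lemma candidates_union: "candidates caps n Q x (E \<union> E') = candidates caps n Q x E \<union> candidates caps n Q x E'"
  by (auto simp: candidates_def split: prod.splits)

lemma is_best_fold_try_entry:
  "is_best S b \<Longrightarrow> is_best (S \<union> candidates caps n Q x (set F)) (fold (try_entry caps n Q x) F b)"
proof (induction F arbitrary: S b)
  case Nil
  then show ?case by (simp add: candidates_def split: prod.splits)
next
  case (Cons e F)
  show ?case
    using Cons.IH[OF is_best_try_entry[OF Cons.prems, of caps n Q x e]]
      candidates_union[of caps n Q x "{e}" "set F"] by (simp add: Un_assoc)
qed

lemma set_fold_reach_state:
  "set (fold (reach_state caps n x F) U G) =
   set G \<union> {(Q, b) | Q b. Q \<in> set U \<and> fold (try_entry caps n Q x) F None = Some b}"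
proof (induction U arbitrary: G)
  case (Cons Q U)
  show ?case
    unfolding fold_Cons o_def Cons by (auto simp: reach_state_def split: option.splits)
qed simp

lemma length_fold_reach_state: "length (fold (reach_state caps n x F) U G) \<le> length G + length U"
proof (induction U arbitrary: G)
  case (Cons Q U)
  show ?case
    using Cons[of "reach_state caps n x F Q G"] by (auto simp: reach_state_def split: option.splits)
qed simp

lemma set_next_frontier:
  "set (next_frontier caps n U x F) =
   {(Q, b) | Q b. Q \<in> set U \<and> fold (try_entry caps n Q x) F None = Some b}"
  by (simp add: next_frontier_def set_fold_reach_state)

lemma frontier_snoc: "frontier caps n U (xs @ [x]) = next_frontier caps n U x (frontier caps n U xs)"
  by (simp add: frontier_def)

lemma frontier_sound:
  "(Q, p, sol) \<in> set (frontier caps n U xs) \<Longrightarrow> dp_run caps n (set U) xs Q p sol"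
proof (induction xs arbitrary: Q p sol rule: rev_induct)
  case Nil
  then show ?case by (auto simp: frontier_def intro: dp_run.start)
next
  case (snoc x xs)
  obtain i w g where x: "x = (i, w, g)" by (cases x)
  have "is_best (candidates caps n Q x (set (frontier caps n U xs))) (Some (p, sol))" "Q \<in> set U"
    using snoc.prems is_best_fold_try_entry[of "{}" None caps n Q x "frontier caps n U xs"]
    by (auto simp: frontier_snoc set_next_frontier is_best_def)
  then obtain Q' p' sol' k where "(Q', p', sol') \<in> set (frontier caps n U xs)" "k \<le> length g"
    "admissible caps n Q' Q k w" "p = p' + (0 # g) ! k" "sol = (i, k) # sol'"
    unfolding x by (auto simp: is_best_def candidates_def)
  then show ?case unfolding x using snoc.IH \<open>Q \<in> set U\<close> by (auto intro: dp_run.extend)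
qed

text \<open>An exchange argument: \<open>admissible\<close> sees only the two token lists and the
  weight and period of the new item, so the plan of a prefix can be replaced by a more profitable
  one that ends in the same state.\<close>

lemma frontier_complete:
  "dp_run caps n (set U) xs Q p sol \<Longrightarrow> \<exists>p' sol'. (Q, p', sol') \<in> set (frontier caps n U xs) \<and> p \<le> p'"
proof (induction rule: dp_run.induct)
  case start
  then show ?case by (simp add: frontier_def)
next
  case (extend xs Q' p sol Q j g w i)
  let ?x = "(i, w, g)" and ?F = "frontier caps n U xs"
  obtain p' sol' where F: "(Q', p', sol') \<in> set ?F" "p \<le> p'" using extend.IH by blast
  then have "(p' + (0 # g) ! j, (i, j) # sol') \<in> candidates caps n Q ?x (set ?F)"
    using extend.hyps unfolding candidates_def by auto
  moreover have "is_best (candidates caps n Q ?x (set ?F)) (fold (try_entry caps n Q ?x) ?F None)"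
    using is_best_fold_try_entry[of "{}" None] by (simp add: is_best_def)
  ultimately obtain b where b: "fold (try_entry caps n Q ?x) ?F None = Some b" "p' + (0 # g) ! j \<le> fst b"
    by (auto simp: is_best_def split: option.splits)
  then have "(Q, b) \<in> set (frontier caps n U (xs @ [?x]))"
    using extend.hyps by (simp add: frontier_snoc set_next_frontier)
  then show ?case using b(2) F(2) by (intro exI[of _ "fst b"] exI[of _ "snd b"]) auto
qed

lemma length_frontier: "length (frontier caps n U xs) \<le> max 1 (length U)"
proof (cases xs rule: rev_cases)
  case (snoc ys y)
  then show ?thesis
    using length_fold_reach_state[of caps n y "frontier caps n U ys" U "[]"]
    by (simp add: frontier_snoc next_frontier_def)
qed (simp add: frontier_def)

lemma is_best_best_entry: "is_best (snd ` set F) (best_entry F)"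
proof -
  have "is_best (S \<union> snd ` set F) (fold (\<lambda>e. upd_best (snd e)) F b)" if "is_best S b" for S b
    using that
  proof (induction F arbitrary: S b)
    case (Cons e F)
    show ?case using Cons.IH[OF is_best_upd_best[OF Cons.prems, of "snd e"]] by simp
  qed simp
  from this[of "{}" None] show ?thesis by (simp add: best_entry_def is_best_def)
qed

section \<open>A run that follows the near-optimal schedule\<close>

context slack_schedule
begin

text \<open>The invariant ties the state to the snapshot for the weight of the last item; before the
  first item the snapshot is 0 for every \<open>\<omega>\<close>. Only loads matter in the
  assumption on \<open>U\<close>, because the program pads token lists to a fixed length.\<close>

lemma snapshot_run:
  assumes xs: "sorted_by_weight xs" "distinct (map fst xs)"
    "\<And>i v g. (i, v, g) \<in> set xs \<Longrightarrow> v = w i \<and> w i > 0 \<and> g = map (gn i) [1..<T + 1]"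
    and time: "\<And>i. i \<in> A \<Longrightarrow> time i \<in> {1..T}"
    and caps: "length caps = T" "\<And>t. t \<in> {1..T} \<Longrightarrow> caps ! (t - 1) = W t"
    and U: "\<And>Q. length Q \<le> K * (m + K + 1) + (m + K) * (16 * K\<^sup>2 + 1) \<Longrightarrow>
       (\<And>\<tau>. \<tau> \<in> set Q \<Longrightarrow> available \<tau>) \<Longrightarrow> \<exists>Q'\<in>U. load Q' = load Q"
  shows "\<exists>Q sol. dp_run caps n U xs Q (\<Sum>i\<in>fst ` set xs \<inter> A. gn i (time i)) sol \<and>
    (\<forall>\<omega>. (xs = [] \<or> \<omega> = fst (snd (last xs))) \<longrightarrow> (\<forall>t\<in>{1..T}. load Q t = snapshot \<omega> (fst ` set xs \<inter> A) t))"
  using xs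
proof (induction xs rule: rev_induct)
  case Nil
  have "dp_run caps n U [] [] 0 []" by (rule dp_run.start)
  then show ?case by (auto simp: load_def snapshot_def rounded_def intro!: exI)
next
  case (snoc x xs)
  obtain i v g where x: "x = (i, v, g)" by (cases x)
  have i: "v = w i" "w i > 0" "g = map (gn i) [1..<T + 1]" using snoc.prems(3)[of i v g] by (auto simp: x)
  define P where "P = fst ` set xs \<inter> A"
  define P' where "P' = (if i \<in> A then insert i P else P)"
  have P': "P' = fst ` set (xs @ [x]) \<inter> A" by (auto simp: P_def P'_def x)
  have "i \<notin> P" using snoc.prems(2) by (auto simp: x P_def)
  obtain Q sol where Q: "dp_run caps n U xs Q (\<Sum>i\<in>P. gn i (time i)) sol"
    "\<And>\<omega> t. xs = [] \<or> \<omega> = fst (snd (last xs)) \<Longrightarrow> t \<in> {1..T} \<Longrightarrow> load Q t = snapshot \<omega> P t"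
  proof -
    have "\<exists>Q sol. dp_run caps n U xs Q (\<Sum>i\<in>P. gn i (time i)) sol \<and>
      (\<forall>\<omega>. (xs = [] \<or> \<omega> = fst (snd (last xs))) \<longrightarrow> (\<forall>t\<in>{1..T}. load Q t = snapshot \<omega> P t))"
      unfolding P_def
    proof (rule snoc.IH)
      show "sorted_by_weight xs" "distinct (map fst xs)"
        using snoc.prems(1,2) by (auto simp: sorted_wrt_append)
      fix i v g assume "(i, v, g) \<in> set xs"
      then show "v = w i \<and> w i > 0 \<and> g = map (gn i) [1..<T + 1]"
        using snoc.prems(3)[of i v g] by (simp del: upt_Suc)
    qed
    then show thesis using that by blast
  qed
  \<comment> \<open>For the first item its own weight serves as the preceding one, so that
    \<open>w i \<le> \<omega>\<close> holds in any case.\<close>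
  define \<omega> where "\<omega> = (if xs = [] then w i else fst (snd (last xs)))"
  have "w i \<le> \<omega>"
    using snoc.prems(1) by (auto simp: \<omega>_def sorted_wrt_append x i)
  have le: "w i \<le> w j" if j: "j \<in> P'" for j
  proof (cases "j = i")
    case False
    then obtain v' g' where "(j, v', g') \<in> set xs" using j by (auto simp: P'_def P_def split: if_splits)
    then have "v \<le> v'" "v' = w j"
      using snoc.prems(1) snoc.prems(3)[of j v' g'] by (force simp: sorted_wrt_append x, simp)
    then show ?thesis using i by simp
  qed simp
  have "P' \<subseteq> A" by (auto simp: P')
  have pos: "time i > 0" if "i \<in> A" for i using time[OF that] by simp
  obtain R where R: "length R \<le> K * (m + K + 1) + (m + K) * (16 * K\<^sup>2 + 1)"
    "\<And>\<tau>. \<tau> \<in> set R \<Longrightarrow> available \<tau>"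
    "\<And>t. t \<in> {1..T} \<Longrightarrow> load R t = snapshot (w i) P' t"
    using snapshot_as_tokens[OF \<open>P' \<subseteq> A\<close> le \<open>w i > 0\<close> pos] by blast
  obtain Q' where Q': "Q' \<in> U" "load Q' = load R" using U[OF R(1,2)] by blast
  define j where "j = (if i \<in> A then time i else 0)"
  have "admissible caps n Q Q' j v"
    unfolding admissible_def
  proof
    fix t assume t: "t \<in> {1..length caps}"
    have PA: "P \<subseteq> A" by (simp add: P_def)
    have iA: "i \<notin> P \<and> time i > 0" if "i \<in> A" using time[OF that] \<open>i \<notin> P\<close> by simp
    have t': "t \<in> {1..T}" using t caps by simp
    have eqs: "load Q t = snapshot \<omega> P t" "load Q' t = snapshot (w i) P' t" "caps ! (t - 1) = W t"
      using Q(2)[of \<omega> t] t' caps R(3) by (auto simp: \<omega>_def Q'(2))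
    show "load Q t + (if 1 \<le> j \<and> j \<le> t then v else 0) \<le> load Q' t \<and> load Q' t \<le> caps ! (t - 1) \<or>
      load Q t + n * v \<le> caps ! (t - 1)"
      unfolding eqs i P'_def by (rule snapshot_step[OF PA \<open>w i \<le> \<omega>\<close> t' iA j_def refl])
  qed
  moreover have "j \<le> length g" using time[of i] i by (auto simp: j_def simp del: upt_Suc)
  ultimately have "dp_run caps n U (xs @ [(i, v, g)]) Q' ((\<Sum>i\<in>P. gn i (time i)) + (0 # g) ! j) ((i, j) # sol)"
    using Q(1) Q'(1) by (intro dp_run.extend)
  moreover have "(\<Sum>i\<in>P. gn i (time i)) + (0 # g) ! j = (\<Sum>i\<in>P'. gn i (time i))"
  proof (cases "i \<in> A")
    case True
    then obtain k where "time i = Suc k" "k < T" using time[OF True] by (cases "time i") auto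
    then have "(0 # g) ! j = gn i (time i)" using True by (simp add: j_def i del: upt_Suc)
    moreover have "finite P" by (simp add: P_def)
    ultimately show ?thesis using True \<open>i \<notin> P\<close> by (simp add: P'_def)
  qed (simp add: P'_def j_def)
  ultimately have "dp_run caps n U (xs @ [x]) Q' (\<Sum>i\<in>P'. gn i (time i)) ((i, j) # sol)"
    by (simp only: x)
  moreover have "\<forall>\<omega>. (xs @ [x] = [] \<or> \<omega> = fst (snd (last (xs @ [x])))) \<longrightarrow> (\<forall>t\<in>{1..T}. load Q' t = snapshot \<omega> P' t)"
    using R(3) by (auto simp: x Q'(2) i simp del: upt_Suc)
  ultimately show ?case unfolding P'[symmetric] by blast
qed

end

section \<open>Evaluation with cost bounds\<close>

text \<open>Upper bounds instead of exact costs let the rules compose, and \<open>ev_conv\<close>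
  rounds the accumulated bound at the end.\<close>

definition ev :: "program \<Rightarrow> val list \<Rightarrow> expr \<Rightarrow> val \<Rightarrow> nat \<Rightarrow> bool" where
  "ev P env e v b \<longleftrightarrow> (\<exists>c\<le>b. evals P env e v c)"

definition small :: "nat \<Rightarrow> nat \<Rightarrow> bool" where "small G k \<longleftrightarrow> k < 2 ^ G"

lemma small_mono: "small G k \<Longrightarrow> j \<le> k \<Longrightarrow> small G j"
  by (auto simp: small_def)

lemma bits_le: "small G k \<Longrightarrow> 0 < G \<Longrightarrow> bits k \<le> G"
  by (auto simp: bits_def small_def intro: floorlog_leI)

lemma evI: "evals P env e v c \<Longrightarrow> c \<le> b \<Longrightarrow> ev P env e v b"
  by (auto simp: ev_def)

lemma evE:
  assumes "ev P env e v b" obtains c where "evals P env e v c" "c \<le> b"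
  using assms by (auto simp: ev_def)

lemma ev_conv: "ev P env e v b \<Longrightarrow> v = v' \<Longrightarrow> b \<le> b' \<Longrightarrow> ev P env e v' b'"
  by (auto simp: ev_def intro: order.trans)

lemma ev_var: "i < length env \<Longrightarrow> ev P env (Var i) (env ! i) 1"
  by (rule evI[OF evals.var]) auto

lemma ev_var_nth:
  "ev P (a0 # env) (Var 0) a0 1"
  "ev P (a0 # a1 # env) (Var 1) a1 1"
  "ev P (a0 # a1 # a2 # env) (Var 2) a2 1"
  "ev P (a0 # a1 # a2 # a3 # env) (Var 3) a3 1"
  "ev P (a0 # a1 # a2 # a3 # a4 # env) (Var 4) a4 1"
  "ev P (a0 # a1 # a2 # a3 # a4 # a5 # env) (Var 5) a5 1"
  "ev P (a0 # a1 # a2 # a3 # a4 # a5 # a6 # env) (Var 6) a6 1"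
  "ev P (a0 # a1 # a2 # a3 # a4 # a5 # a6 # a7 # env) (Var 7) a7 1"
  by (rule ev_conv, rule ev_var; simp)+

lemma ev_lit: "small G k \<Longrightarrow> 0 < G \<Longrightarrow> ev P env (Lit k) (Num k) G"
  by (rule evI[OF evals.lit bits_le])

lemma ev_arith:
  "ev P env e1 (Num a) c1 \<Longrightarrow> ev P env e2 (Num b) c2 \<Longrightarrow> small G a \<Longrightarrow> small G b \<Longrightarrow> 0 < G \<Longrightarrow>
   ev P env (Arith f e1 e2) (Num (arith_val f a b)) (c1 + c2 + 2 * G)"
  using bits_le[of G a] bits_le[of G b] by (elim evE, intro evI[OF evals.arith]) auto

lemmas ev_ops =
  ev_arith[where f = Add, unfolded arith_val.simps] ev_arith[where f = Sub, unfolded arith_val.simps]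
  ev_arith[where f = Mul, unfolded arith_val.simps] ev_arith[where f = Leq, unfolded arith_val.simps]

lemma ev_pair:
  "ev P env e1 a c1 \<Longrightarrow> ev P env e2 b c2 \<Longrightarrow> ev P env (MkPair e1 e2) (Pair a b) (c1 + c2 + 1)"
  by (elim evE, rule evI[OF evals.pair]) auto

lemma ev_fst: "ev P env e (Pair a b) c \<Longrightarrow> ev P env (Fst e) a (c + 1)"
  by (elim evE, rule evI[OF evals.fst]) auto

lemma ev_snd: "ev P env e (Pair a b) c \<Longrightarrow> ev P env (Snd e) b (c + 1)"
  by (elim evE, rule evI[OF evals.snd]) auto

lemma ev_ispair:
  "ev P env e v c \<Longrightarrow> ev P env (IsPair e) (Num (case v of Pair _ _ \<Rightarrow> 1 | Num _ \<Rightarrow> 0)) (c + 1)"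
  by (elim evE, rule evI[OF evals.ispair]) auto

text \<open>Charging both branches keeps the bounds free of case distinctions, at the price of
  larger constants.\<close>

lemma ev_cond:
  assumes "ev P env e (Num k) c0" "k \<noteq> 0 \<Longrightarrow> ev P env e1 v1 c1" "k = 0 \<Longrightarrow> ev P env e2 v2 c2"
  shows "ev P env (Cond e e1 e2) (if k = 0 then v2 else v1) (c0 + (c1 + c2) + 1)"
proof (cases "k = 0")
  case True
  show ?thesis using assms(1) assms(3)[OF True] True
    by (elim evE) (rule evI, simp, rule evals.cond_false, auto)
next
  case False
  show ?thesis using assms(1) assms(2)[OF False] False
    by (elim evE) (rule evI, simp, rule evals.cond_true, auto)
qed

lemma ev_cond_zero:
  "ev P env e (Num k) c0 \<Longrightarrow> k = 0 \<Longrightarrow> ev P env e2 v c2 \<Longrightarrow> ev P env (Cond e e1 e2) v (c0 + c2 + 1)"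
  using ev_cond[of P env e k c0 e1 v 0 e2 v c2] by simp

lemma ev_cond_ispair_true:
  assumes "ev P env e (Pair a b) c0" "ev P env e1 v c1"
  shows "ev P env (Cond (IsPair e) e1 e2) v (c0 + c1 + 2)"
  using ev_cond[OF ev_ispair[OF assms(1)], of e1 v c1 e2 v 0] assms(2)
  by (auto elim!: ev_conv)

lemma ev_cond_ispair_false:
  assumes "ev P env e (Num k) c0" "ev P env e2 v c2"
  shows "ev P env (Cond (IsPair e) e1 e2) v (c0 + c2 + 2)"
  using ev_cond[OF ev_ispair[OF assms(1)], of e1 v 0 e2 v c2] assms(2)
  by (auto elim!: ev_conv)

lemma ev_bind:
  "ev P env e1 v1 c1 \<Longrightarrow> ev P (v1 # env) e2 v2 c2 \<Longrightarrow> ev P env (Bind e1 e2) v2 (c1 + c2 + 1)"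
  by (elim evE, rule evI[OF evals.bind]) auto

lemma ev_call:
  "f < length P \<Longrightarrow> ev P env e v c1 \<Longrightarrow> ev P [v] (P ! f) r c2 \<Longrightarrow> ev P env (Call f e) r (c1 + c2 + 1)"
  by (elim evE, rule evI[OF evals.call]) auto

lemmas ev_rules = ev_var_nth ev_pair ev_fst ev_snd ev_bind

text \<open>The argument of a loop is \<open>(ctx, (list, acc))\<close>.\<close>

abbreviation ctx_at :: "nat \<Rightarrow> expr" where "ctx_at i \<equiv> Fst (Var i)"
abbreviation elt_at :: "nat \<Rightarrow> expr" where "elt_at i \<equiv> Fst (Fst (Snd (Var i)))"
abbreviation acc_at :: "nat \<Rightarrow> expr" where "acc_at i \<equiv> Snd (Snd (Var i))"
abbreviation loop_arg :: "expr \<Rightarrow> expr \<Rightarrow> expr \<Rightarrow> expr" where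
  "loop_arg c l a \<equiv> MkPair c (MkPair l a)"
abbreviation loop_val :: "val \<Rightarrow> val \<Rightarrow> val \<Rightarrow> val" where
  "loop_val c l a \<equiv> Pair c (Pair l a)"

text \<open>Function \<open>k\<close> calls itself on the tail of the list. The language is
  first-order, so whatever the step needs from outside travels along in the context.\<close>

definition fold_body :: "nat \<Rightarrow> expr \<Rightarrow> expr" where
  "fold_body k step = Cond (IsPair (Fst (Snd (Var 0))))
     (Call k (loop_arg (ctx_at 0) (Snd (Fst (Snd (Var 0)))) step)) (acc_at 0)"

text \<open>\<open>Inv\<close> relates the remaining list to the accumulator, so it can express
  bounds that are used up during the loop. Besides the step, a round costs 5 units for the list
  test, 8 for the new argument and 1 for the call.\<close>

lemma ev_fold:
  assumes "k < length P" "P ! k = fold_body k step"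
    and step: "\<And>x xs acc rest. Inv (x # xs) acc \<Longrightarrow>
       ev P [loop_val ctx (Pair (e x) rest) (enc acc)] step (enc (f x acc)) b"
    and inv: "\<And>x xs acc. Inv (x # xs) acc \<Longrightarrow> Inv xs (f x acc)"
    and "Inv xs acc"
  shows "ev P [loop_val ctx (val_list (map e xs)) (enc acc)] (P ! k) (enc (fold f xs acc)) (length xs * (b + 14) + 8)"
  using \<open>Inv xs acc\<close>
proof (induction xs arbitrary: acc)
  case Nil
  have "ev P [loop_val ctx (Num 0) (enc acc)] (fold_body k step) (enc acc) 8"
    unfolding fold_body_def
    by (rule ev_conv, rule ev_cond_ispair_false, (rule ev_rules)+) simp_all
  then show ?case by (simp add: assms(2))
next
  case (Cons x xs)
  let ?env = "[loop_val ctx (Pair (e x) (val_list (map e xs))) (enc acc)]"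
  have IH: "ev P [loop_val ctx (val_list (map e xs)) (enc (f x acc))] (P ! k)
    (enc (fold f xs (f x acc))) (length xs * (b + 14) + 8)"
    using Cons.IH[OF inv[OF Cons.prems]] .
  note step' = step[OF Cons.prems, of "val_list (map e xs)"]
  have "ev P ?env (loop_arg (ctx_at 0) (Snd (Fst (Snd (Var 0)))) step)
     (loop_val ctx (val_list (map e xs)) (enc (f x acc))) (b + 8)"
    by (rule ev_conv, (rule ev_rules step')+) simp_all
  note call = ev_call[OF assms(1) this IH]
  have "ev P ?env (fold_body k step) (enc (fold f xs (f x acc))) (length (x # xs) * (b + 14) + 8)"
    unfolding fold_body_def
    by (rule ev_conv, rule ev_cond_ispair_true, (rule ev_rules call)+) simp_all
  then show ?case by (simp add: assms(2))
qed

section \<open>The program\<close>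

text \<open>Consing onto an accumulator fits the loop scheme; the resulting order does not matter,
  only the set and the length.\<close>

definition cross :: "('a \<Rightarrow> 'b \<Rightarrow> 'c) \<Rightarrow> 'a list \<Rightarrow> 'b list \<Rightarrow> 'c list" where
  "cross f xs ys = fold (\<lambda>x. fold (\<lambda>y zs. f x y # zs) ys) xs []"

definition count_down :: "nat \<Rightarrow> nat list" where "count_down k = rev [0..<Suc k]"

fun insert_item :: "item \<Rightarrow> item list \<Rightarrow> item list" where
  "insert_item x [] = [x]"
| "insert_item x (y # ys) =
    (if fst (snd y) \<le> fst (snd x) then x # y # ys else y # insert_item x ys)"

lemma length_insert_item: "length (insert_item x xs) = Suc (length xs)"
  by (induction xs) auto

lemma set_insert_item: "set (insert_item x xs) = insert x (set xs)"
  by (induction xs) auto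

text \<open>Items are numbered from the counter while weights and profit rows are consumed in
  parallel.\<close>

definition sort_step :: "nat \<Rightarrow> item list \<times> nat \<times> nat list list \<Rightarrow> item list \<times> nat \<times> nat list list" where
  "sort_step w = (\<lambda>(xs, i, gs). (insert_item (i, w, hd gs) xs, i + 1, tl gs))"

definition admissible_step ::
  "nat \<Rightarrow> token list \<Rightarrow> token list \<Rightarrow> nat \<Rightarrow> nat \<Rightarrow> nat \<Rightarrow> nat \<times> nat \<Rightarrow> nat \<times> nat" where
  "admissible_step n Q' Q j w cap = (\<lambda>(t, ok). (t + 1,
     if load Q' t + (if 1 \<le> j \<and> j \<le> t then w else 0) \<le> load Q t \<and> load Q t \<le> cap \<or>
       load Q' t + n * w \<le> cap then ok else 0))"

definition inserted_by :: "nat \<Rightarrow> plan \<Rightarrow> nat list" where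
  "inserted_by t sol = fold (\<lambda>(i, j) xs. if 1 \<le> j \<and> j \<le> t then i # xs else xs) sol []"

text \<open>The loop runs along the capacity list to visit \<open>T\<close> periods. Counting
  \<open>t\<close> down while consing yields the sets in the order of the periods.\<close>

definition output_step :: "plan \<Rightarrow> nat \<Rightarrow> nat \<times> nat list list \<Rightarrow> nat \<times> nat list list" where
  "output_step sol cap = (\<lambda>(t, out). (t - 1, inserted_by t sol # out))"

definition nums :: "nat list \<Rightarrow> val" where "nums xs = val_list (map Num xs)"

fun enc_token :: "token \<Rightarrow> val" where
  "enc_token (a, b, c, u) = Pair (Num a) (Pair (Num b) (Pair (Num c) (Num u)))"

definition enc_state :: "token list \<Rightarrow> val" where "enc_state Q = val_list (map enc_token Q)"

definition enc_plan :: "plan \<Rightarrow> val" where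
  "enc_plan sol = val_list (map (\<lambda>(i, j). Pair (Num i) (Num j)) sol)"

fun enc_best :: "(nat \<times> plan) option \<Rightarrow> val" where
  "enc_best None = Num 0"
| "enc_best (Some (p, sol)) = Pair (Num p) (enc_plan sol)"

fun enc_item :: "item \<Rightarrow> val" where
  "enc_item (i, w, g) = Pair (Num i) (Pair (Num w) (nums g))"

fun enc_entry :: "entry \<Rightarrow> val" where
  "enc_entry (Q, p, sol) = Pair (enc_state Q) (Pair (Num p) (enc_plan sol))"

definition upd_expr :: "expr \<Rightarrow> expr \<Rightarrow> expr \<Rightarrow> expr" where
  "upd_expr b p sol = Cond (Cond (IsPair b) (Arith Leq (Fst b) p) (Lit 1)) (MkPair p sol) b"

definition insert_body :: expr where
  "insert_body = Cond (IsPair (Snd (Var 0)))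
     (Cond (Arith Leq (Fst (Snd (Fst (Snd (Var 0))))) (Fst (Snd (Fst (Var 0)))))
       (Var 0)
       (MkPair (Fst (Snd (Var 0))) (Call 1 (MkPair (Fst (Var 0)) (Snd (Snd (Var 0)))))))
     (Var 0)"

definition sort_expr :: expr where
  "sort_expr = MkPair
     (Call 1 (MkPair (MkPair (Fst (Snd (acc_at 0))) (MkPair (elt_at 0) (Fst (Snd (Snd (acc_at 0))))))
       (Fst (acc_at 0))))
     (MkPair (Arith Add (Fst (Snd (acc_at 0))) (Lit 1)) (Snd (Snd (Snd (acc_at 0)))))"

definition count_down_body :: expr where
  "count_down_body = Cond (Var 0)
     (MkPair (Var 0) (Call 3 (Arith Sub (Var 0) (Lit 1)))) (MkPair (Var 0) (Var 0))"

text \<open>On \<open>(x, (B, tail))\<close> it lists \<open>x\<close> and its doublings up to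
  \<open>B\<close>, followed by \<open>tail\<close>. For \<open>x = 1\<close> and an empty tail the
  length of the result is \<open>floorlog 2 B\<close>, which is how the program takes
  logarithms.\<close>

definition powers_body :: expr where
  "powers_body = Cond (Arith Leq (Fst (Var 0)) (Fst (Snd (Var 0))))
     (MkPair (Fst (Var 0)) (Call 4 (MkPair (Arith Add (Fst (Var 0)) (Fst (Var 0))) (Snd (Var 0)))))
     (Snd (Snd (Var 0)))"

text \<open>Comparisons yield 0 or 1, so a conjunction becomes a product; in
  \<open>admissible_expr\<close> a disjunction likewise becomes a sum.\<close>

definition load_expr :: expr where
  "load_expr = Arith Add (acc_at 0) (Arith Mul
     (Arith Mul (Arith Leq (Fst (elt_at 0)) (ctx_at 0)) (Arith Leq (ctx_at 0) (Fst (Snd (elt_at 0)))))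
     (Arith Mul (Fst (Snd (Snd (elt_at 0)))) (Snd (Snd (Snd (elt_at 0))))))"

definition admissible_expr :: expr where
  "admissible_expr = MkPair (Arith Add (Fst (acc_at 0)) (Lit 1))
     (Bind (Call 9 (loop_arg (Fst (acc_at 0)) (Fst (ctx_at 0)) (Lit 0)))
     (Bind (Call 9 (loop_arg (Fst (acc_at 1)) (Fst (Snd (ctx_at 1))) (Lit 0)))
     (Cond (Arith Add
        (Arith Mul
        (Arith Leq
        (Arith Add (Var 1) (Arith Mul (Fst (Snd (Snd (Snd (ctx_at 2)))))
        (Arith Mul (Arith Leq (Lit 1) (Fst (Snd (Snd (ctx_at 2)))))
        (Arith Leq (Fst (Snd (Snd (ctx_at 2)))) (Fst (acc_at 2))))))
        (Var 0))
        (Arith Leq (Var 0) (elt_at 2)))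
        (Arith Leq (Arith Add (Var 1) (Snd (Snd (Snd (Snd (ctx_at 2)))))) (elt_at 2)))
       (Snd (acc_at 2)) (Lit 0))))"

definition option_expr :: expr where
  "option_expr =
    (let capsn = Fst (ctx_at 0); Q = Fst (Snd (ctx_at 0)); item = Fst (Snd (Snd (ctx_at 0)));
         entry = Snd (Snd (Snd (ctx_at 0))); j = Fst (acc_at 0); b = Snd (acc_at 0);
         w = Fst (Snd item)
     in MkPair (Arith Add j (Lit 1))
       (Cond (Snd (Call 10 (loop_arg
        (MkPair (Fst entry) (MkPair Q (MkPair j (MkPair w (Arith Mul (Fst capsn) w)))))
        (Snd capsn) (MkPair (Lit 1) (Lit 1)))))
        (upd_expr b (Arith Add (Fst (Snd entry)) (elt_at 0)) (MkPair (MkPair (Fst item) j) (Snd (Snd entry))))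
         b))"

definition entry_expr :: expr where
  "entry_expr = Snd (Call 11 (loop_arg
     (MkPair (Fst (ctx_at 0)) (MkPair (Fst (Snd (ctx_at 0))) (MkPair (Snd (Snd (ctx_at 0))) (elt_at 0))))
     (MkPair (Lit 0) (Snd (Snd (Snd (Snd (ctx_at 0)))))) (MkPair (Lit 0) (acc_at 0))))"

definition state_expr :: expr where
  "state_expr = Bind
     (Call 12 (loop_arg (MkPair (Fst (ctx_at 0)) (MkPair (elt_at 0) (Fst (Snd (ctx_at 0)))))
       (Snd (Snd (ctx_at 0))) (Lit 0)))
     (Cond (IsPair (Var 0)) (MkPair (MkPair (elt_at 1) (Var 0)) (acc_at 1)) (acc_at 1))"

definition item_expr :: expr where
  "item_expr = Call 13 (loop_arg (MkPair (Fst (ctx_at 0)) (MkPair (elt_at 0) (acc_at 0)))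
     (Snd (ctx_at 0)) (Lit 0))"

definition inserted_expr :: expr where
  "inserted_expr = Cond
     (Arith Mul (Arith Leq (Lit 1) (Snd (elt_at 0))) (Arith Leq (Snd (elt_at 0)) (ctx_at 0)))
     (MkPair (Fst (elt_at 0)) (acc_at 0)) (acc_at 0)"

definition output_expr :: expr where
  "output_expr = MkPair (Arith Sub (Fst (acc_at 0)) (Lit 1))
     (MkPair (Call 16 (loop_arg (Fst (acc_at 0)) (ctx_at 0) (Lit 0))) (Snd (acc_at 0)))"

abbreviation cross_expr :: "expr \<Rightarrow> expr \<Rightarrow> expr" where
  "cross_expr xs ys \<equiv> Call 7 (loop_arg ys xs (Lit 0))"

text \<open>The bindings are, in order: the sorted items, \<open>Z = q * T * n\<close>,
  \<open>K = q * floorlog 2 Z\<close>, the units, the tokens, the token lists, and the best profit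
  with its plan. The bounds \<open>40 * K * K * Z\<close> on multiplicities and
  \<open>80 * K * K * K\<close> on the length of token lists are chosen for \<open>available\<close>
  and \<open>snapshot_as_tokens\<close> with \<open>m = floorlog 2 Z + 2\<close>.\<close>

definition main_body :: "nat \<Rightarrow> expr" where
  "main_body q =
    Bind (Fst (Call 2 (loop_arg (Lit 0) (Fst (Snd (Snd (Var 0))))
      (MkPair (Lit 0) (MkPair (Lit 1) (Fst (Snd (Snd (Snd (Snd (Var 0)))))))))))
   (Bind (Arith Mul (Arith Mul (Lit q) (Fst (Snd (Var 1)))) (Fst (Var 1)))
   (Bind (Arith Mul (Lit q) (Call 5 (loop_arg (Lit 0)
      (Call 4 (MkPair (Lit 1) (MkPair (Var 0) (Lit 0)))) (Lit 0))))
   (Bind (Call 4 (MkPair (Lit 1)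
      (MkPair (Arith Mul (Fst (Var 3)) (Fst (Snd (Fst (Var 2))))) (Fst (Snd (Snd (Var 3)))))))
   (Bind (cross_expr (Call 3 (Fst (Snd (Var 4)))) (cross_expr (Call 3 (Fst (Snd (Var 4))))
      (cross_expr (Call 3 (Arith Mul (Arith Mul (Arith Mul (Lit 40) (Var 1)) (Var 1)) (Var 2))) (Var 0))))
   (Bind (Call 8 (loop_arg (Var 0)
      (Call 3 (Arith Mul (Arith Mul (Arith Mul (Lit 80) (Var 2)) (Var 2)) (Var 2)))
      (MkPair (Lit 0) (Lit 0))))
   (Bind (Call 15 (loop_arg (Lit 0)
      (Call 14 (loop_arg (MkPair (MkPair (Fst (Var 6)) (Fst (Snd (Snd (Snd (Var 6)))))) (Var 0))
        (Var 5) (MkPair (MkPair (Lit 0) (MkPair (Lit 0) (Lit 0))) (Lit 0)))) (Lit 0)))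
   (Snd (Call 17 (loop_arg (Snd (Var 0)) (Fst (Snd (Snd (Snd (Var 7)))))
      (MkPair (Fst (Snd (Var 7))) (Lit 0)))))))))))"

definition gik_program :: "nat \<Rightarrow> program" where
  "gik_program q =
    [main_body q, insert_body, fold_body 2 sort_expr, count_down_body, powers_body,
     fold_body 5 (Arith Add (acc_at 0) (Lit 1)),
     fold_body 6 (MkPair (MkPair (ctx_at 0) (elt_at 0)) (acc_at 0)),
     fold_body 7 (Call 6 (loop_arg (elt_at 0) (ctx_at 0) (acc_at 0))),
     fold_body 8 (cross_expr (ctx_at 0) (acc_at 0)),
     fold_body 9 load_expr, fold_body 10 admissible_expr, fold_body 11 option_expr,
     fold_body 12 entry_expr, fold_body 13 state_expr, fold_body 14 item_expr,
     fold_body 15 (upd_expr (acc_at 0) (Fst (Snd (elt_at 0))) (Snd (Snd (elt_at 0)))),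
     fold_body 16 inserted_expr, fold_body 17 output_expr]"

lemma program_nth:
  "gik_program q ! 0 = main_body q" "gik_program q ! 1 = insert_body"
  "gik_program q ! 2 = fold_body 2 sort_expr" "gik_program q ! 3 = count_down_body"
  "gik_program q ! 4 = powers_body" "gik_program q ! 5 = fold_body 5 (Arith Add (acc_at 0) (Lit 1))"
  "gik_program q ! 6 = fold_body 6 (MkPair (MkPair (ctx_at 0) (elt_at 0)) (acc_at 0))"
  "gik_program q ! 7 = fold_body 7 (Call 6 (loop_arg (elt_at 0) (ctx_at 0) (acc_at 0)))"
  "gik_program q ! 8 = fold_body 8 (cross_expr (ctx_at 0) (acc_at 0))"
  "gik_program q ! 9 = fold_body 9 load_expr" "gik_program q ! 10 = fold_body 10 admissible_expr"
  "gik_program q ! 11 = fold_body 11 option_expr" "gik_program q ! 12 = fold_body 12 entry_expr"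
  "gik_program q ! 13 = fold_body 13 state_expr" "gik_program q ! 14 = fold_body 14 item_expr"
  "gik_program q ! 15 = fold_body 15 (upd_expr (acc_at 0) (Fst (Snd (elt_at 0))) (Snd (Snd (elt_at 0))))"
  "gik_program q ! 16 = fold_body 16 inserted_expr" "gik_program q ! 17 = fold_body 17 output_expr"
  by (simp_all add: gik_program_def)

lemma length_program [simp]: "length (gik_program q) = 18" by (simp add: gik_program_def)

section \<open>Cost of the loops of the dynamic program\<close>

lemma fold_cost:
  fixes l G b k :: nat
  assumes "l \<le> G" "0 < G"
  shows "l * (b * G ^ k + 14) + 8 \<le> (b + 22) * G ^ Suc k"
proof -
  have "1 \<le> G ^ k" "1 \<le> G ^ Suc k" using assms by (simp_all add: Suc_le_eq)
  then have "l * (b * G ^ k + 14) + 8 \<le> G * (b * G ^ k + 14 * G ^ k) + 8 * G ^ Suc k"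
    using assms(1) by (intro add_mono mult_le_mono) auto
  then show ?thesis by (simp add: algebra_simps)
qed

text \<open>The single parameter \<open>G\<close> bounds all list lengths and all bit lengths of a run.\<close>

locale bounded_run =
  fixes q G :: nat
  assumes G: "8 \<le> G" and small_q: "small G q"
begin

lemma G_pos: "0 < G" using G by simp

abbreviation "P \<equiv> gik_program q"

lemmas rules = ev_rules ev_lit[where G = G] ev_ops[where G = G]

lemma small_simps: "small G 0" "small G (Suc 0)" "small G 1" "small G 40" "small G 80" "0 < G"
proof -
  have "(2::nat) ^ 7 \<le> 2 ^ G" using G by (intro power_increasing) auto
  then show "small G 40" "small G 80" "small G (Suc 0)" "small G 1" "small G 0" "0 < G" using G by (auto simp: small_def)
qed

text \<open>Numbers about to be added are kept one binary digit shorter than \<open>G\<close>, so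
  that their sum still has at most \<open>G\<close> digits.\<close>

lemma small_half: "small (G - 1) a \<Longrightarrow> small (G - 1) b \<Longrightarrow> small G (a + b)"
  using G by (cases G) (auto simp: small_def)

lemma half_small: "small (G - 1) a \<Longrightarrow> small G a"
  using small_half[of a 0] by (auto simp: small_def)

abbreviation token_mass :: "token list \<Rightarrow> nat" where
  "token_mass Q \<equiv> sum_list (map (\<lambda>(a, b, c, u). c * u) Q)"

text \<open>The mass bounds the load of every period and also every single product
  \<open>c * u\<close>, which \<open>load_expr\<close> computes even outside the interval of the
  token.\<close>

definition ok_state :: "token list \<Rightarrow> bool" where
  "ok_state Q \<longleftrightarrow> length Q \<le> G \<and>
     (\<forall>(a, b, c, u)\<in>set Q. small G a \<and> small G b \<and> small G c \<and> small G u) \<and>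
     small (G - 1) (token_mass Q)"

definition ok_item :: "nat \<Rightarrow> item \<Rightarrow> bool" where
  "ok_item n = (\<lambda>(i, w, g). small G i \<and> small (G - 1) w \<and> small (G - 1) (n * w) \<and>
     length g < G \<and> (\<forall>x\<in>set g. small (G - 1) x))"

definition ok_best :: "(nat \<times> plan) option \<Rightarrow> bool" where
  "ok_best b \<longleftrightarrow> (\<forall>d. b = Some d \<longrightarrow> small G (fst d))"

definition ok_caps :: "nat list \<Rightarrow> bool" where
  "ok_caps caps \<longleftrightarrow> length caps < G \<and> (\<forall>c\<in>set caps. small G c)"

definition ok_entry :: "entry \<Rightarrow> bool" where
  "ok_entry = (\<lambda>(Q, p, sol). ok_state Q \<and> small (G - 1) p)"

lemma small_length: "l \<le> G \<Longrightarrow> small G l" "l < G \<Longrightarrow> small G (Suc l)"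
proof -
  have "G < 2 ^ G" by (rule less_exp)
  then show "l \<le> G \<Longrightarrow> small G l" "l < G \<Longrightarrow> small G (Suc l)" unfolding small_def by linarith+
qed

text \<open>A further loop over at most \<open>G\<close> elements raises the power of
  \<open>G\<close> by one. The 22 consists of 14 per round and 8 at the end, from
  \<open>ev_fold\<close>; this explains bounds such as \<open>(50 + 22) * G ^ 2\<close>
  below.\<close>

lemma ev_loop:
  assumes "P ! k = fold_body k step"
    and "\<And>x xs acc rest. Inv (x # xs) acc \<Longrightarrow>
       ev P [loop_val ctx (Pair (e x) rest) (enc acc)] step (enc (f x acc)) (b * G ^ d)"
    and "\<And>x xs acc. Inv (x # xs) acc \<Longrightarrow> Inv xs (f x acc)"
    and "k < 18" "Inv xs acc" "length xs \<le> G" "c = (b + 22) * G ^ Suc d"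
  shows "ev P [loop_val ctx (val_list (map e xs)) (enc acc)] (P ! k) (enc (fold f xs acc)) c"
proof -
  have "k < length P" using assms(4) by (simp add: length_program)
  from ev_fold[where f = f and Inv = Inv and e = e and enc = enc and ctx = ctx and b = "b * G ^ d",
      OF this assms(1,2,3,5)] show ?thesis
    unfolding assms(7) by (rule ev_conv[OF _ refl fold_cost[OF assms(6) G_pos]])
qed

lemma load_le: "load Q t \<le> token_mass Q"
  unfolding load_def by (rule sum_list_mono) auto

lemma ev_load:
  assumes "ok_state Q" "small G t"
  shows "ev P [loop_val (Num t) (enc_state Q) (Num 0)] (P ! 9) (Num (load Q t)) (72 * G ^ 2)"
proof -
  define Inv where "Inv Q acc \<longleftrightarrow> (\<forall>(a, b, c, u)\<in>set Q. small G a \<and> small G b \<and> small G c \<and> small G u) \<and>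
     small (G - 1) (acc + token_mass Q)" for Q :: "token list" and acc
  have 1: "ev P [loop_val (Num t) (Pair (enc_token \<tau>) rest) (Num acc)] load_expr
      (Num (acc + token_load t \<tau>)) (50 * G ^ 1)" if Inv: "Inv (\<tau> # Q) acc" for \<tau> Q acc rest
  proof -
    obtain a b c u where \<tau>: "\<tau> = (a, b, c, u)" by (cases \<tau>)
    have "small G (acc + (c * u + token_mass Q))"
      using Inv unfolding Inv_def \<tau> by (auto intro: half_small)
    then have s: "small G acc" "small G (c * u)" by (auto elim: small_mono)
    have s': "small G a" "small G b" "small G c" "small G u"
      using Inv unfolding Inv_def \<tau> by auto
    show ?thesis
      unfolding load_expr_def \<tau> enc_token.simps
      by (rule ev_conv, (rule rules | (simp add: s s' small_simps assms; fail))+) (use G in simp_all)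
  qed
  have 2: "Inv Q (acc + token_load t \<tau>)" if "Inv (\<tau> # Q) acc" for \<tau> Q acc
    using that unfolding Inv_def by (cases \<tau>) (auto elim: small_mono)
  have "ev P [loop_val (Num t) (val_list (map enc_token Q)) (Num 0)] (P ! 9)
      (Num (fold (\<lambda>\<tau> acc. acc + token_load t \<tau>) Q 0)) (72 * G ^ 2)"
    by (rule ev_loop[where Inv = Inv and e = enc_token and enc = Num and b = 50 and d = 1 and
        f = "\<lambda>\<tau> acc. acc + token_load t \<tau>", OF program_nth(10) 1 2])
      (use assms in \<open>auto simp: Inv_def ok_state_def numeral_2_eq_2\<close>)
  moreover have "fold (\<lambda>\<tau> acc. acc + token_load t \<tau>) Q k = k + load Q t" for k
    by (induction Q arbitrary: k) (auto simp: load_def)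
  ultimately show ?thesis unfolding enc_state_def by simp
qed

text \<open>Serves to absorb constants and linear terms of collected costs into the leading power of
  \<open>G\<close>.\<close>

lemma G_powers: "8 \<le> G" "8 * G \<le> G ^ 2" "8 * G \<le> G ^ 3" "8 * G \<le> G ^ 4" "8 * G \<le> G ^ 5" "8 * G \<le> G ^ 6"
proof -
  have *: "8 * G \<le> G ^ k" if k: "2 \<le> k" for k
  proof -
    obtain l where l: "k = Suc l" "0 < l" using k by (cases k) auto
    have "8 \<le> G ^ l" using G self_le_power[of G l] l(2) by simp
    then show ?thesis using l by simp
  qed
  show "8 * G \<le> G ^ 2" "8 * G \<le> G ^ 3" "8 * G \<le> G ^ 4" "8 * G \<le> G ^ 5" "8 * G \<le> G ^ 6"
    by (rule *, simp)+
qed (rule G)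

lemma ok_state_load: "ok_state Q \<Longrightarrow> small (G - 1) (load Q t)"
  using load_le[of Q t] unfolding ok_state_def by (blast intro: small_mono)

lemma fold_conj_nth:
  "fold (\<lambda>x (t, ok). (t + 1, if A t x then ok else 0)) xs (t, ok) =
   (t + length xs, if \<forall>k<length xs. A (t + k) (xs ! k) then ok else 0)" for ok :: nat
proof (induction xs arbitrary: t ok)
  case (Cons x xs)
  show ?case unfolding fold_Cons o_def prod.case Cons.IH
    by (auto simp: All_less_Suc2)
qed simp

lemma ev_admissible:
  assumes Q: "ok_state Q'" "ok_state Q" and w: "small (G - 1) w" "small (G - 1) (n * w)"
    and j: "small G j" and caps: "ok_caps caps"
  shows "ev P [loop_val
       (Pair (enc_state Q') (Pair (enc_state Q) (Pair (Num j) (Pair (Num w) (Num (n * w))))))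
       (nums caps) (Pair (Num 1) (Num 1))] (P ! 10)
     (Pair (Num (1 + length caps)) (Num (if admissible caps n Q' Q j w then 1 else 0))) (222 * G ^ 3)"
proof -
  define Inv where "Inv cs a \<longleftrightarrow> fst a + length cs \<le> G \<and> (\<forall>c\<in>set cs. small G c)"
    for cs :: "nat list" and a :: "nat \<times> nat"
  define enc where "enc = (\<lambda>(t, ok). Pair (Num t) (Num ok))"
  let ?ctx = "Pair (enc_state Q') (Pair (enc_state Q) (Pair (Num j) (Pair (Num w) (Num (n * w)))))"
  have 1: "ev P [loop_val ?ctx (Pair (Num c) rest) (enc a)] admissible_expr
      (enc (admissible_step n Q' Q j w c a)) (200 * G ^ 2)" if Inv: "Inv (c # cs) a" for c cs a rest
  proof -
    obtain t ok where a: "a = (t, ok)" by (cases a)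
    have s: "small G t" "small G c" using Inv by (auto simp: Inv_def a intro!: small_length)
    have l: "small G (load Q' t + w)" "small G (load Q' t + n * w)"
      by (intro small_half ok_state_load Q w)+
    have l': "small G (load Q' t)" "small G (load Q t)" "small G w" "small G (n * w)"
      by (intro half_small ok_state_load Q w)+
    show ?thesis
      unfolding admissible_expr_def a enc_def admissible_step_def prod.case
      by (rule ev_conv, (rule rules ev_cond ev_call ev_load | (simp add: s l l' small_simps Q j; fail))+)
        (use G_powers in simp_all)
  qed
  have 2: "Inv cs (admissible_step n Q' Q j w c a)" if "Inv (c # cs) a" for c cs a
    using that by (auto simp: Inv_def admissible_step_def split: prod.splits)
  have "ev P [loop_val ?ctx (val_list (map Num caps)) (enc (1, 1))] (P ! 10)
      (enc (fold (admissible_step n Q' Q j w) caps (1, 1))) (222 * G ^ 3)"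
    by (rule ev_loop[where Inv = Inv and e = Num and enc = enc and b = 200 and d = 2 and
        f = "admissible_step n Q' Q j w", OF program_nth(11) 1 2])
      (use caps in \<open>auto simp: Inv_def ok_caps_def\<close>)
  moreover note fold_conj_nth[of "\<lambda>t c. load Q' t + (if 1 \<le> j \<and> j \<le> t then w else 0) \<le> load Q t \<and>
        load Q t \<le> c \<or> load Q' t + n * w \<le> c" caps 1 1, folded admissible_step_def]
  moreover have "(\<forall>k<length caps. load Q' (1 + k) + (if 1 \<le> j \<and> j \<le> 1 + k then w else 0) \<le> load Q (1 + k) \<and>
        load Q (1 + k) \<le> caps ! k \<or> load Q' (1 + k) + n * w \<le> caps ! k) \<longleftrightarrow> admissible caps n Q' Q j w"
    (is "(\<forall>k<_. ?A k) \<longleftrightarrow> _")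
  proof -
    have "{1..length caps} = Suc ` {..<length caps}" by (simp add: image_Suc_lessThan)
    then show ?thesis unfolding admissible_def by auto
  qed
  ultimately show ?thesis by (simp only: enc_def nums_def prod.case)
qed

text \<open>The factor 3 arises because \<open>upd_expr\<close> may evaluate the old best value
  three times: for the test, for the comparison and as the result.\<close>

lemma ev_upd:
  assumes "ev P env eb (enc_best b) cb" "ev P env ep (Num p) cp" "ev P env es v cs"
    and "v = enc_plan sol" "small G p" "ok_best b"
  shows "ev P env (upd_expr eb ep es) (enc_best (upd_best (p, sol) b)) (3 * cb + 2 * cp + cs + 3 * G + 10)"
proof (cases b)
  case None
  have eb: "ev P env eb (Num 0) cb" using assms(1) by (simp add: None)
  show ?thesis
    unfolding upd_expr_def
    by (rule ev_conv, (rule ev_cond_ispair_false ev_cond ev_pair ev_lit[where G = G] eb assms(2,3)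
        | (simp add: small_simps; fail))+)
      (simp_all add: None upd_best_def assms(4))
next
  case (Some d)
  obtain p' sol' where d: "d = (p', sol')" by (cases d)
  have eb: "ev P env eb (Pair (Num p') (enc_plan sol')) cb" using assms(1) by (simp add: Some d)
  have "small G p'" using assms(6) Some d by (simp add: ok_best_def)
  then show ?thesis
    unfolding upd_expr_def
    apply -
    by (rule ev_conv, (rule ev_cond_ispair_true ev_cond ev_pair ev_fst ev_ops[where G = G] eb assms(2,3)
        | (simp add: small_simps assms(5); fail))+)
      (simp_all add: Some d upd_best_def assms(4))
qed

lemma ok_best_upd: "ok_best b \<Longrightarrow> small G p \<Longrightarrow> ok_best (upd_best (p, sol) b)"
  by (auto simp: ok_best_def upd_best_def split: option.splits if_splits)

lemma fst_fold_try_option: "fst (fold (try_option caps n Q x e) ys (j, b)) = j + length ys"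
  by (induction ys arbitrary: j b) (auto simp: try_option_def split: prod.splits)

lemma try_entry_run:
  assumes Q: "ok_state Q" and x: "ok_item n x" and e: "ok_entry e" and b: "ok_best b"
    and caps: "ok_caps caps" and n: "small G n"
  shows "ev P [loop_val
      (Pair (Pair (Num n) (nums caps)) (Pair (enc_state Q) (Pair (enc_item x) (enc_entry e))))
      (Pair (Num 0) (nums (snd (snd x)))) (Pair (Num 0) (enc_best b))] (P ! 11)
      (Pair (Num (Suc (length (snd (snd x))))) (enc_best (try_entry caps n Q x e b))) (322 * G ^ 4)" (is ?run)
    and "ok_best (try_entry caps n Q x e b)"
proof -
  obtain i w g where x': "x = (i, w, g)" by (cases x)
  obtain Q' p sol where e': "e = (Q', p, sol)" by (cases e)
  have item: "small G i" "small (G - 1) w" "small (G - 1) (n * w)" "length g < G"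
      "\<And>y. y \<in> set g \<Longrightarrow> small (G - 1) y"
    and entry: "ok_state Q'" "small (G - 1) p"
    using x e by (auto simp: ok_item_def ok_entry_def x' e')
  define Inv where "Inv ys a \<longleftrightarrow> fst a + length ys \<le> G \<and> (\<forall>y\<in>set ys. small (G - 1) y) \<and> ok_best (snd a)"
    for ys :: "nat list" and a :: "nat \<times> (nat \<times> plan) option"
  define enc where "enc = (\<lambda>(j, b). Pair (Num j) (enc_best b))"
  let ?ctx = "Pair (Pair (Num n) (nums caps)) (Pair (enc_state Q) (Pair (enc_item x) (enc_entry e)))"
  have 1: "ev P [loop_val ?ctx (Pair (Num y) rest) (enc a)] option_expr
      (enc (try_option caps n Q x e y a)) (300 * G ^ 3)" if Inv: "Inv (y # ys) a" for y ys a rest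
  proof -
    obtain j b where a: "a = (j, b)" by (cases a)
    have s: "small G j" "ok_best b" "small G y"
      using Inv by (auto simp: Inv_def a intro: small_length half_small)
    have s': "small G (p + y)" "small G p" "small G w"
      using Inv entry item by (auto simp: Inv_def intro: half_small small_half)
    show ?thesis
      unfolding option_expr_def Let_def a enc_def try_option_def x' e' enc_item.simps enc_entry.simps prod.case
      by (rule ev_conv, (rule rules ev_cond ev_call ev_admissible ev_upd[where sol = "(i, j) # sol"] item(2,3)
        | (simp add: s s' item entry small_simps Q n caps length_program enc_plan_def; fail))+)
        (use G_powers in simp_all)
  qed
  have 2: "Inv ys (try_option caps n Q x e y a)" if "Inv (y # ys) a" for y ys a
    using that entry(2) by (cases a) (auto simp: Inv_def try_option_def x' e' intro!: ok_best_upd small_half)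
  have inv0: "Inv (0 # g) (0, b)" using item b by (auto simp: Inv_def small_def)
  have "ev P [loop_val ?ctx (val_list (map Num (0 # g))) (enc (0, b))] (P ! 11)
      (enc (fold (try_option caps n Q x e) (0 # g) (0, b))) (322 * G ^ 4)"
    by (rule ev_loop[where Inv = Inv and e = Num and enc = enc and b = 300 and d = 3 and
        f = "try_option caps n Q x e", OF program_nth(12) 1 2])
      (use item inv0 in \<open>auto simp: Suc_le_eq\<close>)
  moreover have "fold (try_option caps n Q x e) (0 # g) (0, b) = (Suc (length g), try_entry caps n Q x e b)"
    using fst_fold_try_option[of caps n Q x e "0 # g" 0 b] by (simp add: try_entry_def x' prod_eq_iff)
  ultimately show ?run
    by (simp add: enc_def nums_def x')
  have "Inv ys a \<Longrightarrow> ok_best (snd (fold (try_option caps n Q x e) ys a))" for ys a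
  proof (induction ys arbitrary: a)
    case (Cons y ys)
    then show ?case using 2 by simp
  qed (simp add: Inv_def)
  from this[OF inv0] show "ok_best (try_entry caps n Q x e b)"
    by (simp add: try_entry_def x')
qed

abbreviation frontier_val :: "entry list \<Rightarrow> val" where
  "frontier_val F \<equiv> val_list (map enc_entry F)"

abbreviation data_val :: "nat \<Rightarrow> nat list \<Rightarrow> val" where
  "data_val n caps \<equiv> Pair (Num n) (nums caps)"

lemma ev_entries:
  assumes Q: "ok_state Q" and x: "ok_item n x" and F: "\<And>e. e \<in> set F \<Longrightarrow> ok_entry e" "length F \<le> G"
    and caps: "ok_caps caps" and n: "small G n"
  shows "ev P [loop_val (Pair (data_val n caps) (Pair (enc_state Q) (enc_item x))) (frontier_val F) (Num 0)]
     (P ! 12) (enc_best (fold (try_entry caps n Q x) F None)) (422 * G ^ 5)"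
proof -
  define Inv where "Inv es b \<longleftrightarrow> (\<forall>e\<in>set es. ok_entry e) \<and> ok_best b"
    for es :: "entry list" and b :: "(nat \<times> plan) option"
  obtain i w g where x': "x = (i, w, g)" by (cases x)
  let ?ctx = "Pair (data_val n caps) (Pair (enc_state Q) (enc_item x))"
  have 1: "ev P [loop_val ?ctx (Pair (enc_entry e) rest) (enc_best b)] entry_expr
      (enc_best (try_entry caps n Q x e b)) (400 * G ^ 4)" if Inv: "Inv (e # es) b" for e es b rest
  proof -
    have eb: "ok_entry e" "ok_best b" using Inv by (auto simp: Inv_def)
    note run = try_entry_run(1)[OF Q x eb caps n, unfolded x' snd_conv enc_item.simps]
    show ?thesis
      unfolding entry_expr_def x' enc_item.simps
      by (rule ev_conv, (rule rules ev_call run | (simp add: small_simps; fail))+)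
        (use G_powers in simp_all)
  qed
  have 2: "Inv es (try_entry caps n Q x e b)" if "Inv (e # es) b" for e es b
    using that try_entry_run(2)[OF Q x _ _ caps n, of e b] by (auto simp: Inv_def)
  have "ev P [loop_val ?ctx (frontier_val F) (enc_best None)] (P ! 12)
      (enc_best (fold (try_entry caps n Q x) F None)) (422 * G ^ 5)"
    by (rule ev_loop[where Inv = Inv and e = enc_entry and enc = enc_best and b = 400 and d = 4 and
        f = "try_entry caps n Q x", OF program_nth(13) 1 2])
      (use F in \<open>auto simp: Inv_def ok_best_def\<close>)
  then show ?thesis by simp
qed

lemma ev_next_frontier:
  assumes U: "\<And>Q. Q \<in> set U \<Longrightarrow> ok_state Q" "length U \<le> G"
    and x: "ok_item n x" and F: "\<And>e. e \<in> set F \<Longrightarrow> ok_entry e" "length F \<le> G"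
    and caps: "ok_caps caps" and n: "small G n"
  shows "ev P [loop_val (Pair (data_val n caps) (Pair (enc_item x) (frontier_val F)))
      (val_list (map enc_state U)) (Num 0)]
     (P ! 13) (frontier_val (next_frontier caps n U x F)) (522 * G ^ 6)"
proof -
  define Inv where "Inv Us K \<longleftrightarrow> (\<forall>Q\<in>set Us. ok_state Q)"
    for Us :: "token list list" and K :: "entry list"
  let ?ctx = "Pair (data_val n caps) (Pair (enc_item x) (frontier_val F))"
  have 1: "ev P [loop_val ?ctx (Pair (enc_state Q) rest) (frontier_val K)] state_expr
      (frontier_val (reach_state caps n x F Q K)) (500 * G ^ 5)" if Inv: "Inv (Q # Us) K" for Q Us K rest
  proof -
    let ?b = "fold (try_entry caps n Q x) F None"
    have Q: "ok_state Q" using Inv by (auto simp: Inv_def)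
    note run = ev_entries[OF Q x F caps n]
    show ?thesis
    proof (cases ?b)
      case None
      note run' = run[unfolded None enc_best.simps]
      show ?thesis unfolding state_expr_def
        by (rule ev_conv, (rule rules ev_cond_ispair_false ev_call run' | (simp add: small_simps; fail))+)
        (use G_powers in \<open>simp_all add: reach_state_def None\<close>)
    next
      case (Some d)
      obtain p sol where d: "d = (p, sol)" by (cases d)
      note run' = run[unfolded Some d enc_best.simps]
      show ?thesis unfolding state_expr_def
        by (rule ev_conv, (rule rules ev_cond_ispair_true ev_call run' | (simp add: small_simps; fail))+)
        (use G_powers in \<open>simp_all add: reach_state_def Some d\<close>)
    qed
  qed
  have 2: "Inv Us (reach_state caps n x F Q K)" if "Inv (Q # Us) K" for Q Us K
    using that by (auto simp: Inv_def)
  have "ev P [loop_val ?ctx (val_list (map enc_state U)) (frontier_val [])] (P ! 13)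
      (frontier_val (fold (reach_state caps n x F) U [])) (522 * G ^ 6)"
    by (rule ev_loop[where Inv = Inv and e = enc_state and enc = frontier_val and b = 500 and d = 5 and
        f = "reach_state caps n x F", OF program_nth(14) 1 2])
      (use U in \<open>auto simp: Inv_def\<close>)
  then show ?thesis by (simp add: next_frontier_def)
qed

lemma ev_frontier:
  assumes U: "\<And>Q. Q \<in> set U \<Longrightarrow> ok_state Q" "length U \<le> G"
    and xs: "\<And>x. x \<in> set xs \<Longrightarrow> ok_item n x" "length xs \<le> G"
    and F: "\<And>ys zs e. xs = ys @ zs \<Longrightarrow> e \<in> set (frontier caps n U ys) \<Longrightarrow> ok_entry e"
    and caps: "ok_caps caps" and n: "small G n"
  shows "ev P [loop_val (Pair (data_val n caps) (val_list (map enc_state U)))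
      (val_list (map enc_item xs)) (frontier_val [([], 0, [])])]
     (P ! 14) (frontier_val (frontier caps n U xs)) (622 * G ^ 7)"
proof -
  \<comment> \<open>The accumulator is pinned to the frontier of the processed prefix, since the
    assumption \<open>F\<close> bounds the profits only of genuine frontiers.\<close>
  define Inv where "Inv zs F \<longleftrightarrow> (\<exists>ys. xs = ys @ zs \<and> F = frontier caps n U ys)"
    for zs :: "item list" and F :: "entry list"
  let ?ctx = "Pair (data_val n caps) (val_list (map enc_state U))"
  have 1: "ev P [loop_val ?ctx (Pair (enc_item z) rest) (frontier_val F')] item_expr
      (frontier_val (next_frontier caps n U z F')) (600 * G ^ 6)" if Inv: "Inv (z # zs) F'" for z zs F' rest
  proof -
    obtain ys where ys: "xs = ys @ z # zs" "F' = frontier caps n U ys" using Inv by (auto simp: Inv_def)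
    have z: "ok_item n z" using xs(1) ys by simp
    have F1: "ok_entry e" if "e \<in> set F'" for e using F[OF ys(1)] that ys(2) by simp
    have F2: "length F' \<le> G" using length_frontier[of caps n U ys] U(2) G by (simp add: ys(2))
    note run = ev_next_frontier[OF U z F1 F2 caps n]
    show ?thesis unfolding item_expr_def
      by (rule ev_conv, (rule rules ev_call run | (simp add: small_simps; fail))+)
        (use G_powers in simp_all)
  qed
  have 2: "Inv zs (next_frontier caps n U z F')" if Inv: "Inv (z # zs) F'" for z zs F'
  proof -
    obtain ys where ys: "xs = ys @ z # zs" "F' = frontier caps n U ys" using Inv by (auto simp: Inv_def)
    then show ?thesis unfolding Inv_def by (intro exI[of _ "ys @ [z]"]) (simp add: frontier_snoc)
  qed
  have "Inv xs [([], 0, [])]" unfolding Inv_def by (intro exI[of _ "[]"]) (simp add: frontier_def)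
  then show ?thesis
    unfolding frontier_def
    by (intro ev_loop[where Inv = Inv and e = enc_item and enc = frontier_val and b = 600 and d = 6 and
        f = "next_frontier caps n U", OF program_nth(15) 1 2])
      (use xs in \<open>auto\<close>)
qed

lemma ev_best_entry:
  assumes F: "\<And>e. e \<in> set F \<Longrightarrow> ok_entry e" "length F \<le> G"
  shows "ev P [loop_val v (frontier_val F) (Num 0)] (P ! 15) (enc_best (best_entry F)) (72 * G ^ 2)"
proof -
  define Inv where "Inv es b \<longleftrightarrow> (\<forall>e\<in>set es. ok_entry e) \<and> ok_best b"
    for es :: "entry list" and b :: "(nat \<times> plan) option"
  have 1: "ev P [loop_val v (Pair (enc_entry e) rest) (enc_best b)]
      (upd_expr (acc_at 0) (Fst (Snd (elt_at 0))) (Snd (Snd (elt_at 0))))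
      (enc_best (upd_best (snd e) b)) (50 * G ^ 1)" if Inv: "Inv (e # es) b" for e es b rest
  proof -
    obtain Q p sol where e: "e = (Q, p, sol)" by (cases e)
    have s: "ok_best b" "small G p" using Inv half_small by (auto simp: Inv_def e ok_entry_def)
    show ?thesis unfolding e enc_entry.simps snd_conv
      by (rule ev_conv, (rule rules ev_upd | (simp add: s; fail))+) (use G in simp_all)
  qed
  have 2: "Inv es (upd_best (snd e) b)" if "Inv (e # es) b" for e es b
    using that half_small by (cases e) (auto simp: Inv_def ok_entry_def intro!: ok_best_upd)
  have "ev P [loop_val v (frontier_val F) (enc_best None)] (P ! 15)
      (enc_best (fold (\<lambda>e. upd_best (snd e)) F None)) (72 * G ^ 2)"
    by (rule ev_loop[where Inv = Inv and e = enc_entry and enc = enc_best and b = 50 and d = 1 and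
        f = "\<lambda>e. upd_best (snd e)", OF program_nth(16) 1 2])
      (use F in \<open>auto simp: Inv_def ok_best_def numeral_2_eq_2\<close>)
  then show ?thesis by (simp add: best_entry_def)
qed

lemma ev_inserted:
  assumes "small G t" "length sol \<le> G" "\<And>i j. (i, j) \<in> set sol \<Longrightarrow> small G j"
  shows "ev P [loop_val (Num t) (enc_plan sol) (Num 0)] (P ! 16) (nums (inserted_by t sol)) (72 * G ^ 2)"
proof -
  define Inv where "Inv zs xs \<longleftrightarrow> (\<forall>(i, j)\<in>set zs. small G j)" for zs :: plan and xs :: "nat list"
  define e where "e = (\<lambda>(i, j). Pair (Num i) (Num j))"
  define f where "f = (\<lambda>(i::nat, j) xs. if 1 \<le> j \<and> j \<le> t then i # xs else xs)"
  have 1: "ev P [loop_val (Num t) (Pair (e z) rest) (nums xs)] inserted_expr (nums (f z xs)) (50 * G ^ 1)"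
    if Inv: "Inv (z # zs) xs" for z zs xs rest
  proof -
    obtain i j where z: "z = (i, j)" by (cases z)
    have s: "small G j" using Inv by (auto simp: Inv_def z)
    show ?thesis unfolding z e_def f_def inserted_expr_def prod.case
      by (rule ev_conv, (rule rules ev_cond | (simp add: s assms small_simps; fail))+)
        (use G in \<open>simp_all add: nums_def\<close>)
  qed
  have 2: "Inv zs (f z xs)" if "Inv (z # zs) xs" for z zs xs
    using that by (auto simp: Inv_def)
  have "ev P [loop_val (Num t) (val_list (map e sol)) (nums [])] (P ! 16) (nums (fold f sol [])) (72 * G ^ 2)"
    by (rule ev_loop[where Inv = Inv and e = e and enc = nums and b = 50 and d = 1 and
        f = f, OF program_nth(17) 1 2])
      (use assms in \<open>auto simp: Inv_def numeral_2_eq_2\<close>)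
  then show ?thesis by (simp add: inserted_by_def f_def e_def nums_def enc_plan_def)
qed

lemma ev_output:
  assumes "small G t" "length sol \<le> G" "\<And>i j. (i, j) \<in> set sol \<Longrightarrow> small G j" "length caps \<le> G"
  shows "ev P [loop_val (enc_plan sol) (nums caps) (Pair (Num t) (Num 0))] (P ! 17)
     (Pair (Num (t - length caps)) (val_list (map nums (snd (fold (output_step sol) caps (t, [])))))) (122 * G ^ 3)"
proof -
  define Inv where "Inv cs a \<longleftrightarrow> small G (fst a)" for cs :: "nat list" and a :: "nat \<times> nat list list"
  define enc where "enc = (\<lambda>(t, out). Pair (Num t) (val_list (map nums out)))"
  have 1: "ev P [loop_val (enc_plan sol) (Pair (Num c) rest) (enc a)] output_expr
      (enc (output_step sol c a)) (100 * G ^ 2)" if Inv: "Inv (c # cs) a" for c cs a rest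
  proof -
    obtain t out where a: "a = (t, out)" by (cases a)
    have s: "small G t" using Inv by (auto simp: Inv_def a)
    note run = ev_inserted[OF s assms(2,3)]
    show ?thesis unfolding a enc_def output_step_def output_expr_def prod.case
      by (rule ev_conv, (rule rules ev_call run | (simp add: s small_simps; fail))+)
        (use G_powers in simp_all)
  qed
  have 2: "Inv cs (output_step sol c a)" if "Inv (c # cs) a" for c cs a
    using that by (auto simp: Inv_def output_step_def elim: small_mono split: prod.splits)
  have "ev P [loop_val (enc_plan sol) (val_list (map Num caps)) (enc (t, []))] (P ! 17)
      (enc (fold (output_step sol) caps (t, []))) (122 * G ^ 3)"
    by (rule ev_loop[where Inv = Inv and e = Num and enc = enc and b = 100 and d = 2 and
        f = "output_step sol", OF program_nth(18) 1 2])
      (use assms in \<open>auto simp: Inv_def\<close>)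
  moreover have "fst (fold (output_step sol) cs (t, out)) = t - length cs" for cs t out
    by (induction cs arbitrary: t out) (auto simp: output_step_def)
  ultimately show ?thesis by (simp add: enc_def nums_def split_beta)
qed

section \<open>Cost of sorting and of enumerating tokens and token lists\<close>

lemma ev_insert:
  assumes "small G (fst (snd x))" "\<And>y. y \<in> set xs \<Longrightarrow> small G (fst (snd y))"
  shows "ev P [Pair (enc_item x) (val_list (map enc_item xs))] (P ! 1)
     (val_list (map enc_item (insert_item x xs))) (10 * G * (length xs + 1))"
  using assms(2)
proof (induction xs)
  case Nil
  obtain i w g where x: "x = (i, w, g)" by (cases x)
  show ?case unfolding program_nth insert_body_def x list.map val_list.simps
    by (rule ev_conv, (rule rules ev_cond_ispair_false | (simp; fail))+) (use G in simp_all)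
next
  case (Cons y ys)
  obtain i w g where x: "x = (i, w, g)" by (cases x)
  obtain i' w' g' where y: "y = (i', w', g')" by (cases y)
  have s: "small G w" "small G w'" using assms(1) Cons.prems[of y] by (auto simp: x y)
  have IH: "ev P [Pair (enc_item x) (val_list (map enc_item ys))] (P ! 1)
     (val_list (map enc_item (insert_item x ys))) (10 * G * (length ys + 1))"
    using Cons by simp
  have "ev P [Pair (enc_item x) (Pair (enc_item y) (val_list (map enc_item ys)))] insert_body
     (val_list (map enc_item (insert_item x (y # ys)))) (10 * G * (length (y # ys) + 1))"
    unfolding insert_body_def x y enc_item.simps
    by (rule ev_conv, (rule rules ev_cond_ispair_true ev_cond ev_call IH[unfolded x enc_item.simps]
        | (simp add: s small_simps; fail))+)
      (use G in \<open>simp_all add: algebra_simps\<close>)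
  then show ?case by (simp only: program_nth list.map val_list.simps)
qed

lemma ev_sort:
  assumes "length ws < G" "length gs = length ws" "\<And>w. w \<in> set ws \<Longrightarrow> small G w"
  shows "ev P [loop_val v (nums ws) (Pair (Num 0) (Pair (Num 1) (val_list (map nums gs))))] (P ! 2)
     (Pair (val_list (map enc_item (fst (fold sort_step ws ([], 1, gs)))))
       (Pair (Num (fst (snd (fold sort_step ws ([], 1, gs)))))
        (val_list (map nums (snd (snd (fold sort_step ws ([], 1, gs)))))))) (82 * G ^ 3)"
proof -
  define Inv where "Inv us a \<longleftrightarrow> (case a of (xs, i, hs) \<Rightarrow> length hs = length us \<and> length xs + length us \<le> G \<and>
    (\<forall>w\<in>set us. small G w) \<and> (\<forall>x\<in>set xs. small G (fst (snd x))) \<and> i + length us \<le> G)"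
    for us :: "nat list" and a :: "item list \<times> nat \<times> nat list list"
  define enc where "enc = (\<lambda>(xs, i, hs). Pair (val_list (map enc_item xs)) (Pair (Num i) (val_list (map nums hs))))"
  have 1: "ev P [loop_val v (Pair (Num u) rest) (enc a)] sort_expr
      (enc (sort_step u a)) (60 * G ^ 2)" if Inv: "Inv (u # us) a" for u us a rest
  proof -
    obtain xs i hs where a: "a = (xs, i, hs)" by (cases a)
    obtain h hs' where h: "hs = h # hs'" using Inv by (cases hs) (auto simp: Inv_def a)
    have s: "small G u" "small G i" "length xs + 1 \<le> G" using Inv by (auto simp: Inv_def a intro: small_length)
    have s': "small G (fst (snd x))" if "x \<in> set xs" for x using that Inv by (auto simp: Inv_def a)
    have "10 * G * (length xs + 1) \<le> 10 * G ^ 2" using mult_le_mono2[OF s(3), of "10 * G"] by (simp add: power2_eq_square)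
    then have run: "ev P [Pair (Pair (Num i) (Pair (Num u) (nums h))) (val_list (map enc_item xs))] (P ! 1)
      (val_list (map enc_item (insert_item (i, u, h) xs))) (10 * G ^ 2)"
      using ev_insert[of "(i, u, h)" xs] s s' by (auto elim!: ev_conv)
    show ?thesis unfolding a h enc_def sort_step_def sort_expr_def prod.case list.map val_list.simps list.sel
      by (rule ev_conv, (rule rules ev_call run | (simp add: s small_simps; fail))+)
        (use G_powers in simp_all)
  qed
  have 2: "Inv us (sort_step u a)" if "Inv (u # us) a" for u us a
    using that by (auto simp: Inv_def sort_step_def length_insert_item set_insert_item split: prod.splits)
  have "ev P [loop_val v (val_list (map Num ws)) (enc ([], 1, gs))] (P ! 2)
      (enc (fold sort_step ws ([], 1, gs))) (82 * G ^ 3)"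
    by (rule ev_loop[where Inv = Inv and e = Num and enc = enc and b = 60 and d = 2 and
        f = sort_step, OF program_nth(3) 1 2])
      (use assms in \<open>auto simp: Inv_def\<close>)
  then show ?thesis by (simp add: enc_def nums_def split_beta)
qed

lemma count_down_Suc: "count_down (Suc k) = Suc k # count_down k" and count_down_0: "count_down 0 = [0]"
  by (simp_all add: count_down_def)

lemma ev_count_down:
  assumes "small G k"
  shows "ev P [Num k] (P ! 3) (nums (count_down k)) (10 * G * (k + 1))"
  using assms
proof (induction k)
  case 0
  have "ev P [Num 0] count_down_body (nums (count_down 0)) (10 * G * (0 + 1))"
    unfolding count_down_body_def
    by (rule ev_conv, (rule rules ev_cond_zero | (simp; fail))+)
      (use G in \<open>simp_all add: nums_def count_down_0\<close>)
  then show ?case by (simp only: program_nth)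
next
  case (Suc k)
  have IH: "ev P [Num (Suc k - 1)] (P ! 3) (nums (count_down k)) (10 * G * (k + 1))"
    using Suc small_mono[of G "Suc k" k] by simp
  have "ev P [Num (Suc k)] count_down_body (nums (count_down (Suc k))) (10 * G * (Suc k + 1))"
    unfolding count_down_body_def
    by (rule ev_conv, (rule rules ev_cond ev_call IH | (simp add: Suc.prems small_simps; fail))+)
      (use G in \<open>simp_all add: nums_def count_down_Suc algebra_simps\<close>)
  then show ?case by (simp only: program_nth)
qed

text \<open>The recursion stops at the first power of two above \<open>B\<close>. It is at most
  \<open>max 1 (2 * B)\<close>, which is why \<open>B\<close> has to be one digit shorter than
  \<open>G\<close>.\<close>

lemma ev_powers:
  assumes B: "small (G - 1) B" and "j \<le> floorlog 2 B"
  shows "ev P [Pair (Num (2 ^ j)) (Pair (Num B) (nums tail))] (P ! 4)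
     (nums (map (\<lambda>e. 2 ^ e) [j..<floorlog 2 B] @ tail)) (10 * G * (floorlog 2 B - j + 1))"
  using assms(2)
proof (induction "floorlog 2 B - j" arbitrary: j)
  case 0
  then have j: "j = floorlog 2 B" by simp
  have lt: "B < 2 ^ j" unfolding j using floorlog2_bounds(2)[of B] by (cases "B = 0") auto
  have "2 ^ j \<le> max 1 (2 * B)" unfolding j using floorlog2_bounds(1)[of B] by (cases "B = 0") (auto simp: floorlog_def)
  moreover have "small G (max 1 (2 * B))" using small_half[OF B B] small_simps by (simp add: max_def mult_2)
  ultimately have s: "small G (2 ^ j)" "small G B" using half_small[OF B] by (auto elim: small_mono)
  have "ev P [Pair (Num (2 ^ j)) (Pair (Num B) (nums tail))] powers_body (nums tail) (10 * G * (0 + 1))"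
    unfolding powers_body_def
    by (rule ev_conv, (rule rules ev_cond_zero | (simp add: s lt not_le small_simps; fail))+)
      (use G in simp_all)
  then show ?case by (simp add: program_nth j)
next
  case (Suc d)
  then have lt: "j < floorlog 2 B" by simp
  then have "B > 0" by (auto intro: gr0I simp: floorlog_def)
  have "2 ^ Suc j \<le> (2::nat) ^ floorlog 2 B" using lt by (intro power_increasing) auto
  then have le: "2 ^ j \<le> B" using floorlog2_bounds(1)[OF \<open>B > 0\<close>] by simp
  then have s: "small G (2 ^ j)" "small G B" using half_small[OF B] by (auto elim: small_mono)
  have IH: "ev P [Pair (Num (2 ^ j + 2 ^ j)) (Pair (Num B) (nums tail))] (P ! 4)
     (nums (map (\<lambda>e. 2 ^ e) [Suc j..<floorlog 2 B] @ tail)) (10 * G * (d + 1))"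
    using Suc.hyps(1)[of "Suc j"] Suc.hyps(2) lt by (simp add: mult_2 Suc_diff_Suc)
  have up: "[j..<floorlog 2 B] = j # [Suc j..<floorlog 2 B]" using lt by (rule upt_conv_Cons)
  have "ev P [Pair (Num (2 ^ j)) (Pair (Num B) (nums tail))] powers_body
     (nums (map (\<lambda>e. 2 ^ e) [j..<floorlog 2 B] @ tail)) (10 * G * (Suc d + 1))"
    unfolding powers_body_def
    by (rule ev_conv, (rule rules ev_cond ev_call IH | (simp add: s small_simps; fail))+)
      (use G le in \<open>simp_all add: nums_def up algebra_simps\<close>)
  then show ?case unfolding Suc.hyps(2) by (simp only: program_nth)
qed

lemma ev_length:
  assumes "length xs \<le> G"
  shows "ev P [loop_val v (val_list (map e xs)) (Num 0)] (P ! 5) (Num (length xs)) (32 * G ^ 2)"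
proof -
  define Inv where "Inv ys k \<longleftrightarrow> k + length ys \<le> G" for ys :: "'a list" and k :: nat
  have 1: "ev P [loop_val v (Pair (e y) rest) (Num k)] (Arith Add (acc_at 0) (Lit 1))
      (Num (k + 1)) (10 * G ^ 1)" if Inv: "Inv (y # ys) k" for y ys k rest
  proof -
    have s: "small G k" using Inv by (auto simp: Inv_def intro: small_length)
    show ?thesis
      by (rule ev_conv, (rule rules | (simp add: s small_simps; fail))+) (use G in simp_all)
  qed
  have 2: "Inv ys (k + 1)" if "Inv (y # ys) k" for y ys k using that by (simp add: Inv_def)
  have "ev P [loop_val v (val_list (map e xs)) (Num 0)] (P ! 5)
      (Num (fold (\<lambda>_ k. k + 1) xs 0)) (32 * G ^ 2)"
    by (rule ev_loop[where Inv = Inv and e = e and enc = Num and b = 10 and d = 1 and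
        f = "\<lambda>_ k. k + 1", OF program_nth(6) 1 2])
      (use assms in \<open>auto simp: Inv_def numeral_2_eq_2\<close>)
  moreover have "fold (\<lambda>_ k. k + 1) xs k = k + length xs" for k
    by (induction xs arbitrary: k) auto
  ultimately show ?thesis by simp
qed

text \<open>The assumption on the encodings fits pairing as well as consing, so the same code builds
  tokens and extends token lists.\<close>

lemma ev_cross:
  assumes enc: "\<And>x y. e3 (f x y) = Pair (e1 x) (e2 y)" and len: "length xs \<le> G" "length ys \<le> G"
  shows "ev P [loop_val (val_list (map e2 ys)) (val_list (map e1 xs)) (Num 0)] (P ! 7)
     (val_list (map e3 (cross f xs ys))) (82 * G ^ 2)"
proof -
  have inner: "ev P [loop_val (e1 x) (val_list (map e2 ys)) (val_list (map e3 zs))] (P ! 6)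
     (val_list (map e3 (fold (\<lambda>y zs. f x y # zs) ys zs))) (42 * G ^ 1)" for x zs
  proof -
    have 1: "ev P [loop_val (e1 x) (Pair (e2 y) rest) (val_list (map e3 zs))]
       (MkPair (MkPair (ctx_at 0) (elt_at 0)) (acc_at 0)) (val_list (map e3 (f x y # zs))) (20 * G ^ 0)"
      for y zs rest
      by (rule ev_conv, (rule rules | (simp; fail))+) (simp_all add: enc)
    show ?thesis
      by (rule ev_loop[where Inv = "\<lambda>_ _. True" and e = e2 and enc = "\<lambda>zs. val_list (map e3 zs)" and b = 20 and d = 0 and
        f = "\<lambda>y zs. f x y # zs", OF program_nth(7) 1])
      (use len in auto)
  qed
  have 1: "ev P [loop_val (val_list (map e2 ys)) (Pair (e1 x) rest) (val_list (map e3 zs))]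
      (Call 6 (loop_arg (elt_at 0) (ctx_at 0) (acc_at 0)))
      (val_list (map e3 (fold (\<lambda>y zs. f x y # zs) ys zs))) (60 * G ^ 1)" for x zs rest
    by (rule ev_conv, (rule rules ev_call inner | (simp; fail))+) (use G in simp_all)
  have "ev P [loop_val (val_list (map e2 ys)) (val_list (map e1 xs)) (val_list (map e3 []))] (P ! 7)
     (val_list (map e3 (fold (\<lambda>x. fold (\<lambda>y zs. f x y # zs) ys) xs []))) (82 * G ^ 2)"
    by (rule ev_loop[where Inv = "\<lambda>_ _. True" and e = e1 and enc = "\<lambda>zs. val_list (map e3 zs)" and b = 60 and d = 1 and
        f = "\<lambda>x. fold (\<lambda>y zs. f x y # zs) ys", OF program_nth(8) 1])
      (use len in \<open>auto simp: numeral_2_eq_2\<close>)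
  then show ?thesis by (simp add: cross_def)
qed

end

lemma set_cross: "set (cross f xs ys) = {f x y | x y. x \<in> set xs \<and> y \<in> set ys}"
  and length_cross: "length (cross f xs ys) = length xs * length ys"
proof -
  have inner: "set (fold (\<lambda>y zs. f x y # zs) ys zs) = set zs \<union> f x ` set ys \<and>
    length (fold (\<lambda>y zs. f x y # zs) ys zs) = length zs + length ys" for x zs
    by (induction ys arbitrary: zs) auto
  have "set (fold (\<lambda>x. fold (\<lambda>y zs. f x y # zs) ys) xs zs) = set zs \<union> {f x y | x y. x \<in> set xs \<and> y \<in> set ys} \<and>
    length (fold (\<lambda>x. fold (\<lambda>y zs. f x y # zs) ys) xs zs) = length zs + length xs * length ys" for zs
  proof (induction xs arbitrary: zs)
    case (Cons x xs)
    then show ?case using inner[of x zs] by auto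
  qed simp
  from this[of "[]"] show "set (cross f xs ys) = {f x y | x y. x \<in> set xs \<and> y \<in> set ys}"
    "length (cross f xs ys) = length xs * length ys" by (simp_all add: cross_def)
qed

context bounded_run begin

lemma ev_states:
  assumes "length toks \<le> G" "length ds \<le> G" "length toks ^ length ds \<le> G" "0 < length toks"
  shows "ev P [loop_val (val_list (map enc_token toks)) (val_list (map e ds)) (val_list (map enc_state [[]]))] (P ! 8)
     (val_list (map enc_state (fold (\<lambda>_. cross (#) toks) ds [[]]))) (122 * G ^ 3)"
proof -
  \<comment> \<open>The final number of lists bounds all intermediate ones, because
    \<open>toks\<close> is nonempty.\<close>
  define Inv where "Inv cs U \<longleftrightarrow> length U * length toks ^ length cs \<le> G"
    for cs :: "'a list" and U :: "token list list"
  have 1: "ev P [loop_val (val_list (map enc_token toks)) (Pair (e c) rest) (val_list (map enc_state U))]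
      (cross_expr (ctx_at 0) (acc_at 0))
      (val_list (map enc_state (cross (#) toks U))) (100 * G ^ 2)" if Inv: "Inv (c # cs) U" for c cs U rest
  proof -
    have "1 \<le> length toks ^ length (c # cs)" using assms(4) by (simp add: Suc_le_eq del: power_Suc)
    then have "length U * 1 \<le> length U * length toks ^ length (c # cs)" by (rule mult_le_mono2)
    then have "length U \<le> G" using Inv unfolding Inv_def by linarith
    then have run: "ev P [loop_val (val_list (map enc_state U)) (val_list (map enc_token toks)) (Num 0)] (P ! 7)
      (val_list (map enc_state (cross (#) toks U))) (82 * G ^ 2)"
      using assms(1) by (intro ev_cross) (auto simp: enc_state_def)
    show ?thesis
      by (rule ev_conv, (rule rules ev_call run | (simp add: small_simps; fail))+)
        (use G_powers in simp_all)
  qed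
  have 2: "Inv cs (cross (#) toks U)" if "Inv (c # cs) U" for c cs U
    using that by (simp add: Inv_def length_cross mult_ac)
  show ?thesis
    by (rule ev_loop[where Inv = Inv and e = e and enc = "\<lambda>U. val_list (map enc_state U)" and b = 100 and d = 2 and
        f = "\<lambda>_. cross (#) toks", OF program_nth(9) 1 2])
      (use assms in \<open>auto simp: Inv_def\<close>)
qed

end

section \<open>The lists computed by the program and its total cost\<close>

definition sorted_items :: "nat list \<Rightarrow> nat list list \<Rightarrow> item list" where
  "sorted_items ws gs = fst (fold sort_step ws ([], 1, gs))"

definition unit_list :: "nat \<Rightarrow> nat list \<Rightarrow> nat list" where
  "unit_list B ws = map (\<lambda>e. 2 ^ e) [0..<floorlog 2 B] @ ws"

definition token_list :: "nat \<Rightarrow> nat \<Rightarrow> nat list \<Rightarrow> token list" where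
  "token_list T C us = cross (\<lambda>a b. (a, b)) (count_down T) (cross (\<lambda>a b. (a, b)) (count_down T)
     (cross (\<lambda>a b. (a, b)) (count_down C) us))"

definition state_list :: "nat \<Rightarrow> token list \<Rightarrow> token list list" where
  "state_list D toks = fold (\<lambda>_. cross (#) toks) (count_down D) [[]]"

definition output_sets :: "nat \<Rightarrow> plan \<Rightarrow> nat list list" where
  "output_sets T sol = map (\<lambda>t. inserted_by t sol) [1..<T + 1]"

lemma length_count_down: "length (count_down k) = k + 1"
  by (simp add: count_down_def)

lemma set_count_down: "set (count_down k) = {..k}"
  by (auto simp: count_down_def)

lemma length_token_list: "length (token_list T C us) = (T + 1) ^ 2 * (C + 1) * length us"
  by (simp add: token_list_def length_cross length_count_down power2_eq_square algebra_simps)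

lemma set_token_list:
  "(a, b, c, u) \<in> set (token_list T C us) \<longleftrightarrow> a \<le> T \<and> b \<le> T \<and> c \<le> C \<and> u \<in> set us"
  by (auto simp: token_list_def set_cross set_count_down)

lemma state_list_props:
  "set (state_list D toks) = {Q. set Q \<subseteq> set toks \<and> length Q = D + 1} \<and>
   length (state_list D toks) = length toks ^ (D + 1)"
proof -
  have "set (fold (\<lambda>_. cross (#) toks) ds U) = {R @ Q | R Q. set R \<subseteq> set toks \<and> length R = length ds \<and> Q \<in> set U} \<and>
     length (fold (\<lambda>_. cross (#) toks) ds U) = length toks ^ length ds * length U" for ds :: "nat list" and U
  proof (induction ds rule: rev_induct)
    case (snoc d ds)
    then show ?case
      by (auto simp: set_cross length_cross length_Suc_conv) (metis append_Cons insert_subset length_Cons list.simps(15))+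
  qed auto
  from this[of "count_down D" "[[]]"] show ?thesis by (simp add: state_list_def length_count_down)
qed

lemma output_fold:
  "length cs \<le> t \<Longrightarrow> snd (fold (output_step sol) cs (t, out)) =
     map (\<lambda>k. inserted_by k sol) [t + 1 - length cs..<t + 1] @ out"
proof (induction cs arbitrary: t out)
  case (Cons c cs)
  have "[t - length cs..<t + 1] = [t - length cs..<t] @ [t]" by simp
  then show ?case using Cons by (simp add: output_step_def del: upt_Suc)
qed simp

context bounded_run
begin

text \<open>All bounds on numbers and lengths are assumptions here, which separates the symbolic
  evaluation from the analysis of an instance. The frontier loop with its \<open>622 * G ^ 7\<close>
  dominates the cost.\<close>

lemma ev_main:
  fixes n T :: nat and ws caps :: "nat list" and gs :: "nat list list"
  defines "Z \<equiv> q * T * n"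
  defines "K \<equiv> q * floorlog 2 Z"
  defines "C \<equiv> 40 * K * K * Z" and "D \<equiv> 80 * K * K * K"
  defines "xs \<equiv> sorted_items ws gs"
  defines "toks \<equiv> token_list T C (unit_list (n * fst (snd (hd xs))) ws)"
  defines "U \<equiv> state_list D toks"
  assumes n: "n < G" "length ws = n" "length gs = n" and T: "T < G" "length caps = T"
    and ws: "\<And>w. w \<in> set ws \<Longrightarrow> small (G - 1) w" and caps: "ok_caps caps"
    and xs: "\<And>x. x \<in> set xs \<Longrightarrow> ok_item n x" "length xs = n" "xs \<noteq> []"
    and CD: "C < G" "D < G" "0 < K" and Z: "small (G - 1) Z"
    and units: "length (unit_list (n * fst (snd (hd xs))) ws) \<le> G"
    and toks: "0 < length toks" "length toks ^ (D + 1) \<le> G"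
    and U: "\<And>Q. Q \<in> set U \<Longrightarrow> ok_state Q"
    and F: "\<And>ys zs e. xs = ys @ zs \<Longrightarrow> e \<in> set (frontier caps n U ys) \<Longrightarrow> ok_entry e"
    and best: "best_entry (frontier caps n U xs) = Some (p, sol)"
    and sol: "length sol \<le> G" "\<And>i j. (i, j) \<in> set sol \<Longrightarrow> small G j"
  shows "ev P [Pair (Num n) (Pair (Num T) (Pair (nums ws) (Pair (nums caps)
       (Pair (val_list (map nums gs)) (Num 0)))))] (P ! 0)
     (val_list (map nums (output_sets T sol))) (2000 * G ^ 7)" (is "ev P ?env _ ?v _")
proof -
  obtain i w g xs' where x: "xs = (i, w, g) # xs'" using xs(3) by (cases xs) auto
  define B where "B = n * w"
  define us where "us = unit_list B ws"
  have hd: "n * fst (snd (hd xs)) = B" by (simp add: x B_def)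
  have okw: "small (G - 1) w" "small (G - 1) B" using xs(1)[of "(i, w, g)"] by (auto simp: x ok_item_def B_def)
  have sw: "small G w" using okw(1) by (rule half_small)
  have "length toks ^ 1 \<le> length toks ^ (D + 1)" using toks(1) by (intro power_increasing) (simp_all add: Suc_le_eq)
  then have toksG: "length toks \<le> G" using toks(2) by (metis order.trans power_one_right)
  define t1 where "t1 = cross (\<lambda>a b. (a, b)) (count_down C) us"
  define t2 where "t2 = cross (\<lambda>a b. (a, b)) (count_down T) t1"
  have toks_eq: "toks = cross (\<lambda>a b. (a, b)) (count_down T) t2"
    by (simp add: toks_def token_list_def t1_def t2_def us_def hd)
  have "length t2 \<le> (T + 1) * length t2" "length t1 \<le> (T + 1) * length t1" by auto
  then have lens: "length t1 \<le> G" "length t2 \<le> G"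
    using toksG by (auto simp: toks_eq t2_def length_cross length_count_down)
  have sZ: "small G Z" using Z by (rule half_small)
  have usG: "length us \<le> G" using units by (simp add: us_def hd)
  have pow: "10 * G * (k + 1) \<le> 10 * G ^ 2" if "k < G" for k
  proof -
    have "10 * G * (k + 1) \<le> 10 * G * G" using that by (intro mult_le_mono2) auto
    then show ?thesis by (simp add: power2_eq_square)
  qed
  have logG: "floorlog 2 k < G" if "small (G - 1) k" for k
  proof -
    have "floorlog 2 k \<le> G - 1" using that by (intro floorlog_leI) (auto simp: small_def)
    then show ?thesis using G by simp
  qed
  have sK: "small G (floorlog 2 Z)" "small G K" "small G (40 * K)" "small G (40 * K * K)" "small G C"
    "small G (80 * K)" "small G (80 * K * K)" "small G D"
  proof -
    have Zpos: "0 < Z" using CD(3) by (auto simp: K_def floorlog_def intro: gr0I)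
    have "40 * K * K \<le> C" "40 * K \<le> 40 * K * K" "80 * K * K \<le> D" "80 * K \<le> 80 * K * K"
      using Zpos CD(3) by (simp_all add: C_def D_def)
    then have "K \<le> G" "40 * K \<le> G" "40 * K * K \<le> G" "C \<le> G" "80 * K \<le> G" "80 * K * K \<le> G" "D \<le> G"
      using CD(1,2) by linarith+
    then show "small G K" "small G (40 * K)" "small G (40 * K * K)" "small G C"
      "small G (80 * K)" "small G (80 * K * K)" "small G D"
      by (auto intro!: small_length)
    show "small G (floorlog 2 Z)" using logG[OF Z] by (auto intro: small_length)
  qed
  have sT: "small G T" "small G n" using T n by (auto intro: small_length)
  have sqT: "small G (q * T)"
  proof (rule small_mono[OF sZ])
    have "n \<noteq> 0" using xs by auto
    then show "q * T \<le> Z" by (simp add: Z_def)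
  qed
  have run_sort: "ev P [loop_val (Num 0) (nums ws) (Pair (Num 0) (Pair (Num 1) (val_list (map nums gs))))] (P ! 2)
      (Pair (Pair (Pair (Num i) (Pair (Num w) (nums g))) (val_list (map enc_item xs')))
       (Pair (Num (fst (snd (fold sort_step ws ([], 1, gs)))))
        (val_list (map nums (snd (snd (fold sort_step ws ([], 1, gs)))))))) (82 * G ^ 3)"
    using ev_sort[of ws gs "Num 0"] n ws half_small x[unfolded xs_def sorted_items_def] by auto
  have run_log: "ev P [Pair (Num 1) (Pair (Num Z) (Num 0))] (P ! 4)
      (nums (map (\<lambda>e. 2 ^ e) [0..<floorlog 2 Z])) (10 * G ^ 2)"
    using ev_powers[OF Z, of 0 "[]"] pow[OF logG[OF Z]] by (auto elim!: ev_conv simp: nums_def)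
  have run_len: "ev P [loop_val (Num 0) (nums (map (\<lambda>e. 2 ^ e) [0..<floorlog 2 Z])) (Num 0)] (P ! 5)
      (Num (floorlog 2 Z)) (32 * G ^ 2)"
    unfolding nums_def using ev_length[of "map (\<lambda>e. 2 ^ e) [0..<floorlog 2 Z]" "Num 0" Num] logG[OF Z]
    by auto
  have run_units: "ev P [Pair (Num 1) (Pair (Num B) (nums ws))] (P ! 4) (nums us) (10 * G ^ 2)"
    using ev_powers[OF okw(2), of 0 ws] pow[OF logG[OF okw(2)]]
    by (auto elim!: ev_conv simp: us_def unit_list_def)
  have run_T: "ev P [Num T] (P ! 3) (nums (count_down T)) (10 * G ^ 2)"
    using ev_count_down[OF sT(1)] pow[OF T(1)] by (auto elim!: ev_conv)
  have run_C: "ev P [Num C] (P ! 3) (nums (count_down C)) (10 * G ^ 2)"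
    using ev_count_down[of C] sK pow[OF CD(1)] by (auto elim!: ev_conv)
  have run_D: "ev P [Num D] (P ! 3) (nums (count_down D)) (10 * G ^ 2)"
    using ev_count_down[of D] sK pow[OF CD(2)] by (auto elim!: ev_conv)
  define e1 where "e1 = (\<lambda>(c, u). Pair (Num c) (Num u))"
  define e2 where "e2 = (\<lambda>(b, d). Pair (Num b) (e1 d))"
  have run_t1: "ev P [loop_val (nums us) (nums (count_down C)) (Num 0)] (P ! 7)
     (val_list (map e1 t1)) (82 * G ^ 2)"
    unfolding nums_def t1_def by (rule ev_cross) (use usG CD in \<open>auto simp: e1_def length_count_down\<close>)
  have run_t2: "ev P [loop_val (val_list (map e1 t1)) (nums (count_down T)) (Num 0)] (P ! 7)
     (val_list (map e2 t2)) (82 * G ^ 2)"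
    unfolding nums_def t2_def by (rule ev_cross) (use lens T in \<open>auto simp: e2_def length_count_down\<close>)
  have run_toks: "ev P [loop_val (val_list (map e2 t2)) (nums (count_down T)) (Num 0)] (P ! 7)
     (val_list (map enc_token toks)) (82 * G ^ 2)"
    unfolding nums_def toks_eq
    by (rule ev_cross) (use lens T in \<open>auto simp: e1_def e2_def length_count_down\<close>)
  have run_U: "ev P [loop_val (val_list (map enc_token toks)) (nums (count_down D)) (Pair (Num 0) (Num 0))] (P ! 8)
     (val_list (map enc_state U)) (122 * G ^ 3)"
    using ev_states[of toks "count_down D" Num] toks toksG CD
    by (auto simp: U_def state_list_def length_count_down nums_def enc_state_def)
  have lenU: "length U \<le> G" using state_list_props[of D toks] toks by (simp add: U_def)
  define F where "F = frontier caps n U xs"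
  have okF: "\<And>e. e \<in> set F \<Longrightarrow> ok_entry e" using F[of xs "[]"] by (simp add: F_def)
  have lenF: "length F \<le> G" using length_frontier[of caps n U xs] lenU G by (simp add: F_def)
  have run_F: "ev P [loop_val (Pair (data_val n caps) (val_list (map enc_state U)))
      (Pair (Pair (Num i) (Pair (Num w) (nums g))) (val_list (map enc_item xs')))
      (Pair (Pair (Num 0) (Pair (Num 0) (Num 0))) (Num 0))] (P ! 14) (frontier_val F) (622 * G ^ 7)"
  proof -
    have "ev P [loop_val (Pair (data_val n caps) (val_list (map enc_state U)))
        (val_list (map enc_item xs)) (frontier_val [([], 0, [])])] (P ! 14)
        (frontier_val (frontier caps n U xs)) (622 * G ^ 7)"
      by (rule ev_frontier[OF U lenU xs(1) _ F caps sT(2)]) (use xs(2) n T in simp_all)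
    then show ?thesis unfolding F_def by (simp add: x enc_state_def enc_plan_def)
  qed
  have run_best: "ev P [loop_val (Num 0) (frontier_val F) (Num 0)] (P ! 15)
      (Pair (Num p) (enc_plan sol)) (72 * G ^ 2)"
    using ev_best_entry[OF okF lenF, of "Num 0"] best by (simp add: F_def)
  have run_out: "ev P [loop_val (enc_plan sol) (nums caps) (Pair (Num T) (Num 0))] (P ! 17)
     (Pair (Num (T - length caps)) (val_list (map nums (output_sets T sol)))) (122 * G ^ 3)"
    using ev_output[where caps = caps, OF sT(1) sol] T output_fold[of caps T sol "[]"]
    by (simp add: output_sets_def del: upt_Suc)
  have pw: "G ^ 2 \<le> G ^ 7" "G ^ 3 \<le> G ^ 7" using G by (auto intro: power_increasing)
  \<comment> \<open>Evaluation by rules produces literal products such as \<open>q * T * n\<close>,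
    so the facts about the named values are used with the names expanded.\<close>
  have ZKCD: "q * T * n = Z" "q * floorlog 2 Z = K" "40 * K * K * Z = C" "80 * K * K * K = D" "n * w = B"
    by (simp_all add: Z_def K_def C_def D_def B_def)
  have "ev P ?env (main_body q) ?v (2000 * G ^ 7)"
    unfolding main_body_def
    by (rule ev_conv, (rule rules ev_call run_sort run_log[folded ZKCD(1)] run_len[folded ZKCD(1)] run_units[folded ZKCD(5)]
          run_T run_C[folded ZKCD(3), folded ZKCD(2), folded ZKCD(1)] run_t1[folded ZKCD(3), folded ZKCD(2), folded ZKCD(1)] run_t2 run_toks
          run_D[folded ZKCD(4), folded ZKCD(2), folded ZKCD(1)]
          run_U[folded ZKCD(4), folded ZKCD(2), folded ZKCD(1)] run_F run_best run_out
        | (simp add: small_simps small_q sT sqT sZ sK sw ZKCD; fail))+)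
      (use G_powers(1,2) pw in linarith)
  then show ?thesis by (simp only: program_nth)
qed

end

section \<open>Approximation guarantee and running time\<close>

lemma sorted_items_props:
  fixes w :: "nat \<Rightarrow> nat" and g :: "nat \<Rightarrow> nat list" and n :: nat
  defines "xs \<equiv> sorted_items (map w [1..<n + 1]) (map g [1..<n + 1])"
  shows "set xs = (\<lambda>i. (i, w i, g i)) ` {1..n}" "sorted_by_weight xs"
    "distinct (map fst xs)" "length xs = n"
proof -
  have sorted: "sorted_by_weight (insert_item x ys)"
    if "sorted_by_weight ys" for x ys
    using that by (induction ys) (auto simp: set_insert_item)
  have distinct: "distinct (map fst (insert_item x ys)) \<longleftrightarrow> distinct (map fst (x # ys))" for x ys
    by (induction ys) (auto simp: set_insert_item)
  have "set r = set ys \<union> (\<lambda>i. (i, w i, g i)) ` {a..<b} \<and> sorted_by_weight r \<and>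
      distinct (map fst r) \<and> length r = length ys + (b - a)"
    if "r = fst (fold sort_step (map w [a..<b]) (ys, a, map g [a..<b]))" "\<And>x. x \<in> set ys \<Longrightarrow> fst x < a"
      "sorted_by_weight ys" "distinct (map fst ys)" for a b r ys
    using that
  proof (induction "b - a" arbitrary: a ys)
    case (Suc d)
    then have up: "[a..<b] = a # [Suc a..<b]" by (intro upt_conv_Cons) simp
    let ?ys = "insert_item (a, w a, g a) ys"
    have "a \<notin> fst ` set ys" using Suc.prems(2) by fastforce
    then have "set r = set ?ys \<union> (\<lambda>i. (i, w i, g i)) ` {Suc a..<b} \<and>
      sorted_by_weight r \<and> distinct (map fst r) \<and> length r = length ?ys + (b - Suc a)"
      using Suc.prems Suc.hyps(2) sorted
      by (intro Suc.hyps(1)) (auto simp: up sort_step_def set_insert_item distinct less_Suc_eq)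
    moreover have "{a..<b} = insert a {Suc a..<b}" using Suc.hyps(2) by auto
    ultimately show ?case using Suc.hyps(2) by (auto simp: set_insert_item length_insert_item)
  qed simp
  from this[OF refl, of "[]" 1 "n + 1"] show "set xs = (\<lambda>i. (i, w i, g i)) ` {1..n}"
    "sorted_by_weight xs" "distinct (map fst xs)" "length xs = n"
    by (simp_all add: xs_def sorted_items_def atLeastLessThanSuc_atLeastAtMost del: upt_Suc)
qed

section \<open>From an optimal chain to a schedule with slack, and from a plan to a chain\<close>

lemma chain_profit_times:
  assumes "finite X" "\<And>i. i \<in> X \<Longrightarrow> time i \<in> {1..periods I}"
    and S: "\<And>t. t \<le> periods I \<Longrightarrow> S t = {i\<in>X. time i \<le> t}"
  shows "chain_profit I S = (\<Sum>i\<in>X. gain I i (time i))"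
proof -
  have "chain_profit I S = (\<Sum>t\<in>{1..periods I}. \<Sum>i\<in>{i\<in>X. time i = t}. gain I i (time i))"
    unfolding chain_profit_def
  proof (intro sum.cong refl)
    fix t i assume t: "t \<in> {1..periods I}"
    have "t - 1 \<le> periods I" "t \<le> periods I" using t by auto
    then show "S t - S (t - 1) = {i\<in>X. time i = t}" using t by (auto simp: S)
  qed auto
  also have "\<dots> = (\<Sum>i\<in>X. gain I i (time i))"
    using assms(1,2) by (intro sum.group) auto
  finally show ?thesis .
qed

text \<open>A chain is unconstrained beyond the last period, so there are infinitely many feasible
  chains. Their profits are bounded, however, and the empty chain is feasible, so \<open>Max\<close>
  is taken over a finite nonempty set.\<close>

lemma max_profit_attained:
  obtains S where "feasible_chain I S" "chain_profit I S = max_profit I"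
proof -
  let ?V = "{chain_profit I S | S. feasible_chain I S}"
  have "chain_profit I S \<le> (\<Sum>t\<in>{1..periods I}. \<Sum>i\<in>{1..items I}. gain I i t)" if "feasible_chain I S" for S
    unfolding chain_profit_def using that
    by (intro sum_mono sum_mono2) (auto simp: feasible_chain_def chain_def)
  then have "?V \<subseteq> {..(\<Sum>t\<in>{1..periods I}. \<Sum>i\<in>{1..items I}. gain I i t)}" by auto
  then have fin: "finite ?V" using finite_subset by blast
  have "feasible_chain I (\<lambda>_. {})" by (simp add: feasible_chain_def chain_def)
  then have "?V \<noteq> {}" by blast
  then have "max_profit I \<in> ?V" unfolding max_profit_def using fin by (rule Max_in[rotated])
  then show thesis using that by force
qed

text \<open>This is \<open>(1 + 1 / r) ^ (r + 1) \<ge> 2\<close>. Bernoulli's inequality is proved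
  first, in a form without division, and then applied with exponent \<open>r + 1\<close>.\<close>

lemma two_times_power_le:
  fixes r :: nat assumes "0 < r" shows "2 * r ^ (r + 1) \<le> (r + 1) ^ (r + 1)"
proof -
  have "r ^ k * (r + k) \<le> r * (r + 1) ^ k" for k
  proof (induction k)
    case (Suc k)
    have "r ^ Suc k * (r + Suc k) \<le> r ^ k * ((r + 1) * (r + k))" by (simp add: algebra_simps)
    also have "\<dots> \<le> (r + 1) * (r * (r + 1) ^ k)"
      using mult_le_mono2[OF Suc, of "r + 1"] by (simp only: ac_simps)
    finally show ?case by (simp add: algebra_simps)
  qed simp
  from this[of "r + 1"] have "r * (2 * r ^ (r + 1)) \<le> r * (r + 1) ^ (r + 1)"
    by (simp add: algebra_simps)
  then show ?thesis using assms by simp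
qed

text \<open>The previous bound reads \<open>(1 - 1 / q) ^ q \<le> 1 / 2\<close>; raised to the power
  \<open>L\<close>, it outweighs \<open>Z\<close>. This is the condition of the union bound for
  blocks of \<open>q * L\<close> items.\<close>

lemma coloring_condition:
  fixes q L Z :: nat
  assumes "2 \<le> q" "Z < 2 ^ L"
  shows "Z * (q - 1) ^ (q * L) < q ^ (q * L)"
proof -
  obtain r where r: "q = r + 1" "0 < r" using assms(1) by (cases q) auto
  have "Z * (q - 1) ^ (q * L) < 2 ^ L * (q - 1) ^ (q * L)" using assms(2) r by simp
  also have "\<dots> = (2 * r ^ (r + 1)) ^ L" by (simp only: r power_mult power_mult_distrib add_diff_cancel_right')
  also have "\<dots> \<le> ((r + 1) ^ (r + 1)) ^ L" using two_times_power_le[OF r(2)] by (rule power_mono) simp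
  also have "\<dots> = q ^ (q * L)" by (simp only: r power_mult)
  finally show ?thesis .
qed

text \<open>An optimal chain is viewed as its last set together with insertion times. The cheapest
  color class is removed, and its weight turns into slack. The last inequality says, without
  division, that at least \<open>1 - 1 / q\<close> of the maximum profit is kept.\<close>

lemma near_optimal_schedule:
  fixes I :: gik and q L m :: nat
  defines "n \<equiv> items I" and "T \<equiv> periods I" and "w \<equiv> weight I"
  assumes I: "gik_instance I" and q: "2 \<le> q" and L: "q * T * n < 2 ^ L" and m: "4 * n \<le> 2 ^ m"
  obtains A time s where "slack_schedule n T (q * L) m w A time s (capacity I)"
    "A \<subseteq> {1..n}" "\<And>i. i \<in> A \<Longrightarrow> time i \<in> {1..T}" "s T \<le> (\<Sum>i\<in>{1..n}. w i)"
    "q * max_profit I \<le> q * (\<Sum>i\<in>A. gain I i (time i)) + max_profit I"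
proof -
  have nT: "1 \<le> n" "1 \<le> T" "\<And>i. i \<in> {1..n} \<Longrightarrow> 0 < w i"
    using I by (auto simp: gik_instance_def n_def T_def w_def)
  obtain S where S: "feasible_chain I S" "chain_profit I S = max_profit I"
    using max_profit_attained by blast
  have S0: "S 0 = {}" and S_step: "\<And>t. t \<in> {1..T} \<Longrightarrow> S (t - 1) \<subseteq> S t \<and> S t \<subseteq> {1..n}"
    and S_cap: "\<And>t. t \<in> {1..T} \<Longrightarrow> sum w (S t) \<le> capacity I t"
    using S(1) by (auto simp: feasible_chain_def chain_def n_def T_def w_def)
  have S_mono: "S a \<subseteq> S b" if "a \<le> b" "b \<le> T" for a b
    using that
  proof (induction b rule: dec_induct)
    case (step b)
    have "S b \<subseteq> S (Suc b)" using S_step[of "Suc b"] step.prems by simp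
    moreover have "S a \<subseteq> S b" using step.IH step.prems by simp
    ultimately show ?case by simp
  qed simp
  define X where "X = S T"
  define time where "time i = (LEAST t. i \<in> S t)" for i
  have X: "X \<subseteq> {1..n}" unfolding X_def using S_step[of T] nT by auto
  then have finX: "finite X" using finite_subset by blast
  have S_eq: "S t = {i\<in>X. time i \<le> t}" if "t \<le> T" for t
  proof (intro set_eqI iffI)
    fix i assume i: "i \<in> S t"
    then have "time i \<le> t" unfolding time_def by (rule Least_le)
    moreover have "i \<in> X" using i S_mono[OF that order.refl] unfolding X_def by (rule subsetD[rotated])
    ultimately show "i \<in> {i\<in>X. time i \<le> t}" by simp
  next
    fix i assume i: "i \<in> {i\<in>X. time i \<le> t}"
    then have "i \<in> S T" by (simp add: X_def)
    then have "i \<in> S (time i)" unfolding time_def by (rule LeastI)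
    moreover have "S (time i) \<subseteq> S t" using i that by (intro S_mono) auto
    ultimately show "i \<in> S t" by (rule subsetD[rotated])
  qed
  have time: "time i \<in> {1..T}" if "i \<in> X" for i
  proof -
    have "time i \<le> T" using that unfolding time_def by (intro Least_le) (simp add: X_def)
    moreover have "time i \<noteq> 0" using S_eq[of 0] S0 that by auto
    ultimately show ?thesis by simp
  qed
  have profit: "max_profit I = (\<Sum>i\<in>X. gain I i (time i))"
    unfolding S(2)[symmetric] using finX time S_eq by (intro chain_profit_times) (auto simp: T_def)
  have "card X \<le> n" using X card_mono[of "{1..n}" X] by simp
  moreover have "q > 0" using q by simp
  moreover have "q * L > 0" using q L nT by (intro mult_pos_pos) (auto intro!: gr0I)
  moreover have "T * n * q * (q - 1) ^ (q * L) < q ^ (q * L)"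
    using coloring_condition[OF q L] by (simp add: mult_ac)
  ultimately obtain D where D: "D \<subseteq> X" "q * sum (\<lambda>i. gain I i (time i)) D \<le> sum (\<lambda>i. gain I i (time i)) X"
    "\<And>t. t \<in> {1..T} \<Longrightarrow> \<exists>Y\<subseteq>{i\<in>X. time i \<le> t}. card Y \<le> q * L \<and>
       sum w ({i\<in>X. time i \<le> t} - Y) \<le> q * L * sum w {i\<in>D. time i \<le> t}"
    using color_class_covers_light_items[OF finX, of n q "q * L" T "\<lambda>i. gain I i (time i)" time w] by blast
  define A where "A = X - D"
  define s where "s t = sum w {i\<in>D. time i \<le> t}" for t
  have finD: "finite D" using D(1) finX finite_subset by blast
  show thesis
  proof
    show "slack_schedule n T (q * L) m w A time s (capacity I)"
    proof
      show "finite A" using finX by (simp add: A_def)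
      show "card A \<le> n" using \<open>card X \<le> n\<close> card_mono[OF finX, of A] by (simp add: A_def)
      show "0 < q * L" by fact
      show "0 < w i" if "i \<in> A" for i using that X nT by (auto simp: A_def)
      show "4 * n \<le> 2 ^ m" by fact
      show "0 < n" using nT by simp
      show "s t \<le> s t'" if "t \<le> t'" for t t'
        unfolding s_def using that finD by (intro sum_mono2) auto
      show "sum w {i\<in>A. time i \<le> t} + s t \<le> capacity I t" if "t \<in> {1..T}" for t
      proof -
        have "sum w {i\<in>A. time i \<le> t} + s t = sum w ({i\<in>A. time i \<le> t} \<union> {i\<in>D. time i \<le> t})"
          unfolding s_def using finX finD by (intro sum.union_disjoint[symmetric]) (auto simp: A_def)
        also have "{i\<in>A. time i \<le> t} \<union> {i\<in>D. time i \<le> t} = S t"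
          using D(1) that by (auto simp: A_def S_eq)
        finally show ?thesis using S_cap[OF that] by simp
      qed
      show "\<exists>Y\<subseteq>{i\<in>A. time i \<le> t}. card Y \<le> q * L \<and> sum w ({i\<in>A. time i \<le> t} - Y) \<le> q * L * s t"
        if t: "t \<in> {1..T}" for t
      proof -
        obtain Y where Y: "Y \<subseteq> {i\<in>X. time i \<le> t}" "card Y \<le> q * L"
          "sum w ({i\<in>X. time i \<le> t} - Y) \<le> q * L * s t"
          using D(3)[OF t] unfolding s_def by blast
        have "finite Y" using Y(1) finX by (auto intro: finite_subset)
        then have "card (Y \<inter> A) \<le> q * L" using Y(2) card_mono[of Y "Y \<inter> A"] by simp
        moreover have "sum w ({i\<in>A. time i \<le> t} - Y \<inter> A) \<le> sum w ({i\<in>X. time i \<le> t} - Y)"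
          using finX by (intro sum_mono2) (auto simp: A_def)
        ultimately show ?thesis using Y by (intro exI[of _ "Y \<inter> A"]) auto
      qed
    qed
    show "A \<subseteq> {1..n}" using X by (auto simp: A_def)
    show "time i \<in> {1..T}" if "i \<in> A" for i using that time by (simp add: A_def)
    show "s T \<le> (\<Sum>i\<in>{1..n}. w i)"
      unfolding s_def using D(1) X by (intro sum_mono2) auto
    have "(\<Sum>i\<in>X. gain I i (time i)) = (\<Sum>i\<in>A. gain I i (time i)) + (\<Sum>i\<in>D. gain I i (time i))"
      using sum.subset_diff[OF D(1) finX] by (simp add: A_def)
    then have "q * max_profit I = q * (\<Sum>i\<in>A. gain I i (time i)) + q * (\<Sum>i\<in>D. gain I i (time i))"
      unfolding profit by (simp only: add_mult_distrib2)
    then show "q * max_profit I \<le> q * (\<Sum>i\<in>A. gain I i (time i)) + max_profit I"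
      using D(2) unfolding profit by linarith
  qed
qed

lemma set_inserted_by: "set (inserted_by t sol) = fst ` {z\<in>set sol. 1 \<le> snd z \<and> snd z \<le> t}"
proof -
  have "set (fold (\<lambda>(i, j) xs. if 1 \<le> j \<and> j \<le> t then i # xs else xs) sol xs) =
    set xs \<union> fst ` {z\<in>set sol. 1 \<le> snd z \<and> snd z \<le> t}" for xs
    by (induction sol arbitrary: xs) (auto simp: image_iff split: prod.splits)
  then show ?thesis by (simp add: inserted_by_def)
qed

text \<open>Every item occurs once in the plan, so \<open>map_of\<close> recovers its insertion time
  and sums over the plan become sums over items.\<close>

lemma plan_chain:
  fixes I :: gik and sol :: plan
  defines "S \<equiv> \<lambda>t. set (inserted_by t sol)"
  assumes distinct: "distinct (map fst sol)" and sol: "\<forall>(i, j)\<in>set sol. j \<le> periods I"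
    and items: "fst ` set sol \<subseteq> {1..items I}"
    and fits: "\<And>t. t \<in> {1..periods I} \<Longrightarrow>
       planned_weight (weight I) t sol \<le> capacity I t"
  shows "feasible_chain I S"
    and "chain_profit I S = sum_list (map (\<lambda>(i, j). if j = 0 then 0 else gain I i j) sol)"
    and "encodes_chain I (val_list (map nums (output_sets (periods I) sol))) S"
proof -
  have inj: "inj_on fst (set sol)" and dist: "distinct sol"
    using distinct by (simp_all add: distinct_map)
  have weight: "sum (weight I) (S t) = planned_weight (weight I) t sol" for t
  proof -
    have "planned_weight (weight I) t sol =
      (\<Sum>z\<in>set sol. if 1 \<le> snd z \<and> snd z \<le> t then weight I (fst z) else 0)"
      using dist by (simp add: sum_list_distinct_conv_sum_set split_beta)
    also have "\<dots> = (\<Sum>z\<in>{z\<in>set sol. 1 \<le> snd z \<and> snd z \<le> t}. weight I (fst z))"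
      by (rule sum.inter_filter[symmetric]) simp
    also have "\<dots> = sum (weight I) (S t)"
      unfolding S_def set_inserted_by using inj by (subst sum.reindex) (auto intro: inj_on_subset)
    finally show ?thesis by simp
  qed
  have "S 0 = {}" "\<And>t. S (t - 1) \<subseteq> S t" by (auto simp: S_def set_inserted_by)
  moreover have "S t \<subseteq> {1..items I}" for t using items by (auto simp: S_def set_inserted_by)
  ultimately show "feasible_chain I S"
    using fits weight by (simp add: feasible_chain_def chain_def)
  define X where "X = fst ` {z\<in>set sol. 1 \<le> snd z}"
  define time where "time i = the (map_of sol i)" for i
  have time: "time (fst z) = snd z" if "z \<in> set sol" for z
    using map_of_is_SomeI[OF distinct, of "fst z" "snd z"] that by (simp add: time_def)
  have "chain_profit I S = (\<Sum>i\<in>X. gain I i (time i))"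
  proof (rule chain_profit_times)
    show "finite X" by (simp add: X_def)
    show "time i \<in> {1..periods I}" if "i \<in> X" for i using that sol time by (auto simp: X_def)
    show "S t = {i\<in>X. time i \<le> t}" for t
      using time by (force simp: S_def set_inserted_by X_def)
  qed
  also have "\<dots> = (\<Sum>z\<in>{z\<in>set sol. 1 \<le> snd z}. gain I (fst z) (snd z))"
    unfolding X_def using inj time by (subst sum.reindex) (auto intro: inj_on_subset)
  also have "\<dots> = (\<Sum>z\<in>set sol. if 1 \<le> snd z then gain I (fst z) (snd z) else 0)"
    by (rule sum.inter_filter) simp
  also have "\<dots> = (\<Sum>z\<in>set sol. case z of (i, j) \<Rightarrow> if j = 0 then 0 else gain I i j)"
    by (intro sum.cong) auto
  also have "\<dots> = sum_list (map (\<lambda>(i, j). if j = 0 then 0 else gain I i j) sol)"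
    using dist by (simp add: sum_list_distinct_conv_sum_set)
  finally show "chain_profit I S = sum_list (map (\<lambda>(i, j). if j = 0 then 0 else gain I i j) sol)" .
  show "encodes_chain I (val_list (map nums (output_sets (periods I) sol))) S"
    unfolding encodes_chain_def
    by (intro exI[of _ "output_sets (periods I) sol"])
      (auto simp: nums_def[abs_def] output_sets_def S_def simp del: upt_Suc)
qed

lemma dp_run_profit_le:
  assumes "dp_run caps n U xs Q p sol" "\<And>i v g y. (i, v, g) \<in> set xs \<Longrightarrow> y \<in> set g \<Longrightarrow> y \<le> b"
  shows "p \<le> length xs * b"
  using assms
proof (induction rule: dp_run.induct)
  case (extend xs Q' p sol Q j g w i)
  have "(0 # g) ! j \<le> b"
  proof (cases j)
    case (Suc k)
    then have "g ! k \<in> set g" using extend.hyps(3) by simp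
    then show ?thesis using extend.prems Suc by auto
  qed simp
  moreover have "p \<le> length xs * b" using extend.prems by (intro extend.IH) auto
  ultimately show ?case by simp
qed simp

lemma dp_run_state: "dp_run caps n U xs Q p sol \<Longrightarrow> Q = [] \<or> Q \<in> U"
  by (induction rule: dp_run.induct) auto

section \<open>Parameters, correctness on one instance, and running time\<close>

lemma small_mult: "small a x \<Longrightarrow> small b y \<Longrightarrow> small (a + b) (x * y)"
  unfolding small_def power_add by (rule mult_strict_mono) auto

lemma small_self: "small k k" by (simp add: small_def)

lemma small_le_exp: "small a x \<Longrightarrow> a \<le> b \<Longrightarrow> small b x"
  unfolding small_def by (rule less_le_trans, assumption, rule power_increasing) auto

lemma small_bits: "small (bits k) k"
proof (cases "k = 0")
  case False
  then have "k < 2 ^ floorlog 2 k" by (intro floorlog2_bounds) simp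
  also have "\<dots> \<le> 2 ^ bits k" by (intro power_increasing) (auto simp: bits_def)
  finally show ?thesis by (simp add: small_def)
qed (simp add: small_def)

text \<open>No number of the input has more digits than the whole input. The 3 comes from the three
  summands of the size, each at least 1.\<close>

lemma input_size_bounds:
  assumes I: "gik_instance I"
  shows "3 \<le> input_size I" "items I \<le> input_size I" "periods I \<le> input_size I"
    and "i \<in> {1..items I} \<Longrightarrow> small (input_size I) (weight I i)"
    and "t \<in> {1..periods I} \<Longrightarrow> small (input_size I) (capacity I t)"
    and "i \<in> {1..items I} \<Longrightarrow> t \<in> {1..periods I} \<Longrightarrow> small (input_size I) (gain I i t)"
proof -
  let ?n = "items I" and ?T = "periods I" and ?s = "input_size I"
  have nT: "1 \<le> ?n" "1 \<le> ?T" using I by (auto simp: gik_instance_def)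
  define bw where "bw = bits (Max (weight I ` {1..?n}))"
  define bg where "bg = bits (Max {gain I i t | i t. i \<in> {1..?n} \<and> t \<in> {1..?T}})"
  define bc where "bc = bits (Max (capacity I ` {1..?T}))"
  have s: "?s = ?n * bw + ?n * ?T * bg + ?T * bc"
    by (simp add: input_size_def bw_def bg_def bc_def)
  have "1 \<le> bw" "1 \<le> bg" "1 \<le> bc" by (auto simp: bits_def bw_def bg_def bc_def)
  then have "?n \<le> ?n * bw" "?T \<le> ?T * bc" "1 \<le> ?n * ?T * bg" "bw \<le> ?n * bw" "bc \<le> ?T * bc" "bg \<le> ?n * ?T * bg"
    using nT by simp_all
  then have le: "3 \<le> ?s" "?n \<le> ?s" "?T \<le> ?s" "bw \<le> ?s" "bg \<le> ?s" "bc \<le> ?s"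
    using nT unfolding s by linarith+
  then show "3 \<le> ?s" "?n \<le> ?s" "?T \<le> ?s" by simp_all
  have *: "small ?s x" if "x \<in> V" "finite V" "bits (Max V) \<le> ?s" for x V
    using small_le_exp[OF small_bits that(3)] Max_ge[OF that(2,1)] by (rule small_mono)
  show "i \<in> {1..?n} \<Longrightarrow> small ?s (weight I i)"
    by (rule *[of _ "weight I ` {1..?n}"]) (use le in \<open>auto simp: bw_def\<close>)
  show "t \<in> {1..?T} \<Longrightarrow> small ?s (capacity I t)"
    by (rule *[of _ "capacity I ` {1..?T}"]) (use le in \<open>auto simp: bc_def\<close>)
  have "{gain I i t | i t. i \<in> {1..?n} \<and> t \<in> {1..?T}} = (\<lambda>(i, t). gain I i t) ` ({1..?n} \<times> {1..?T})"
    by (force simp: image_iff)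
  then have "finite {gain I i t | i t. i \<in> {1..?n} \<and> t \<in> {1..?T}}" by simp
  then show "i \<in> {1..?n} \<Longrightarrow> t \<in> {1..?T} \<Longrightarrow> small ?s (gain I i t)"
    by (intro *[of _ "{gain I i t | i t. i \<in> {1..?n} \<and> t \<in> {1..?T}}"]) (use le in \<open>auto simp: bg_def\<close>)
qed

text \<open>The value of \<open>G\<close> for the whole run. A token consists of two periods, a
  multiplicity and one of at most \<open>3 * s\<close> units, so the base of the power bounds the
  number of tokens and the power the number of token lists. The other summands cover the remaining
  lengths and bit lengths.\<close>

definition cost_parameter :: "nat \<Rightarrow> nat \<Rightarrow> nat \<Rightarrow> nat \<Rightarrow> nat" where
  "cost_parameter q n T s = (let Z = q * T * n; K = q * floorlog 2 Z; C = 40 * K * K * Z; D = 80 * K * K * K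
     in ((T + 1) ^ 2 * (C + 1) * (3 * s)) ^ (D + 1) + 4 * s + C + D + 20)"

text \<open>The origin of the 80: the estimate gives \<open>4 + 51 = 55\<close> times
  \<open>K ^ 3\<close>, and 80 leaves room.\<close>

lemma token_count_le:
  fixes K m :: nat
  assumes "2 \<le> K" "m \<le> K + 2"
  shows "K * (m + K + 1) + (m + K) * (16 * K\<^sup>2 + 1) \<le> 80 * K * K * K"
proof -
  have "m + K + 1 \<le> 4 * K" "m + K \<le> 3 * K" using assms by auto
  moreover have "16 * K\<^sup>2 + 1 \<le> 17 * (K * K)"
  proof -
    have "1 \<le> K * K" using assms by simp
    then show ?thesis by (simp add: power2_eq_square)
  qed
  ultimately have "K * (m + K + 1) + (m + K) * (16 * K\<^sup>2 + 1) \<le> K * (4 * K) + 3 * K * (17 * (K * K))"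
    by (intro add_mono mult_le_mono) auto
  also have "K * (4 * K) \<le> K * (4 * K) * K" using assms by simp
  finally show ?thesis by (simp add: algebra_simps)
qed

text \<open>Two independent halves meet here. For completeness, a near-optimal schedule becomes a
  run of the dynamic program; for soundness, the plan actually found is feasible, whatever run
  produced it. The rest verifies that \<open>G\<close> bounds all numbers and lists that
  occur.\<close>

lemma solve_instance:
  assumes I: "gik_instance I" and q: "2 \<le> q"
  shows "\<exists>v c S. runs (gik_program q) (encode_instance I) v c \<and>
     c \<le> 2000 * cost_parameter q (items I) (periods I) (input_size I) ^ 7 + 2 \<and>
     encodes_chain I v S \<and> feasible_chain I S \<and>
     q * max_profit I \<le> q * chain_profit I S + max_profit I"
proof -
  define n T s where "n = items I" and "T = periods I" and "s = input_size I"
  define Z where "Z = q * T * n"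
  define L where "L = floorlog 2 Z"
  define K where "K = q * L"
  define m where "m = L + 2"
  define C where "C = 40 * K * K * Z"
  define D where "D = 80 * K * K * K"
  define G where "G = cost_parameter q n T s"
  define w where "w = weight I"
  define g where "g i = map (gain I i) [1..<T + 1]" for i
  define ws caps gs where "ws = map w [1..<n + 1]" and "caps = map (capacity I) [1..<T + 1]"
    and "gs = map g [1..<n + 1]"
  have set_ws: "set ws = w ` {1..n}" and set_caps: "set caps = capacity I ` {1..T}"
    by (simp_all add: ws_def caps_def atLeastLessThanSuc_atLeastAtMost del: upt_Suc)
  define xs where "xs = sorted_items ws gs"
  define B where "B = n * fst (snd (hd xs))"
  define us where "us = unit_list B ws"
  define toks where "toks = token_list T C us"
  define U where "U = state_list D toks"
  have G: "G = ((T + 1) ^ 2 * (C + 1) * (3 * s)) ^ (D + 1) + 4 * s + C + D + 20"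
    by (simp add: G_def cost_parameter_def Let_def C_def D_def K_def L_def Z_def)
  have nT: "1 \<le> n" "1 \<le> T" "\<And>i. i \<in> {1..n} \<Longrightarrow> 0 < w i"
    using I by (auto simp: gik_instance_def n_def T_def w_def)
  note size = input_size_bounds[OF I, folded n_def T_def s_def]
  have len: "length ws = n" "length caps = T" "length gs = n" by (simp_all add: ws_def caps_def gs_def del: upt_Suc)
  have Z: "2 \<le> Z" "n \<le> Z" "q \<le> Z"
  proof -
    have "q * 1 * 1 \<le> q * T * n" "1 * 1 * n \<le> q * T * n" using q nT by (intro mult_le_mono; simp)+
    then show "2 \<le> Z" "n \<le> Z" "q \<le> Z" using q unfolding Z_def by linarith+
  qed
  have L: "Z < 2 ^ L" "2 ^ L \<le> 2 * Z" using floorlog2_bounds[of Z] Z by (auto simp: L_def)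
  have "0 < L" using L(1) Z by (cases L) auto
  then have K: "2 \<le> K" "L \<le> K"
    using q mult_le_mono[of 2 q 1 L] mult_le_mono[of 1 q L L] by (simp_all add: K_def)
  have m: "4 * n \<le> 2 ^ m" "2 ^ m \<le> 8 * Z" using L Z by (simp_all add: m_def)
  have xs: "set xs = (\<lambda>i. (i, w i, g i)) ` {1..n}" "sorted_by_weight xs"
    "distinct (map fst xs)" "length xs = n"
    using sorted_items_props[of w n g] by (simp_all add: xs_def ws_def gs_def)
  then have "xs \<noteq> []" using nT by auto
  then obtain x0 xs' where x0: "xs = x0 # xs'" by (cases xs) auto
  have hd_w: "w i \<le> fst (snd (hd xs))" if "i \<in> {1..n}" for i
  proof -
    have "(i, w i, g i) \<in> set xs" using that xs(1) by simp
    then show ?thesis using xs(2) by (auto simp: x0)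
  qed
  have "hd xs \<in> set xs" using \<open>xs \<noteq> []\<close> by (rule hd_in_set)
  then obtain i0 where i0: "i0 \<in> {1..n}" "hd xs = (i0, w i0, g i0)" unfolding xs(1) by blast
  have sn: "small s n" using small_le_exp[OF small_self] size(2) by blast
  have small_w: "small s (w i)" if "i \<in> {1..n}" for i using size(4) that by (simp add: w_def)
  have small_nw: "small (2 * s) (n * w i)" if "i \<in> {1..n}" for i
    using small_mult[OF sn small_w[OF that]] by (simp add: mult_2)
  have B: "small (2 * s) B" using small_nw[OF i0(1)] by (simp add: B_def i0)
  \<comment> \<open>The slack never exceeds the total weight and hence \<open>B\<close>, so the
    powers of two up to \<open>B\<close> contain every grid width. They number at most
    \<open>2 * s\<close>; with the \<open>n \<le> s\<close> weights this gives \<open>3 * s\<close>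
    units.\<close>
  have sum_B: "(\<Sum>i\<in>{1..n}. w i) \<le> B"
    using sum_bounded_above[of "{1..n}" w "fst (snd (hd xs))"] hd_w by (simp add: B_def)
  have "floorlog 2 B \<le> 2 * s" using B by (intro floorlog_leI) (auto simp: small_def)
  then have len_us: "length us \<le> 3 * s" "0 < length us"
    using size(2) len nT by (auto simp: us_def unit_list_def)
  have set_us: "set us = {2 ^ e | e. e < floorlog 2 B} \<union> w ` {1..n}"
    by (auto simp: us_def unit_list_def set_ws)
  have pow_us: "2 ^ e \<in> set us" if "2 ^ e \<le> B" for e
  proof -
    have "B > 0" using that by (auto intro: gr0I)
    then have "(2::nat) ^ e < 2 ^ floorlog 2 B" using floorlog2_bounds(2)[of B] that by linarith
    then have "e < floorlog 2 B" by (rule power_less_imp_less_exp[rotated]) simp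
    then show ?thesis by (auto simp: set_us)
  qed
  have small_us: "small (2 * s) u" if "u \<in> set us" for u
    using that unfolding set_us
  proof
    assume "u \<in> {2 ^ e | e. e < floorlog 2 B}"
    then obtain e where e: "u = 2 ^ e" "e < floorlog 2 B" by blast
    then have "B > 0" by (auto simp: floorlog_def intro: gr0I)
    have "2 ^ Suc e \<le> (2::nat) ^ floorlog 2 B" using e by (intro power_increasing) auto
    then have "u \<le> B" using floorlog2_bounds(1)[OF \<open>B > 0\<close>] e by simp
    then show ?thesis by (rule small_mono[OF B])
  next
    assume "u \<in> w ` {1..n}"
    then obtain i where "i \<in> {1..n}" "u = w i" by blast
    then show ?thesis using small_le_exp[OF small_w, of i "2 * s"] by simp
  qed
  have toks: "0 < length toks" "length toks ^ (D + 1) \<le> G"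
  proof -
    show "0 < length toks" using len_us by (simp add: toks_def length_token_list)
    have "length toks \<le> (T + 1) ^ 2 * (C + 1) * (3 * s)"
      unfolding toks_def length_token_list using len_us(1) by (rule mult_le_mono2)
    then have "length toks ^ (D + 1) \<le> ((T + 1) ^ 2 * (C + 1) * (3 * s)) ^ (D + 1)" by (rule power_mono) simp
    then show "length toks ^ (D + 1) \<le> G" unfolding G by linarith
  qed
  have "Z \<le> C"
  proof -
    have "1 * Z \<le> 40 * K * K * Z" using K by (intro mult_le_mono1) auto
    then show ?thesis by (simp add: C_def)
  qed
  have Gbig: "4 * s + C + D + 20 \<le> G" unfolding G by linarith
  have setU: "set U = {Q. set Q \<subseteq> set toks \<and> length Q = D + 1}"
    using state_list_props[of D toks] by (simp add: U_def)
  have "q \<le> G" using Z(3) \<open>Z \<le> C\<close> Gbig by linarith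
  interpret bounded_run q G
  proof
    show "8 \<le> G" using Gbig by simp
    show "small G q" using small_le_exp[OF small_self \<open>q \<le> G\<close>] .
  qed
  have G1: "2 * s \<le> G - 1" "s \<le> G - 1" "s \<le> G" using Gbig by auto
  have okU: "ok_state Q" if "Q \<in> set U" for Q
  proof -
    have Q: "set Q \<subseteq> set toks" "length Q = D + 1" using that by (auto simp: setU)
    have tok: "a \<le> T \<and> b \<le> T \<and> c \<le> C \<and> u \<in> set us" if "(a, b, c, u) \<in> set Q" for a b c u
      using that Q(1) set_token_list[of a b c u T C us] by (auto simp: toks_def)
    have "token_mass Q \<le> sum_list (map (\<lambda>_. C * 2 ^ (2 * s)) Q)"
    proof (intro sum_list_mono)
      fix z assume "z \<in> set Q"
      obtain a b c u where z: "z = (a, b, c, u)" by (cases z)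
      then have "c \<le> C" "u \<le> 2 ^ (2 * s)" using tok[of a b c u] \<open>z \<in> set Q\<close> small_us[of u]
        by (auto simp: small_def)
      then show "(case z of (a, b, c, u) \<Rightarrow> c * u) \<le> C * 2 ^ (2 * s)" by (simp add: z mult_le_mono)
    qed
    also have "\<dots> = (D + 1) * C * 2 ^ (2 * s)" by (simp add: sum_list_triv Q(2) algebra_simps)
    finally have le: "token_mass Q \<le> (D + 1) * C * 2 ^ (2 * s)" .
    have "small (2 * s + 1) (2 ^ (2 * s))" unfolding small_def by (rule power_strict_increasing) auto
    then have "small (D + 1 + C + (2 * s + 1)) ((D + 1) * C * 2 ^ (2 * s))"
      by (rule small_mult[OF small_mult[OF small_self small_self]])
    then have "small (G - 1) ((D + 1) * C * 2 ^ (2 * s))"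
      by (rule small_le_exp) (use Gbig in simp)
    then have "small (G - 1) (token_mass Q)" using le by (rule small_mono)
    moreover have "small G a \<and> small G b \<and> small G c \<and> small G u" if "(a, b, c, u) \<in> set Q" for a b c u
    proof -
      have "a \<le> G" "b \<le> G" "c \<le> G" using tok[OF that] size(3) Gbig by auto
      moreover have "small G u" using small_us[of u] tok[OF that] G1 by (auto intro: small_le_exp)
      ultimately show ?thesis by (auto intro: small_length)
    qed
    ultimately show ?thesis using Q(2) Gbig by (auto simp: ok_state_def)
  qed
  have set_g: "set (g i) = gain I i ` {1..T}" for i
    by (simp add: g_def atLeastLessThanSuc_atLeastAtMost del: upt_Suc)
  have ok_xs: "ok_item n x" if x: "x \<in> set xs" for x
  proof -
    obtain i where i: "x = (i, w i, g i)" "i \<in> {1..n}" using x unfolding xs(1) by blast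
    have "small G i" using i(2) size(2) Gbig by (intro small_length) auto
    moreover have "small (G - 1) y" if "y \<in> set (g i)" for y
      using that size(6)[OF i(2)] small_le_exp[OF _ G1(2)] unfolding set_g by blast
    ultimately show ?thesis
      using small_le_exp[OF small_w[OF i(2)] G1(2)] small_le_exp[OF small_nw[OF i(2)] G1(1)] size(3) Gbig
      by (auto simp: ok_item_def i(1) g_def simp del: upt_Suc)
  qed
  have okF: "ok_entry e" if ys: "xs = ys @ zs" and e: "e \<in> set (frontier caps n U ys)" for ys zs e
  proof -
    obtain Q p sol where Q: "e = (Q, p, sol)" by (cases e)
    have run: "dp_run caps n (set U) ys Q p sol" using frontier_sound e by (simp add: Q)
    have "y \<le> 2 ^ s - 1" if "(i, v, h) \<in> set ys" and y: "y \<in> set h" for i v h y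
    proof -
      have "(i, v, h) \<in> set xs" using that(1) ys by simp
      then have i: "i \<in> {1..n}" "h = g i" unfolding xs(1) by auto
      then obtain t where "t \<in> {1..T}" "y = gain I i t" using y unfolding i(2) set_g by blast
      then have "y < 2 ^ s" using size(6)[OF i(1)] by (simp add: small_def)
      then show ?thesis by simp
    qed
    then have "p \<le> length ys * (2 ^ s - 1)" using dp_run_profit_le[OF run] by blast
    also have "\<dots> \<le> n * (2 ^ s - 1)" using xs(4) ys by (intro mult_le_mono1) auto
    finally have "small (s + s) p"
      by (rule small_mono[OF small_mult[OF sn], rotated 1]) (simp add: small_def)
    then have "small (G - 1) p" using G1 by (auto intro: small_le_exp)
    moreover have "ok_state Q"
    proof -
      have "ok_state []" by (simp add: ok_state_def small_def)
      then show ?thesis using dp_run_state[OF run] okU by blast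
    qed
    ultimately show ?thesis by (simp add: ok_entry_def Q)
  qed
  have "q * T * n < 2 ^ L" using L(1) by (simp add: Z_def)
  then obtain A time sl where sched: "slack_schedule n T K m w A time sl (capacity I)"
    and A: "A \<subseteq> {1..n}" "\<And>i. i \<in> A \<Longrightarrow> time i \<in> {1..T}" "sl T \<le> (\<Sum>i\<in>{1..n}. w i)"
    and near: "q * max_profit I \<le> q * (\<Sum>i\<in>A. gain I i (time i)) + max_profit I"
    using near_optimal_schedule[OF I q, of L m] m(1) unfolding n_def T_def w_def K_def by blast
  interpret sched: slack_schedule n T K m w A time sl "capacity I" by fact
  have ids: "fst ` set xs = {1..n}" using xs(1) by (simp add: image_image)
  have caps_nth: "caps ! (t - 1) = capacity I t" if "t \<in> {1..T}" for t
    using that by (auto simp: caps_def nth_append simp del: upt_Suc)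
  have "\<exists>Q sol. dp_run caps n (set U) xs Q (\<Sum>i\<in>fst ` set xs \<inter> A. gain I i (time i)) sol \<and>
    (\<forall>\<omega>. (xs = [] \<or> \<omega> = fst (snd (last xs))) \<longrightarrow> (\<forall>t\<in>{1..T}. load Q t = sched.snapshot \<omega> (fst ` set xs \<inter> A) t))"
  proof (rule sched.snapshot_run[OF xs(2,3) _ A(2) len(2) caps_nth])
    show "v = w i \<and> 0 < w i \<and> h = map (gain I i) [1..<T + 1]" if "(i, v, h) \<in> set xs" for i v h
      using that xs(1) nT(3) by (auto simp: g_def simp del: upt_Suc)
    fix Q assume Q: "length Q \<le> K * (m + K + 1) + (m + K) * (16 * K\<^sup>2 + 1)"
      "\<And>\<tau>. \<tau> \<in> set Q \<Longrightarrow> sched.available \<tau>"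
    \<comment> \<open>By \<open>2 ^ m \<le> 8 * Z\<close>, the factor 5 of \<open>available\<close>
      becomes the 40 in \<open>C\<close>.\<close>
    have C5: "5 * K\<^sup>2 * 2 ^ m \<le> C"
      using mult_le_mono2[OF m(2), of "5 * K\<^sup>2"] by (simp add: C_def power2_eq_square algebra_simps)
    have "length Q \<le> D"
      using Q(1) token_count_le[OF K(1), of m] K(2) by (simp add: D_def m_def)
    \<comment> \<open>Padding to the fixed length \<open>D + 1\<close> by tokens of multiplicity 0,
      which carry no load.\<close>
    define R where "R = Q @ replicate (D + 1 - length Q) (0, 0, 0, hd us)"
    have "load R = load Q" by (rule ext) (simp add: R_def load_def sum_list_replicate)
    moreover have "set R \<subseteq> set toks"
    proof
      fix z assume "z \<in> set R"
      obtain a b c u where z: "z = (a, b, c, u)" by (cases z)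
      consider "(a, b, c, u) \<in> set Q" | "(a, b, c, u) = (0, 0, 0, hd us)"
        using \<open>z \<in> set R\<close> by (auto simp: R_def z split: if_splits)
      then show "z \<in> set toks"
      proof cases
        case 1
        note av = Q(2)[OF 1, unfolded sched.available_def prod.case]
        then have "u \<in> set us" using A(1,3) sum_B pow_us by (fastforce simp: set_us)
        then show ?thesis using av C5 by (simp add: z toks_def set_token_list)
      next
        case 2
        then show ?thesis using len_us by (simp add: z toks_def set_token_list)
      qed
    qed
    moreover have "length R = D + 1" using \<open>length Q \<le> D\<close> by (simp add: R_def)
    ultimately show "\<exists>Q'\<in>set U. load Q' = load Q" by (auto simp: setU)
  qed
  then obtain Q0 sol0 where run0: "dp_run caps n (set U) xs Q0 (\<Sum>i\<in>A. gain I i (time i)) sol0"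
    using A(1) by (auto simp: ids Int_absorb1)
  define F where "F = frontier caps n U xs"
  obtain p1 sol1 where p1: "(Q0, p1, sol1) \<in> set F" "(\<Sum>i\<in>A. gain I i (time i)) \<le> p1"
    using frontier_complete[OF run0] by (auto simp: F_def)
  have best: "is_best (snd ` set F) (best_entry F)" by (rule is_best_best_entry)
  then obtain p sol where psol: "best_entry F = Some (p, sol)"
    using p1 by (cases "best_entry F") (auto simp: is_best_def)
  have "p1 \<le> p" using best p1 unfolding psol is_best_def by force
  obtain Q where "(Q, p, sol) \<in> set F" using best unfolding psol is_best_def by force
  then have run: "dp_run caps n (set U) xs Q p sol" by (simp add: F_def frontier_sound)
  have plan: "map fst sol = rev (map fst xs) \<and> (\<forall>(i, j)\<in>set sol. j \<le> T) \<and>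
    p = sum_list (map (\<lambda>(i, j). if j = 0 then 0 else gain I i j) sol)"
    using xs(1) by (intro dp_run_plan[OF run]) (auto simp: g_def simp del: upt_Suc)
  have len_sol: "length sol = n" using plan xs(4) by (metis length_map length_rev)
  define S where "S t = set (inserted_by t sol)" for t
  have chain: "feasible_chain I S" "chain_profit I S = p"
    "encodes_chain I (val_list (map nums (output_sets T sol))) S"
  proof -
    have 1: "distinct (map fst sol)" using plan xs(3) by simp
    have 2: "\<forall>(i, j)\<in>set sol. j \<le> periods I" using plan by (simp add: T_def)
    have "fst ` set sol = fst ` set xs" using plan by (metis list.set_map set_rev)
    then have 3: "fst ` set sol \<subseteq> {1..items I}" using ids by (simp add: n_def)
    have 4: "planned_weight (weight I) t sol \<le> capacity I t"
      if t: "t \<in> {1..periods I}" for t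
    proof -
      \<comment> \<open>No item follows the complete run, so the reserve \<open>r\<close> of
        \<open>dp_run_fits\<close> is 0.\<close>
      have "planned_weight w t sol + 0 \<le> caps ! (t - 1)"
        using xs(1,4) t len by (intro dp_run_fits[OF run xs(2)]) (auto simp: T_def)
      then show ?thesis using caps_nth[of t] t unfolding w_def T_def by simp
    qed
    show "feasible_chain I S" "chain_profit I S = p"
      "encodes_chain I (val_list (map nums (output_sets T sol))) S"
      using plan_chain[OF 1 2 3 4] plan by (simp_all add: S_def[abs_def] T_def)
  qed
  have enc: "encode_instance I = Pair (Num n) (Pair (Num T) (Pair (nums ws) (Pair (nums caps)
       (Pair (val_list (map nums gs)) (Num 0)))))"
    by (simp add: encode_instance_def nums_def ws_def caps_def gs_def g_def n_def T_def w_def o_def del: upt_Suc)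
  have "ev (gik_program q) [encode_instance I] (gik_program q ! 0)
     (val_list (map nums (output_sets T sol))) (2000 * G ^ 7)"
    unfolding enc
  proof (rule ev_main[of n ws gs T caps p sol, folded Z_def, folded L_def, folded K_def,
        folded C_def D_def xs_def, folded B_def, folded us_def, folded toks_def, folded U_def, folded F_def])
    show "n < G" "T < G" using size Gbig by auto
    show "length ws = n" "length gs = n" "length caps = T" by (simp_all add: len)
    show "small (G - 1) v" if "v \<in> set ws" for v
      using that small_le_exp[OF small_w G1(2)] unfolding set_ws by blast
    show "ok_caps caps"
      using small_le_exp[OF size(5) G1(3)] size(3) Gbig by (simp add: ok_caps_def set_caps len)
    show "ok_item n x" if "x \<in> set xs" for x using that by (rule ok_xs)
    show "length xs = n" "xs \<noteq> []" by fact+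
    show "C < G" "D < G" "0 < K" using Gbig K by auto
    have "Z \<le> G - 1" using \<open>Z \<le> C\<close> Gbig by simp
    then show "small (G - 1) Z" by (rule small_le_exp[OF small_self])
    show "length us \<le> G" using len_us Gbig by simp
    show "0 < length toks" "length toks ^ (D + 1) \<le> G" by fact+
    show "ok_state Q" if "Q \<in> set U" for Q using that by (rule okU)
    show "ok_entry e" if "xs = ys @ zs" "e \<in> set (frontier caps n U ys)" for ys zs e
      using that by (rule okF)
    show "best_entry F = Some (p, sol)" by fact
    show "length sol \<le> G" using len_sol size(2) Gbig by simp
    show "small G j" if "(i, j) \<in> set sol" for i j
      using plan that size(3) Gbig by (intro small_length) auto
  qed
  note run_main = this
  have "ev (gik_program q) [encode_instance I] (Call 0 (Var 0))
     (val_list (map nums (output_sets T sol))) (1 + 2000 * G ^ 7 + 1)"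
    by (rule ev_call[OF _ ev_var_nth(1) run_main]) (simp add: length_program)
  then obtain c where c: "c \<le> 2000 * G ^ 7 + 2"
    "runs (gik_program q) (encode_instance I) (val_list (map nums (output_sets T sol))) c"
    by (auto simp: ev_def runs_def)
  have "q * (\<Sum>i\<in>A. gain I i (time i)) \<le> q * p" using p1(2) \<open>p1 \<le> p\<close> by (intro mult_le_mono2) simp
  then have "q * max_profit I \<le> q * chain_profit I S + max_profit I"
    using near unfolding chain(2) by linarith
  with c chain(1,3) show ?thesis
    unfolding G_def n_def T_def s_def by (intro exI conjI)
qed

text \<open>The number \<open>y\<close> dominates both \<open>q\<close> and the binary logarithm of
  \<open>s\<close>. Then \<open>K \<le> 3 * y\<^sup>2\<close>, so
  \<open>D \<le> 2160 * y ^ 6\<close>, and there are at most \<open>s ^ (15 * y)\<close> tokens. The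
  number of token lists is thus at most \<open>s ^ E\<close> with \<open>15 * 2161 = 32415\<close>
  in \<open>E\<close>. The seventh power and all constants fit into the exponent
  \<open>8 * E\<close>.\<close>

lemma cost_parameter_le:
  fixes q n T s y :: nat
  assumes q: "2 \<le> q" "q \<le> y" and s: "3 \<le> s" "s \<le> 2 ^ y" and n: "1 \<le> n" "n \<le> s" and T: "1 \<le> T" "T \<le> s"
  shows "2000 * cost_parameter q n T s ^ 7 + 2 \<le> s ^ (259320 * y ^ 7)"
proof -
  define Z where "Z = q * T * n"
  define K where "K = q * floorlog 2 Z"
  define C where "C = 40 * K * K * Z"
  define D where "D = 80 * K * K * K"
  define E where "E = 32415 * y ^ 7"
  have y: "2 \<le> y" using q by simp
  have pow2: "2 ^ k \<le> s ^ k" for k using s by (intro power_mono) auto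
  have exp: "s ^ a \<le> s ^ b" if "a \<le> b" for a b using that s by (intro power_increasing) auto
  have y_pow: "y \<le> y ^ 7" "y ^ 6 \<le> y ^ 7" "128 \<le> y ^ 7"
  proof -
    show "y \<le> y ^ 7" using y by (intro self_le_power) auto
    show "y ^ 6 \<le> y ^ 7" using y by (intro power_increasing) auto
    have "2 ^ 7 \<le> y ^ 7" using y by (intro power_mono) auto
    then show "128 \<le> y ^ 7" by simp
  qed
  have p: "y ^ 2 = y * y" "y ^ 5 = y * y * y * y * y" "y ^ 6 = y * y * y * y * y * y" "y ^ 7 = y * y * y * y * y * y * y"
    by (simp_all add: eval_nat_numeral)
  have y_s: "y \<le> s ^ y" using pow2[of y] less_exp[of y] by linarith
  have Z: "Z \<le> y * s ^ 2" unfolding Z_def power2_eq_square mult.assoc[symmetric]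
    using q n T by (intro mult_le_mono)
  have "Z < 2 ^ y * (2 ^ y * 2 ^ y)"
  proof -
    have "s ^ 2 \<le> 2 ^ y * 2 ^ y" unfolding power2_eq_square using s by (intro mult_le_mono)
    then have "y * s ^ 2 \<le> y * (2 ^ y * 2 ^ y)" by (rule mult_le_mono2)
    also have "\<dots> < 2 ^ y * (2 ^ y * 2 ^ y)" by simp
    finally show ?thesis using Z by simp
  qed
  then have "floorlog 2 Z \<le> y + (y + y)" by (intro floorlog_leI) (simp_all add: power_add)
  then have "K \<le> y * (3 * y)" unfolding K_def using q by (intro mult_le_mono) auto
  then have K: "K \<le> 3 * y ^ 2" by (simp add: power2_eq_square)
  have C: "C + 1 \<le> s ^ (12 + 5 * y)"
  proof -
    have "C \<le> 40 * (3 * y ^ 2) * (3 * y ^ 2) * (y * s ^ 2)"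
      unfolding C_def using K Z by (intro mult_le_mono) auto
    also have "\<dots> = 360 * y ^ 5 * s ^ 2" by (simp add: p)
    also have "\<dots> \<le> s ^ 9 * (s ^ y) ^ 5 * s ^ 2"
      using pow2[of 9] y_s by (intro mult_le_mono power_mono) auto
    also have "\<dots> = s ^ (11 + 5 * y)" by (simp flip: power_add power_mult add: mult.commute)
    finally have "C \<le> s ^ (11 + 5 * y)" .
    moreover have "1 \<le> s ^ (11 + 5 * y)" using s by simp
    ultimately have "C + 1 \<le> 2 * s ^ (11 + 5 * y)" by simp
    also have "\<dots> \<le> s * s ^ (11 + 5 * y)" using s by (intro mult_le_mono1) auto
    also have "\<dots> = s ^ (12 + 5 * y)" by (simp flip: power_Suc)
    finally show ?thesis .
  qed
  have D: "D \<le> 2160 * y ^ 6"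
  proof -
    have "D \<le> 80 * (3 * y ^ 2) * (3 * y ^ 2) * (3 * y ^ 2)"
      unfolding D_def using K by (intro mult_le_mono) auto
    then show ?thesis by (simp add: p)
  qed
  have "(T + 1) ^ 2 \<le> (s * s) ^ 2"
  proof (rule power_mono)
    have "T + 1 \<le> 2 * s" using T s by simp
    also have "\<dots> \<le> s * s" using s by (intro mult_le_mono1) auto
    finally show "T + 1 \<le> s * s" .
  qed simp
  moreover have "3 * s \<le> s * s" using s by (intro mult_le_mono1) auto
  ultimately have "(T + 1) ^ 2 * (C + 1) * (3 * s) \<le> (s * s) ^ 2 * s ^ (12 + 5 * y) * (s * s)"
    using C by (blast intro: mult_le_mono)
  also have "\<dots> = s ^ (18 + 5 * y)"
    by (simp only: power2_eq_square[symmetric] power_mult[symmetric] power_add[symmetric]) simp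
  also have "\<dots> \<le> s ^ (15 * y)" using y by (intro exp) auto
  finally have "((T + 1) ^ 2 * (C + 1) * (3 * s)) ^ (D + 1) \<le> (s ^ (15 * y)) ^ (D + 1)"
    by (rule power_mono) simp
  also have "\<dots> = s ^ (15 * y * (D + 1))" by (simp only: power_mult)
  also have "\<dots> \<le> s ^ E"
  proof (rule exp)
    have "15 * y * (D + 1) \<le> 15 * y * (2160 * y ^ 6 + y ^ 6)"
      using D y by (intro mult_le_mono2 add_mono) (auto simp: Suc_le_eq)
    then show "15 * y * (D + 1) \<le> E" by (simp add: E_def p)
  qed
  finally have 1: "((T + 1) ^ 2 * (C + 1) * (3 * s)) ^ (D + 1) \<le> s ^ E" .
  have 2: "4 * s \<le> s ^ E"
  proof -
    have "4 * s \<le> s ^ 2 * s" using pow2[of 2] by (intro mult_le_mono1) auto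
    also have "\<dots> = s ^ 3" by (simp add: eval_nat_numeral)
    also have "\<dots> \<le> s ^ E" using y_pow by (intro exp) (simp add: E_def)
    finally show ?thesis .
  qed
  have 3: "C \<le> s ^ E"
  proof -
    have "C \<le> s ^ (12 + 5 * y)" using C by simp
    also have "\<dots> \<le> s ^ E" using y_pow by (intro exp) (simp add: E_def)
    finally show ?thesis .
  qed
  have 4: "D \<le> s ^ E"
  proof -
    have "D \<le> E" using D y_pow(2) unfolding E_def by linarith
    then have "D \<le> 2 ^ E" using less_exp[of E] by linarith
    then show ?thesis using pow2[of E] by simp
  qed
  have 5: "20 \<le> s ^ E"
  proof -
    have "20 \<le> s ^ 5" using pow2[of 5] by simp
    also have "\<dots> \<le> s ^ E" using y_pow by (intro exp) (simp add: E_def)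
    finally show ?thesis .
  qed
  have "cost_parameter q n T s \<le> 5 * s ^ E"
    unfolding cost_parameter_def Let_def Z_def[symmetric] K_def[symmetric] C_def[symmetric] D_def[symmetric]
    using 1 2 3 4 5 by linarith
  also have "\<dots> \<le> s ^ 3 * s ^ E" using pow2[of 3] by (intro mult_le_mono1) auto
  finally have "cost_parameter q n T s ^ 7 \<le> (s ^ (3 + E)) ^ 7" by (intro power_mono) (simp_all add: power_add)
  then have "2000 * cost_parameter q n T s ^ 7 + 2 \<le> 2000 * s ^ (7 * (3 + E)) + 2"
    by (simp flip: power_mult add: mult.commute)
  also have "\<dots> \<le> 2048 * s ^ (7 * (3 + E))"
  proof -
    have "1 \<le> s ^ (7 * (3 + E))" using s by simp
    then show ?thesis by linarith
  qed
  also have "\<dots> \<le> s ^ 11 * s ^ (7 * (3 + E))" using pow2[of 11] by (intro mult_le_mono1) auto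
  also have "\<dots> = s ^ (11 + 7 * (3 + E))" by (simp only: power_add)
  also have "\<dots> \<le> s ^ (8 * E)" using y_pow by (intro exp) (simp add: E_def)
  finally show ?thesis by (simp add: E_def)
qed

text \<open>As \<open>q \<ge> 1 / \<epsilon>\<close>, losing a \<open>q\<close>-th of the optimum is
  losing at most the fraction \<open>\<epsilon>\<close>. For \<open>y\<close> the ceiling of
  \<open>X = 1 / \<epsilon> * log 2 s\<close> is taken; since \<open>X \<ge> 1\<close>, it is at
  most \<open>2 * X\<close>, and \<open>2 ^ 7\<close> is the factor 128.\<close>

lemma gik_program_approx:
  fixes \<epsilon> :: real
  assumes \<epsilon>: "0 < \<epsilon>" "\<epsilon> < 1"
  shows "gik_approx_algorithm (gik_program (nat \<lceil>1 / \<epsilon>\<rceil>)) (1 - \<epsilon>)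
    (\<lambda>s. 1 * s powr (259320 * 128 * (1 / \<epsilon> * log 2 s) powr 7))" (is "gik_approx_algorithm _ _ ?\<tau>")
  unfolding gik_approx_algorithm_def
proof (intro allI impI)
  fix I assume I: "gik_instance I"
  define q where "q = nat \<lceil>1 / \<epsilon>\<rceil>"
  define s where "s = input_size I"
  define X where "X = 1 / \<epsilon> * log 2 (real s)"
  define y where "y = nat \<lceil>X\<rceil>"
  have s: "3 \<le> s" unfolding s_def by (rule input_size_bounds(1)[OF I])
  have "1 < 1 / \<epsilon>" using \<epsilon> by simp
  then have "1 < \<lceil>1 / \<epsilon>\<rceil>" by (simp add: less_ceiling_iff)
  then have q: "2 \<le> q" "1 / \<epsilon> \<le> real q" unfolding q_def by linarith+
  have "1 \<le> log 2 (real s)" using s by (simp add: le_log_iff)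
  then have "1 / \<epsilon> * 1 \<le> X" and X_log: "1 * log 2 (real s) \<le> X"
    unfolding X_def using \<epsilon> by (intro mult_left_mono mult_right_mono; simp)+
  then have X: "1 / \<epsilon> \<le> X" "1 \<le> X" using \<open>1 < 1 / \<epsilon>\<close> by auto
  have "q \<le> y" unfolding q_def y_def using X by (intro nat_mono ceiling_mono)
  have y: "X \<le> real y" "real y \<le> 2 * X" using X unfolding y_def by linarith+
  have "s \<le> 2 ^ y"
  proof -
    have "real s = 2 powr log 2 (real s)" using s by simp
    also have "\<dots> \<le> 2 powr real y" using X_log y by (intro powr_mono) auto
    also have "\<dots> = real (2 ^ y)" by (simp add: powr_realpow)
    finally show ?thesis by (simp only: of_nat_le_iff)
  qed
  have "1 \<le> items I" "1 \<le> periods I" using I by (auto simp: gik_instance_def)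
  then have cost: "2000 * cost_parameter q (items I) (periods I) s ^ 7 + 2 \<le> s ^ (259320 * y ^ 7)"
    using q \<open>q \<le> y\<close> s \<open>s \<le> 2 ^ y\<close> input_size_bounds(2,3)[OF I]
    by (intro cost_parameter_le) (auto simp: s_def)
  obtain v c S where sol: "runs (gik_program q) (encode_instance I) v c"
    "c \<le> 2000 * cost_parameter q (items I) (periods I) s ^ 7 + 2"
    "encodes_chain I v S" "feasible_chain I S" "q * max_profit I \<le> q * chain_profit I S + max_profit I"
    using solve_instance[OF I q(1)] unfolding s_def by blast
  have pow_real: "real (s ^ k) = real s powr real k" for k using s by (simp add: powr_realpow)
  have "real c \<le> real (s ^ (259320 * y ^ 7))" using sol(2) cost by (simp only: of_nat_le_iff)
  also have "\<dots> = real s powr real (259320 * y ^ 7)" by (rule pow_real)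
  also have "\<dots> \<le> real s powr (259320 * 128 * X powr 7)"
  proof (rule powr_mono)
    have "real y ^ 7 \<le> (2 * X) ^ 7" using y by (intro power_mono) auto
    then have "real y ^ 7 \<le> 128 * X ^ 7" by (simp add: power_mult_distrib)
    then show "real (259320 * y ^ 7) \<le> 259320 * 128 * X powr 7"
      using X by (simp add: powr_numeral)
  qed (use s in simp)
  finally have time: "real c \<le> ?\<tau> (real (input_size I))"
    by (simp add: X_def s_def)
  have "(1 - \<epsilon>) * real (max_profit I) \<le> real (chain_profit I S)"
  proof -
    have "real (q * max_profit I) \<le> real (q * chain_profit I S + max_profit I)"
      using sol(5) by (simp only: of_nat_le_iff)
    then have "real q * (real (max_profit I) - real (chain_profit I S)) \<le> 1 * real (max_profit I)"
      by (simp add: algebra_simps)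
    also have "\<dots> \<le> (\<epsilon> * real q) * real (max_profit I)"
      using q(2) \<epsilon> by (intro mult_right_mono) (auto simp: field_simps)
    finally have "real q * (real (max_profit I) - real (chain_profit I S)) \<le> real q * (\<epsilon> * real (max_profit I))"
      by (simp only: ac_simps)
    then have "real (max_profit I) - real (chain_profit I S) \<le> \<epsilon> * real (max_profit I)"
      using q(1) by (elim mult_left_le_imp_le) simp
    then show ?thesis by (simp add: left_diff_distrib)
  qed
  with time sol(1,3,4) show "\<exists>v c S. runs (gik_program (nat \<lceil>1 / \<epsilon>\<rceil>)) (encode_instance I) v c \<and>
      real c \<le> ?\<tau> (real (input_size I)) \<and> encodes_chain I v S \<and> feasible_chain I S \<and>
      (1 - \<epsilon>) * real (max_profit I) \<le> real (chain_profit I S)"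
    unfolding q_def by (intro exI conjI)
qed

theorem theorem5:
  "(\<exists>a>0. \<exists>b>0. \<exists>d>0. \<forall>\<epsilon>::real. 0 < \<epsilon> \<and> \<epsilon> < 1 \<longrightarrow>
      (\<exists>P. gik_approx_algorithm P (1 - \<epsilon>)
        (\<lambda>s. a * s powr (b * (1 / \<epsilon> * log 2 s) powr d)))) \<and>
   gik_admits_qptas"
proof
  show "\<exists>a>0. \<exists>b>0. \<exists>d>0. \<forall>\<epsilon>::real. 0 < \<epsilon> \<and> \<epsilon> < 1 \<longrightarrow>
      (\<exists>P. gik_approx_algorithm P (1 - \<epsilon>) (\<lambda>s. a * s powr (b * (1 / \<epsilon> * log 2 s) powr d)))"
    using gik_program_approx
    by (intro exI[of _ "1::real"] exI[of _ "259320 * 128::real"] exI[of _ "7::real"] conjI allI impI) auto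
  show gik_admits_qptas
    unfolding gik_admits_qptas_def
  proof (intro allI impI)
    fix \<epsilon> :: real assume \<epsilon>: "0 < \<epsilon> \<and> \<epsilon> < 1"
    define b where "b = 259320 * 128 * (1 / \<epsilon>) powr 7"
    \<comment> \<open>Passing to base 2 contributes one more factor \<open>log 2 s\<close>, so the
      exponent 7 becomes 8. The logarithm is positive because input sizes are at least 3.\<close>
    have "s powr (259320 * 128 * (1 / \<epsilon> * log 2 s) powr 7) = 2 powr (b * log 2 s powr 8)"
      if "3 \<le> s" for s :: real
    proof -
      have log: "0 < log 2 s" using that by simp
      have "s powr z = 2 powr (log 2 s * z)" for z
        using that by (simp add: powr_powr[symmetric])
      moreover have "log 2 s * (259320 * 128 * (1 / \<epsilon> * log 2 s) powr 7) = b * log 2 s powr 8"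
        using log \<epsilon> by (simp add: b_def powr_mult powr_numeral eval_nat_numeral)
      ultimately show ?thesis by simp
    qed
    then have "gik_approx_algorithm (gik_program (nat \<lceil>1 / \<epsilon>\<rceil>)) (1 - \<epsilon>) (\<lambda>s. 1 * 2 powr (b * log 2 s powr 8))"
      using gik_program_approx[of \<epsilon>] \<epsilon> input_size_bounds(1) unfolding gik_approx_algorithm_def
      by (metis of_nat_le_iff of_nat_numeral)
    moreover have "0 < b" using \<epsilon> by (simp add: b_def)
    ultimately show "\<exists>P. \<exists>a>0. \<exists>b>0. \<exists>d>0. gik_approx_algorithm P (1 - \<epsilon>) (\<lambda>s. a * 2 powr (b * log 2 s powr d))"
      using zero_less_one zero_less_numeral by blast
  qed
qed

end
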